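(* Let $\mathcal{A}$ be the mod 2 Steenrod algebra, let $\mathbb{V}_5$ be a $5$-dimensional $\mathbb{F}_2$-vector space, $GL_5=GL(\mathbb{V}_5)$, and let $$\mathrm{Tr}_5\colon \mathbb{F}_2\otimes_{GL_5}PH_{11}(B\mathbb{V}_5)\to \mathrm{Ext}_{\mathcal{A}}^{5,16}(\mathbb{F}_2,\mathbb{F}_2)$$ be Singer's fifth algebraic transfer in degree $11$. Then the element $P(h_2)\in \mathrm{Ext}_{\mathcal{A}}^{5,16}(\mathbb{F}_2,\mathbb{F}_2)$ is not in the image of $\mathrm{Tr}_5$.
   Context: All homology and cohomology is taken with coefficients in $\mathbb{F}_2$. $\mathbb{V}_k$ is a $k$-dimensional $\mathbb{F}_2$-vector space, $GL_k=GL(\mathbb{V}_k)$, and $P_k=H^*(B\mathbb{V}_k)=\mathbb{F}_2[x_1,\dots,x_k]$ with each $x_i$ of degree $1$; $\mathcal{A}$ acts on $P_k$ via the Steenrod squares $\mathrm{Sq}^i$ (Cartan formula, $\mathrm{Sq}^0x_j=x_j$, $\mathrm{Sq}^1x_j=x_j^2$, $\mathrm{Sq}^ix_j=0$ for $i\ge 2$), and $GL_k$ acts by linear substitutions; the two actions commute. $PH_*(B\mathbb{V}_k)\subset H_*(B\mathbb{V}_k)$ is the subspace of elements annihilated by all positive-degree operations of $\mathcal{A}$ (acting dually on homology). $\mathbb{F}_2\otimes_{GL_k}M$ denotes the coinvariants of a $GL_k$-module $M$. In each degree $d$, $\mathbb{F}_2\otimes_{GL_k}PH_d(B\mathbb{V}_k)$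 is dual to the invariants $(\mathbb{F}_2\otimes_{\mathcal{A}}P_k)_d^{GL_k}$. Singer's algebraic transfer (W. Singer, "The transfer in homological algebra", Math. Z. 202 (1989)): let $\mathcal{A}$ act on $\mathbb{F}_2[x,x^{-1}]$ by $\mathrm{Sq}^jx^i=\binom{i}{j}x^{i+j}$, and let $\hat P_1$ be the $\mathcal{A}$-submodule spanned by $x^i$, $i\ge -1$. There is a short exact sequence of $\mathcal{A}$-modules $0\to P_1\to\hat P_1\to\Sigma^{-1}\mathbb{F}_2\to 0$. Tensoring it (over $\mathbb{F}_2$, with diagonal $\mathcal{A}$-action) with $\Sigma^{-(k-i)}P_{i-1}$ gives connecting homomorphisms $\mathrm{Tor}^{\mathcal{A}}_{k-i+1}(\mathbb{F}_2,\Sigma^{-(k-i+1)}P_{i-1})\to \mathrm{Tor}^{\mathcal{A}}_{k-i}(\mathbb{F}_2,\Sigma^{-(k-i)}P_i)$ for $i=1,\dots,k$ (with $P_0=\mathbb{F}_2$). Their composite is a map $\mathrm{Tor}^{\mathcal{A}}_{k,k+d}(\mathbb{F}_2,\mathbb{F}_2)=\mathrm{Tor}^{\mathcal{A}}_{k}(\mathbb{F}_2,\Sigma^{-k}\mathbb{F}_2)_d\to \mathrm{Tor}_0^{\mathcal{A}}(\mathbb{F}_2,P_k)_d=(\mathbb{F}_2\otimes_{\mathcal{A}}P_k)_d$, whose image lies in the $GL_k$-invariants. The dual map is $\mathrm{Tr}_k\colon\mathbb{F}_2\otimes_{GL_k}PH_d(B\mathbb{V}_k)\to\mathrm{Ext}_{\mathcal{A}}^{k,k+d}(\mathbb{F}_2,\mathbb{F}_2)$.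 The element $h_i\in\mathrm{Ext}_{\mathcal{A}}^{1,2^i}(\mathbb{F}_2,\mathbb{F}_2)$ is the class corresponding to the indecomposable $\mathrm{Sq}^{2^i}$. $P$ is the Adams periodicity operator, and $P(h_2)\in\mathrm{Ext}_{\mathcal{A}}^{5,16}(\mathbb{F}_2,\mathbb{F}_2)$ is the Massey product $\langle h_2,h_0^4,h_3\rangle$; it is well known (Tangora, Bruner) that $P(h_2)\neq 0$. *)

theory Defs
  imports
    "HOL-Library.Poly_Mapping"
    "HOL-Library.Z2"
    "HOL-Library.Function_Algebras"
    "HOL-Computational_Algebra.Group_Closure"
    "Jordan_Normal_Form.Matrix"
begin

section \<open>Vector spaces over the field with two elements\<close>

text \<open>
  The vector space with basis \<open>'a\<close> is \<open>'a \<Rightarrow>\<^sub>0 bit\<close>. Every nonzero coefficient is \<open>1\<close>, so the linear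
  extension of \<open>g\<close> sums \<open>g\<close> over the support; and additive subgroups (\<^const>\<open>group_closure\<close>)
  are the same as linear subspaces (spans).
\<close>

definition lin :: "('a \<Rightarrow> 'b::comm_monoid_add) \<Rightarrow> ('a \<Rightarrow>\<^sub>0 bit) \<Rightarrow> 'b" where
  "lin g z = (\<Sum>b\<in>Poly_Mapping.keys z. g b)"

text \<open>The quotient space \<open>Z / (Z \<inter> B)\<close> is the set of classes \<open>Z // cong_mod Z B\<close>.\<close>

definition cong_mod :: "'a::ab_group_add set \<Rightarrow> 'a set \<Rightarrow> ('a \<times> 'a) set" where
  "cong_mod Z B = {(x, y). x \<in> Z \<and> y \<in> Z \<and> x - y \<in> B}"


section \<open>The Steenrod algebra\<close>

text \<open>
  The word \<open>[i\<^sub>1, \<dots>, i\<^sub>r]\<close> of positive integers stands for the monomial \<open>Sq\<^bsup>i\<^sub>1\<^esup> \<dots> Sq\<^bsup>i\<^sub>r\<^esup>\<close>. The Steenrod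
  algebra is the free associative algebra on \<open>Sq\<^bsup>i\<^esup>\<close> (\<open>i > 0\<close>), with basis all words and
  concatenation as product, modulo the two-sided ideal generated by the Adem relations, where
  \<open>Sq\<^bsup>0\<^esup> = 1\<close>.
\<close>

type_synonym word = "nat list"

definition is_word :: "word \<Rightarrow> bool" where
  "is_word w \<longleftrightarrow> 0 \<notin> set w"

definition adem :: "nat \<Rightarrow> nat \<Rightarrow> word \<Rightarrow>\<^sub>0 bit" where
  "adem a b = Poly_Mapping.single [a, b] 1 +
     (\<Sum>c\<le>a div 2. Poly_Mapping.single (if c = 0 then [a + b] else [a + b - c, c])
                      (of_nat ((b - c - 1) choose (a - 2 * c))))"

definition adem_ideal :: "(word \<Rightarrow>\<^sub>0 bit) set" where
  "adem_ideal = group_closure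
     {lin (\<lambda>w. Poly_Mapping.single (u @ w @ v) 1) (adem a b) | u v a b.
        is_word u \<and> is_word v \<and> 0 < a \<and> a < 2 * b}"


section \<open>Polynomials and their Steenrod operations\<close>

text \<open>
  All the modules needed are submodules of the ring of Laurent polynomials in variables
  \<open>x\<^sub>0, x\<^sub>1, \<dots>\<close> over the field with two elements, spanned by monomials. A tensor product of modules
  in disjoint sets of variables is the module in the union of these variables.
\<close>

type_synonym expo = "nat \<Rightarrow>\<^sub>0 int"
type_synonym laurent = "expo \<Rightarrow>\<^sub>0 bit"

definition expo_deg :: "expo \<Rightarrow> int" where
  "expo_deg m = (\<Sum>v\<in>Poly_Mapping.keys m. Poly_Mapping.lookup m v)"

text \<open>
  The binomial coefficient modulo 2. The upper argument may be negative, and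
  \<^const>\<open>gbinomial\<close> is only available over fields; its value here is an integer.
\<close>

definition binom_mod2 :: "int \<Rightarrow> nat \<Rightarrow> bit" where
  "binom_mod2 i j = of_int \<lfloor>(of_int i :: rat) gchoose j\<rfloor>"

text \<open>\<open>Sq\<^bsup>j\<^esup>(x\<^bsup>i\<^esup>) = binom(i, j) x\<^bsup>i + j\<^esup>\<close> in each variable, combined by the Cartan formula.\<close>

definition sq_monom :: "nat \<Rightarrow> expo \<Rightarrow> laurent" where
  "sq_monom j m =
     (\<Sum>e | Poly_Mapping.keys e \<subseteq> Poly_Mapping.keys m \<and>
          (\<Sum>v\<in>Poly_Mapping.keys m. Poly_Mapping.lookup e v) = j.
        Poly_Mapping.single (m + Poly_Mapping.map int e)
          (\<Prod>v\<in>Poly_Mapping.keys m.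
             binom_mod2 (Poly_Mapping.lookup m v) (Poly_Mapping.lookup e v)))"

definition sq :: "nat \<Rightarrow> laurent \<Rightarrow> laurent" where
  "sq j = lin (sq_monom j)"

definition act :: "word \<Rightarrow> laurent \<Rightarrow> laurent" where
  "act w p = foldr sq w p"

definition P_monoms :: "nat \<Rightarrow> expo set" where
  "P_monoms k = {m. Poly_Mapping.keys m \<subseteq> {..<k} \<and> (\<forall>v. 0 \<le> Poly_Mapping.lookup m v)}"

text \<open>
  The monomial basis of \<open>\<hat>P\<^sub>1 \<otimes> P\<^sub>i\<close>: here \<open>P\<^sub>i\<close> uses the variables \<open>x\<^sub>0, \<dots>, x\<^bsub>i-1\<^esub>\<close>, and \<open>\<hat>P\<^sub>1\<close>
  uses \<open>x\<^sub>i\<close>.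
\<close>

definition Phat_monoms :: "nat \<Rightarrow> expo set" where
  "Phat_monoms i = {m. Poly_Mapping.keys m \<subseteq> {..i} \<and> -1 \<le> Poly_Mapping.lookup m i \<and>
                       (\<forall>v<i. 0 \<le> Poly_Mapping.lookup m v)}"


section \<open>Bar complex, Tor and Ext\<close>

text \<open>
  Let \<open>M\<close> be a module with monomial basis \<open>E\<close>. The reduced bar complex computing
  \<open>Tor\<^sup>A(\<bbbF>\<^sub>2, M)\<close> has \<open>I(A)\<^bsup>\<otimes>n\<^esup> \<otimes> M\<close> in degree \<open>n\<close>, with \<open>I(A)\<close> the augmentation
  ideal. It is the quotient of the space with basis \<open>[w\<^sub>1 | \<dots> | w\<^sub>n] m\<close> (nonempty words \<open>w\<^sub>j\<close>,
  \<open>m \<in> E\<close>) by the subspace spanned by all \<open>[\<dots> | p | \<dots>] m\<close> with \<open>p\<close> in the Adem ideal.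
  The sets \<open>bar n t E\<close> (internal degree \<open>t\<close>) live before this quotient; all conditions below are
  imposed modulo \<open>bar_rel\<close>.
\<close>

type_synonym chain = "(word list \<times> expo) \<Rightarrow>\<^sub>0 bit"

definition bar_word_list :: "word list \<Rightarrow> bool" where
  "bar_word_list ws \<longleftrightarrow> (\<forall>w\<in>set ws. w \<noteq> [] \<and> is_word w)"

definition words_deg :: "word list \<Rightarrow> int" where
  "words_deg ws = (\<Sum>w\<leftarrow>ws. int (sum_list w))"

definition bar :: "nat \<Rightarrow> int \<Rightarrow> expo set \<Rightarrow> chain set" where
  "bar n t E = {z. Poly_Mapping.keys z \<subseteq>
     {(ws, m). length ws = n \<and> bar_word_list ws \<and> m \<in> E \<and> words_deg ws + expo_deg m = t}}"

definition bar_rel :: "chain set" where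
  "bar_rel = group_closure
     {lin (\<lambda>w. Poly_Mapping.single (us @ [w] @ vs, m) 1) p | us vs m p. p \<in> adem_ideal}"

fun bar_d_basis :: "word list \<times> expo \<Rightarrow> chain" where
  "bar_d_basis (ws, m) =
     (\<Sum>i<length ws - 1.
        Poly_Mapping.single (take i ws @ [ws ! i @ ws ! Suc i] @ drop (i + 2) ws, m) 1) +
     (if ws = [] then 0
      else lin (\<lambda>m'. Poly_Mapping.single (butlast ws, m') 1)
             (act (last ws) (Poly_Mapping.single m 1)))"

definition bar_d :: "chain \<Rightarrow> chain" where
  "bar_d = lin bar_d_basis"

definition tor_cycles :: "nat \<Rightarrow> int \<Rightarrow> nat \<Rightarrow> chain set" where
  "tor_cycles n t k = {z \<in> bar n t (P_monoms k). bar_d z \<in> bar_rel}"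

definition tor_boundaries :: "nat \<Rightarrow> int \<Rightarrow> nat \<Rightarrow> chain set" where
  "tor_boundaries n t k =
     {y \<in> bar n t (P_monoms k). \<exists>w\<in>bar (Suc n) t (P_monoms k). y - bar_d w \<in> bar_rel}"

text \<open>
  \<open>Tor\<^sup>A\<^sub>n(\<bbbF>\<^sub>2, P\<^sub>k)\<close> in internal degree \<open>t\<close>; since suspensions only shift degrees, this is also
  \<open>Tor\<^sup>A\<^sub>n(\<bbbF>\<^sub>2, \<Sigma>\<^bsup>-j\<^esup> P\<^sub>k)\<close> in internal degree \<open>t - j\<close>.
\<close>

definition Tor :: "nat \<Rightarrow> int \<Rightarrow> nat \<Rightarrow> chain set set" where
  "Tor n t k = tor_cycles n t k // cong_mod (tor_cycles n t k) (tor_boundaries n t k)"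

text \<open>
  \<open>Ext\<^sub>A\<^bsup>s,t\<^esup>(\<bbbF>\<^sub>2, \<bbbF>\<^sub>2)\<close> is the cohomology of the dual of the bar complex of
  \<open>\<bbbF>\<^sub>2 = P\<^sub>0\<close>. A cochain is given by its values on the basis elements
  \<open>[w\<^sub>1 | \<dots> | w\<^sub>s] 1\<close>.
\<close>

type_synonym cochain = "word list \<Rightarrow> bit"

definition cochain_eval :: "cochain \<Rightarrow> chain \<Rightarrow> bit" where
  "cochain_eval c z = lin (\<lambda>(ws, m). c ws) z"

definition cochains :: "nat \<Rightarrow> int \<Rightarrow> cochain set" where
  "cochains s t = {c. (\<forall>ws. c ws \<noteq> 0 \<longrightarrow> length ws = s \<and> bar_word_list ws \<and> words_deg ws = t) \<and>
                      (\<forall>z \<in> bar s t (P_monoms 0) \<inter> bar_rel. cochain_eval c z = 0)}"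

definition coboundary :: "cochain \<Rightarrow> cochain" where
  "coboundary c ws =
     (if bar_word_list ws then cochain_eval c (bar_d (Poly_Mapping.single (ws, 0) 1)) else 0)"

definition ext_cocycles :: "nat \<Rightarrow> int \<Rightarrow> cochain set" where
  "ext_cocycles s t = {c \<in> cochains s t. coboundary c = 0}"

fun ext_coboundaries :: "nat \<Rightarrow> int \<Rightarrow> cochain set" where
  "ext_coboundaries 0 t = {0}"
| "ext_coboundaries (Suc s) t = coboundary ` cochains s t"

definition ext_rel :: "nat \<Rightarrow> int \<Rightarrow> (cochain \<times> cochain) set" where
  "ext_rel s t = cong_mod (ext_cocycles s t) (ext_coboundaries s t)"

definition Ext :: "nat \<Rightarrow> int \<Rightarrow> cochain set set" where
  "Ext s t = ext_cocycles s t // ext_rel s t"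

definition ext_class :: "nat \<Rightarrow> int \<Rightarrow> cochain \<Rightarrow> cochain set" where
  "ext_class s t c = ext_rel s t `` {c}"


section \<open>Products, Massey products and the Adams periodicity operator\<close>

definition cup :: "nat \<Rightarrow> cochain \<Rightarrow> cochain \<Rightarrow> cochain" where
  "cup p a b ws = a (take p ws) * b (drop p ws)"

text \<open>
  In the next definitions, a pair \<open>(s, t)\<close> is the bidegree of the class that follows. The union
  in \<open>ext_mult\<close> is over equal classes.
\<close>

fun ext_mult :: "nat \<times> int \<Rightarrow> nat \<times> int \<Rightarrow> cochain set \<Rightarrow> cochain set \<Rightarrow> cochain set" where
  "ext_mult (p, t) (q, u) X Y = (\<Union>a\<in>X. \<Union>b\<in>Y. ext_class (p + q) (t + u) (cup p a b))"

fun ext_power :: "nat \<times> int \<Rightarrow> cochain set \<Rightarrow> nat \<Rightarrow> cochain set" where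
  "ext_power (p, t) X 0 = ext_class 0 0 (\<lambda>ws. if ws = [] then 1 else 0)"
| "ext_power (p, t) X (Suc n) = ext_mult (p, t) (n * p, int n * t) X (ext_power (p, t) X n)"

fun massey :: "nat \<times> int \<Rightarrow> nat \<times> int \<Rightarrow> nat \<times> int \<Rightarrow>
    cochain set \<Rightarrow> cochain set \<Rightarrow> cochain set \<Rightarrow> cochain set set" where
  "massey (p, t) (q, u) (r, v) X Y Z =
     {ext_class (p + q + r - 1) (t + u + v) (cup (p + q - 1) e c + cup p a f) | a b c e f.
        a \<in> X \<and> b \<in> Y \<and> c \<in> Z \<and>
        e \<in> cochains (p + q - 1) (t + u) \<and> coboundary e = cup p a b \<and>
        f \<in> cochains (q + r - 1) (u + v) \<and> coboundary f = cup q b c}"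

text \<open>\<open>h\<^sub>i\<close>, of bidegree \<open>(1, 2\<^sup>i)\<close>: the functional on \<open>I(A)\<close> that is \<open>1\<close> on \<open>Sq\<^bsup>2^i\<^esup>\<close> and \<open>0\<close> on decomposables.\<close>

definition h :: "nat \<Rightarrow> cochain set" where
  "h i = ext_class 1 (2 ^ i) (\<lambda>ws. if ws = [[2 ^ i]] then 1 else 0)"

text \<open>
  The Adams periodicity operator \<open>P(x) = \<langle>x, h\<^sub>0\<^sup>4, h\<^sub>3\<rangle>\<close>, for \<open>x\<close> of bidegree \<open>(s, t)\<close>. Like every
  Massey product it is a set of classes; it is a single class for \<open>x = h\<^sub>2\<close>, because
  the indeterminacy lies in \<open>h\<^sub>2 Ext\<^bsup>4,12\<^esup> + h\<^sub>3 Ext\<^bsup>4,8\<^esup> = 0\<close>.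
\<close>

definition adams_P :: "nat \<times> int \<Rightarrow> cochain set \<Rightarrow> cochain set set" where
  "adams_P st x = massey st (4, 4) (1, 8) x (ext_power (1, 1) (h 0) 4) (h 3)"


section \<open>Homology of elementary abelian groups and coinvariants\<close>

text \<open>
  \<open>H\<^sub>d(BV\<^sub>k)\<close> is the space of functionals on degree \<open>d\<close> of \<open>P\<^sub>k\<close>, given by their values
  on monomials. Steenrod operations and linear substitutions act on it by transposition.
\<close>

definition homology_BV :: "nat \<Rightarrow> int \<Rightarrow> (expo \<Rightarrow> bit) set" where
  "homology_BV k d = {f. \<forall>m. f m \<noteq> 0 \<longrightarrow> m \<in> P_monoms k \<and> expo_deg m = d}"

definition PH :: "nat \<Rightarrow> int \<Rightarrow> (expo \<Rightarrow> bit) set" where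
  "PH k d = {f \<in> homology_BV k d.
     \<forall>w. is_word w \<and> w \<noteq> [] \<longrightarrow> (\<forall>m\<in>P_monoms k. lin f (act w (Poly_Mapping.single m 1)) = 0)}"

definition GL :: "nat \<Rightarrow> bit mat set" where
  "GL k = {g \<in> carrier_mat k k. invertible_mat g}"

definition subst_monom :: "nat \<Rightarrow> bit mat \<Rightarrow> expo \<Rightarrow> laurent" where
  "subst_monom k g m =
     (\<Prod>j\<in>Poly_Mapping.keys m.
        (\<Sum>i<k. Poly_Mapping.single (Poly_Mapping.single i 1) (g $$ (i, j)))
          ^ nat (Poly_Mapping.lookup m j))"

definition GL_act :: "nat \<Rightarrow> bit mat \<Rightarrow> (expo \<Rightarrow> bit) \<Rightarrow> expo \<Rightarrow> bit" where
  "GL_act k g f m = (if m \<in> P_monoms k then lin f (subst_monom k g m) else 0)"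

definition PH_coinvariants :: "nat \<Rightarrow> int \<Rightarrow> (expo \<Rightarrow> bit) set set" where
  "PH_coinvariants k d =
     PH k d // cong_mod (PH k d) (group_closure {GL_act k g f - f | g f. g \<in> GL k \<and> f \<in> PH k d})"


section \<open>Singer's algebraic transfer\<close>

text \<open>
  The projection \<open>\<hat>P\<^sub>1 \<otimes> P\<^sub>i \<rightarrow> \<Sigma>\<^bsup>-1\<^esup> P\<^sub>i\<close>, which takes the coefficient of \<open>x\<^sub>i\<^bsup>-1\<^esup>\<close>, on
  bar complexes.
\<close>

definition bar_proj :: "nat \<Rightarrow> chain \<Rightarrow> chain" where
  "bar_proj i = lin (\<lambda>(ws, m).
     if Poly_Mapping.lookup m i = -1
     then Poly_Mapping.single (ws, m + Poly_Mapping.single i 1) 1 else 0)"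

text \<open>
  The connecting homomorphism \<open>Tor\<^bsub>n+1\<^esub>(\<bbbF>\<^sub>2, P\<^sub>i)\<^bsub>t+1\<^esub> \<rightarrow> Tor\<^sub>n(\<bbbF>\<^sub>2, P\<^bsub>i+1\<^esub>)\<^sub>t\<close> of
  \<open>0 \<rightarrow> P\<^bsub>i+1\<^esub> \<rightarrow> \<hat>P\<^sub>1 \<otimes> P\<^sub>i \<rightarrow> \<Sigma>\<^bsup>-1\<^esup> P\<^sub>i \<rightarrow> 0\<close>. By the snake lemma the cycles \<open>y\<close> obtained from a
  homology class \<open>X\<close> form exactly one homology class.
\<close>

definition connecting :: "nat \<Rightarrow> nat \<Rightarrow> int \<Rightarrow> chain set \<Rightarrow> chain set" where
  "connecting i n t X =
     {y \<in> tor_cycles n t (Suc i).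
        \<exists>z\<in>X. \<exists>w\<in>bar (Suc n) t (Phat_monoms i).
          bar_proj i w - z \<in> bar_rel \<and> bar_d w - y \<in> bar_rel}"

text \<open>
  The composite of the first \<open>i\<close> connecting homomorphisms,
  \<open>Tor\<^sub>k(\<bbbF>\<^sub>2, \<Sigma>\<^bsup>-k\<^esup> \<bbbF>\<^sub>2)\<^sub>d \<rightarrow> Tor\<^bsub>k-i\<^esub>(\<bbbF>\<^sub>2, \<Sigma>\<^bsup>-(k-i)\<^esup> P\<^sub>i)\<^sub>d\<close>.
\<close>

primrec connecting_iter :: "nat \<Rightarrow> int \<Rightarrow> nat \<Rightarrow> chain set \<Rightarrow> chain set" where
  "connecting_iter k d 0 X = X"
| "connecting_iter k d (Suc i) X =
     connecting i (k - Suc i) (d + int (k - Suc i)) (connecting_iter k d i X)"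

definition tor_transfer :: "nat \<Rightarrow> int \<Rightarrow> chain set \<Rightarrow> chain set" where
  "tor_transfer k d X = connecting_iter k d k X"

text \<open>
  The dual of \<open>tor_transfer\<close>, using that \<open>Ext\<^bsup>k,k+d\<^esup>\<close> is the dual of \<open>Tor\<^bsub>k,k+d\<^esub>\<close> by evaluation:
  \<open>f\<close> is sent to the class of all cocycles that restrict on homology to \<open>f \<circ> tor_transfer k d\<close>.
\<close>

definition transfer_PH :: "nat \<Rightarrow> int \<Rightarrow> (expo \<Rightarrow> bit) \<Rightarrow> cochain set" where
  "transfer_PH k d f =
     {c \<in> ext_cocycles k (int k + d).
        \<forall>X\<in>Tor k (int k + d) 0. \<forall>z\<in>X. \<forall>y\<in>tor_transfer k d X.
          cochain_eval c z = lin (\<lambda>(ws, m). f m) y}"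

text \<open>
  On coinvariants. The union is over equal classes, because the image of \<open>tor_transfer\<close> is
  \<open>GL\<^sub>k\<close>-invariant.
\<close>

definition Tr :: "nat \<Rightarrow> int \<Rightarrow> (expo \<Rightarrow> bit) set \<Rightarrow> cochain set" where
  "Tr k d C = (\<Union>f\<in>C. transfer_PH k d f)"

end

theory Submission
  imports Defs "HOL-Computational_Algebra.Formal_Power_Series"
begin

text \<open>
  In the Milnor basis put \<open>Q\<^sub>0 = Sq\<^bsup>1\<^esup>\<close>, \<open>Q\<^sub>1 = [Sq\<^bsup>2\<^esup>, Q\<^sub>0]\<close>, \<open>Q\<^sub>2 = [Sq\<^bsup>4\<^esup>, Q\<^sub>1]\<close> and \<open>R = [Sq\<^bsup>4\<^esup>, Sq\<^bsup>2\<^esup>] = Sq(0,2)\<close>.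
  Since \<open>[Sq\<^bsup>4\<^esup>, Q\<^sub>1] = Q\<^sub>2 = [R, Q\<^sub>0]\<close>, \<open>[R, Q\<^sub>1] = [Q\<^sub>0, Q\<^sub>1] = 0\<close> and \<open>Q\<^sub>0\<^sup>2 = Q\<^sub>1\<^sup>2 = 0\<close>, the sum of all shuffles of
  \<open>Sq\<^bsup>4\<^esup>\<close> into \<open>[Q\<^sub>1|Q\<^sub>1|Q\<^sub>1|Q\<^sub>1]\<close> and of \<open>R, Q\<^sub>0\<close> into \<open>[Q\<^sub>1|Q\<^sub>1|Q\<^sub>1]\<close> is a cycle in the bar complex, of bidegree
  (5, 16). It pairs to 1 with every representative of the Massey product: contracting it with \<open>h\<^sub>3\<close> on
  the right gives 0, contracting it with \<open>h\<^sub>2\<close> on the left gives \<open>[Q\<^sub>1|Q\<^sub>1|Q\<^sub>1|Q\<^sub>1]\<close>, and the latter is the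
  boundary of a chain in which \<open>[Sq\<^bsup>1\<^esup>|Sq\<^bsup>1\<^esup>|Sq\<^bsup>1\<^esup>|Sq\<^bsup>1\<^esup>|Sq\<^bsup>8\<^esup>]\<close> occurs once.

  On the other hand its transfer is zero modulo hit elements. Each of the five steps of the transfer
  multiplies by some \<open>x\<^sub>i\<^bsup>-1\<^esup>\<close> and applies one bar entry. An operation of odd degree lowers the number
  of odd exponents of a monomial and one of even degree does not raise it. Four of the five entries
  have odd degree, so every monomial of the resulting polynomial of degree 11 has exactly one odd
  exponent, that is, it has the form \<open>x\<^sub>v n\<^sup>2\<close> with \<open>deg n = 5\<close>, and such monomials are hit. Thus a class in
  the image of the transfer vanishes on the cycle.
\<close>

section \<open>Linear algebra over the field with two elements\<close>

text \<open>Signs and differences disappear in characteristic 2; the class provides these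
  cancellations uniformly for coefficients, polynomials, algebra elements and chains.\<close>

class boolean_group = ab_group_add +
  assumes add_self [simp]: "x + x = 0"
begin

lemma add_self_left [simp]: "x + (x + y) = y"
  by (simp flip: add.assoc)

lemma minus_self [simp]: "- x = x"
  using add_self by (rule minus_unique)

lemma diff_eq_add: "x - y = x + y"
  using diff_conv_add_uminus by simp

lemma add_eq_0_iff_eq: "x + y = 0 \<longleftrightarrow> x = y"
  using eq_iff_diff_eq_0 diff_eq_add by metis

end

instance bit :: boolean_group
  by standard (metis bit_not_zero_iff bit_2_eq_0 mult_2 mult_zero_left)

instance poly_mapping :: (type, boolean_group) boolean_group
  by standard (simp add: poly_mapping_eq_iff lookup_add fun_eq_iff)

lemma keys_add_bit:
  fixes x y :: "'a \<Rightarrow>\<^sub>0 bit"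
  shows "Poly_Mapping.keys (x + y) = (Poly_Mapping.keys x - Poly_Mapping.keys y) \<union> (Poly_Mapping.keys y - Poly_Mapping.keys x)"
  by (auto simp: in_keys_iff lookup_add)

lemma lin_superset:
  assumes "finite A" "Poly_Mapping.keys z \<subseteq> A"
  shows "lin g z = (\<Sum>b\<in>A. if b \<in> Poly_Mapping.keys z then g b else 0)"
  unfolding lin_def using assms by (intro sum.mono_neutral_cong_left) auto

text \<open>A basis element in both supports drops out of \<open>x + y\<close>, and its two
  contributions on the right cancel because the target has exponent 2.\<close>

lemma lin_add [simp]:
  fixes g :: "'a \<Rightarrow> 'b::boolean_group"
  shows "lin g (x + y) = lin g x + lin g y"
proof -
  let ?A = "Poly_Mapping.keys x \<union> Poly_Mapping.keys y"
  have "lin g (x + y) = (\<Sum>b\<in>?A. if b \<in> Poly_Mapping.keys (x + y) then g b else 0)"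
    by (rule lin_superset) (auto simp: keys_add_bit)
  also have "\<dots> = (\<Sum>b\<in>?A. (if b \<in> Poly_Mapping.keys x then g b else 0) + (if b \<in> Poly_Mapping.keys y then g b else 0))"
    by (rule sum.cong) (auto simp: keys_add_bit)
  also have "\<dots> = lin g x + lin g y"
    by (simp add: sum.distrib lin_superset[of ?A])
  finally show ?thesis .
qed

lemma lin_0 [simp]: "lin g 0 = 0"
  by (simp add: lin_def)

lemma lin_single [simp]: "lin g (Poly_Mapping.single k 1) = g k"
  by (simp add: lin_def)

lemma lin_zero_fun [simp]: "lin (\<lambda>_. 0) z = 0"
  by (simp add: lin_def)

lemma lin_fun_add: "lin (\<lambda>b. g b + g' b) z = lin g z + lin g' z"
  by (simp add: lin_def sum.distrib)

text \<open>The only nonzero coefficient is 1, so additive identities can be tested on basis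
  elements.\<close>

lemma bit_poly_induct [case_names zero single add]:
  fixes z :: "'a \<Rightarrow>\<^sub>0 bit"
  assumes "P 0" "\<And>k. P (Poly_Mapping.single k 1)" "\<And>x y. P x \<Longrightarrow> P y \<Longrightarrow> P (x + y)"
  shows "P z"
proof (induction z rule: update_induct)
  case const
  show ?case by fact
next
  case (update f a b)
  have "Poly_Mapping.update a b f = Poly_Mapping.single a 1 + f"
    using update
    by (intro poly_mapping_eqI) (auto simp: lookup_update lookup_add lookup_single when_def in_keys_iff)
  then show ?case using assms update by simp
qed

lemma lin_id: "lin (\<lambda>k. Poly_Mapping.single k 1) z = z"
  by (induction z rule: bit_poly_induct) auto

lemma sum_single_keys_bit: "(\<Sum>k\<in>Poly_Mapping.keys z. Poly_Mapping.single k 1) = (z :: 'a \<Rightarrow>\<^sub>0 bit)"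
  using lin_id[of z] by (simp add: lin_def)

lemma keys_lin: 
  fixes g :: "'a \<Rightarrow> 'b \<Rightarrow>\<^sub>0 bit"
  assumes "x \<in> Poly_Mapping.keys (lin g z)"
  obtains b where "b \<in> Poly_Mapping.keys z" "x \<in> Poly_Mapping.keys (g b)"
proof -
  have "Poly_Mapping.keys (lin g z) \<subseteq> (\<Union>b\<in>Poly_Mapping.keys z. Poly_Mapping.keys (g b))"
  proof -
    have "Poly_Mapping.keys (sum g A) \<subseteq> (\<Union>b\<in>A. Poly_Mapping.keys (g b))" for A
      by (induction A rule: infinite_finite_induct) (auto simp: keys_add_bit)
    then show ?thesis by (simp add: lin_def)
  qed
  with assms that show thesis by blast
qed

lemma lin_compose:
  fixes g :: "'b \<Rightarrow> 'c::boolean_group" and g' :: "'a \<Rightarrow> 'b \<Rightarrow>\<^sub>0 bit"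
  shows "lin g (lin g' z) = lin (\<lambda>b. lin g (g' b)) z"
  by (induction z rule: bit_poly_induct) auto

lemma lin_cong: "(\<And>b. b \<in> Poly_Mapping.keys z \<Longrightarrow> g b = g' b) \<Longrightarrow> lin g z = lin g' z"
  by (simp add: lin_def)

section \<open>Steenrod operations on Laurent polynomials\<close>

text \<open>Binomial coefficients with integer upper argument are integers, in the negative case by
  upper negation. Hence the floor in \<open>binom_mod2\<close> loses nothing.\<close>

lemma of_int_floor_gbinomial: "of_int \<lfloor>(of_int i :: rat) gchoose j\<rfloor> = (of_int i gchoose j :: rat)"
proof -
  have "\<exists>z. (of_int i gchoose j :: rat) = of_int z"
  proof (cases "i \<ge> 0")
    case True
    then obtain n where "i = int n" using zero_le_imp_eq_int by blast
    then have "(of_int i gchoose j :: rat) = of_int (int (n choose j))"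
      by (simp add: binomial_gbinomial)
    then show ?thesis ..
  next
    case False
    then obtain n where n: "i = - int (Suc n)" using negD by fastforce
    have "of_nat j - of_int i - 1 = (of_nat (j + n) :: rat)"
      unfolding n by simp
    then have "(of_int i gchoose j :: rat) = (-1) ^ j * (of_nat (j + n) gchoose j)"
      by (simp only: gbinomial_negated_upper[of "of_int i"])
    also have "\<dots> = of_int ((-1) ^ j * int ((j + n) choose j))"
      by (simp add: binomial_gbinomial)
    finally show ?thesis ..
  qed
  then show ?thesis by auto
qed

text \<open>Vandermonde convolution over the rationals, pulled back to the integers and reduced
  modulo 2.\<close>

lemma binom_mod2_add: "binom_mod2 (i + i') j = (\<Sum>k=0..j. binom_mod2 i k * binom_mod2 i' (j - k))"
proof -
  let ?B = "\<lambda>i j. \<lfloor>(of_int i :: rat) gchoose j\<rfloor>"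
  have "(of_int (?B (i + i') j) :: rat) = (of_int i + of_int i') gchoose j"
    unfolding of_int_floor_gbinomial by simp
  also have "\<dots> = (\<Sum>k=0..j. of_int (?B i k) * of_int (?B i' (j - k)))"
    by (simp only: of_int_floor_gbinomial gbinomial_Vandermonde[symmetric] atMost_atLeast0)
  finally have "?B (i + i') j = (\<Sum>k=0..j. ?B i k * ?B i' (j - k))"
    by (simp only: of_int_eq_iff flip: of_int_sum of_int_mult)
  then show ?thesis
    by (simp only: binom_mod2_def of_int_sum of_int_mult)
qed

lemma binom_mod2_0_right [simp]: "binom_mod2 i 0 = 1"
  by (simp add: binom_mod2_def)

lemma binom_mod2_of_nat: "binom_mod2 (int n) j = of_nat (n choose j)"
proof -
  have "(of_int (int n) :: rat) gchoose j = of_int (int (n choose j))"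
    by (simp add: binomial_gbinomial)
  then have "binom_mod2 (int n) j = of_int (int (n choose j))"
    by (simp only: binom_mod2_def floor_of_int)
  then show ?thesis by simp
qed

lemma binom_mod2_0: "binom_mod2 0 j = (if j = 0 then 1 else 0)"
  using binom_mod2_of_nat[of 0 j] by (cases j) auto

lemma binom_mod2_1: "binom_mod2 1 j = (if j \<le> 1 then 1 else 0)"
  using binom_mod2_of_nat[of 1 j] by (cases j; cases "j - 1") auto

lemma binom_mod2_minus1: "binom_mod2 (-1) j = 1"
proof -
  have "(of_int (-1) :: rat) gchoose j = of_int ((-1) ^ j)"
    using gbinomial_minus[of "1 :: rat" j] gbinomial_of_nat_symmetric[of j j]
    by simp
  then have "binom_mod2 (-1) j = of_int ((-1) ^ j)"
    by (simp only: binom_mod2_def floor_of_int)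
  also have "\<dots> = 1" by simp
  finally show ?thesis .
qed

text \<open>The expansion of \<open>x^n (1 + x t)^n\<close>, where \<open>x\<close> is the variable
  with index \<open>v\<close> and \<open>t\<close> is the formal variable: all squares of a power of
  \<open>x\<close> in one series.\<close>

definition var_sq :: "nat \<Rightarrow> int \<Rightarrow> laurent fps" where
  "var_sq v n = Abs_fps (\<lambda>k. Poly_Mapping.single (Poly_Mapping.single v (n + int k)) (binom_mod2 n k))"

definition total_sq :: "laurent \<Rightarrow> laurent fps" where
  "total_sq p = Abs_fps (\<lambda>j. sq j p)"

lemma total_sq_nth [simp]: "fps_nth (total_sq p) j = sq j p"
  by (simp add: total_sq_def)

lemma var_sq_nth:
  "fps_nth (var_sq v n) k = Poly_Mapping.single (Poly_Mapping.single v (n + int k)) (binom_mod2 n k)"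
  by (simp add: var_sq_def)

lemma single_sum: "(\<Sum>k\<in>A. Poly_Mapping.single b (f k)) = Poly_Mapping.single b (sum f A :: bit)"
  by (induction A rule: infinite_finite_induct) (auto simp: single_add)

lemma sum_single_keys:
  assumes "finite V" "Poly_Mapping.keys m \<subseteq> V"
  shows "(\<Sum>v\<in>V. Poly_Mapping.single v (Poly_Mapping.lookup m v)) = (m :: 'a \<Rightarrow>\<^sub>0 'b::comm_monoid_add)"
proof (rule poly_mapping_eqI)
  fix k
  have "Poly_Mapping.lookup (\<Sum>v\<in>V. Poly_Mapping.single v (Poly_Mapping.lookup m v)) k =
    (\<Sum>v\<in>V. if v = k then Poly_Mapping.lookup m k else 0)"
    unfolding lookup_sum by (rule sum.cong) (auto simp: lookup_single when_def)
  also have "\<dots> = Poly_Mapping.lookup m k"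
    using assms by (auto simp: sum.delta in_keys_iff)
  finally show "Poly_Mapping.lookup (\<Sum>v\<in>V. Poly_Mapping.single v (Poly_Mapping.lookup m v)) k = Poly_Mapping.lookup m k" .
qed

lemma var_sq_add: "var_sq v (n + n') = var_sq v n * var_sq v n'"
proof (rule fps_ext)
  fix j
  have "fps_nth (var_sq v n * var_sq v n') j = (\<Sum>i=0..j. Poly_Mapping.single
      (Poly_Mapping.single v (n + int i) + Poly_Mapping.single v (n' + int (j - i)))
      (binom_mod2 n i * binom_mod2 n' (j - i)))"
    by (simp add: fps_mult_nth var_sq_def mult_single)
  also have "\<dots> = (\<Sum>i=0..j. Poly_Mapping.single
      (Poly_Mapping.single v (n + n' + int j)) (binom_mod2 n i * binom_mod2 n' (j - i)))"
    by (rule sum.cong) (auto simp: algebra_simps of_nat_diff simp flip: single_add)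
  also have "\<dots> = fps_nth (var_sq v (n + n')) j"
    by (simp add: single_sum var_sq_def binom_mod2_add)
  finally show "fps_nth (var_sq v (n + n')) j = fps_nth (var_sq v n * var_sq v n') j" by simp
qed

lemma var_sq_0: "var_sq v 0 = 1"
  by (rule fps_ext) (auto simp: var_sq_def binom_mod2_0)

definition sq_expos :: "nat set \<Rightarrow> nat \<Rightarrow> (nat \<Rightarrow>\<^sub>0 nat) set" where
  "sq_expos V j = {e. Poly_Mapping.keys e \<subseteq> V \<and> (\<Sum>v\<in>V. Poly_Mapping.lookup e v) = j}"

lemma sq_expos_empty: "sq_expos {} j = (if j = 0 then {0} else {})"
  by (auto simp: sq_expos_def)

text \<open>Splitting off the exponent at \<open>v\<close> mirrors the convolution by which one more
  factor \<open>var_sq\<close> is multiplied in.\<close>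

lemma sq_expos_insert:
  assumes "finite V" "v \<notin> V"
  shows "sq_expos (insert v V) j =
    (\<lambda>(i, e). Poly_Mapping.single v i + e) ` (SIGMA i:{0..j}. sq_expos V (j - i))" (is "?L = ?R")
proof
  show "?L \<subseteq> ?R"
  proof
    fix e assume e: "e \<in> ?L"
    define e' where "e' = Poly_Mapping.update v 0 e"
    have eq: "e = Poly_Mapping.single v (Poly_Mapping.lookup e v) + e'"
      by (rule poly_mapping_eqI) (auto simp: e'_def lookup_update lookup_add lookup_single when_def)
    have s: "(\<Sum>w\<in>V. Poly_Mapping.lookup e' w) = (\<Sum>w\<in>V. Poly_Mapping.lookup e w)"
      using assms by (intro sum.cong) (auto simp: e'_def lookup_update)
    have k: "Poly_Mapping.keys e' = Poly_Mapping.keys e - {v}"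
      by (simp add: e'_def keys_update)
    have "Poly_Mapping.lookup e v \<in> {0..j} \<and> e' \<in> sq_expos V (j - Poly_Mapping.lookup e v)"
      using e assms s by (auto simp: sq_expos_def k)
    then have "(\<lambda>(i, e). Poly_Mapping.single v i + e) (Poly_Mapping.lookup e v, e') \<in> ?R"
      by (intro imageI) auto
    then show "e \<in> ?R" using eq by simp
  qed
  show "?R \<subseteq> ?L"
  proof clarify
    fix i e assume *: "i \<in> {0..j}" "e \<in> sq_expos V (j - i)"
    have "Poly_Mapping.lookup e v = 0"
      using * assms by (auto simp: sq_expos_def in_keys_iff)
    moreover have "(\<Sum>w\<in>V. Poly_Mapping.lookup (Poly_Mapping.single v i + e) w) = (\<Sum>w\<in>V. Poly_Mapping.lookup e w)"
      using assms by (intro sum.cong) (auto simp: lookup_add lookup_single when_def)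
    ultimately show "Poly_Mapping.single v i + e \<in> ?L"
      using * assms keys_add[of "Poly_Mapping.single v i" e]
      by (auto simp: sq_expos_def lookup_add split: if_splits)
  qed
qed

lemma finite_sq_expos: "finite V \<Longrightarrow> finite (sq_expos V j)"
  by (induction V arbitrary: j rule: finite_induct) (auto simp: sq_expos_empty sq_expos_insert)

lemma prod_var_sq_nth:
  assumes "finite V"
  shows "fps_nth (\<Prod>v\<in>V. var_sq v (n v)) j = (\<Sum>e\<in>sq_expos V j.
    Poly_Mapping.single (\<Sum>v\<in>V. Poly_Mapping.single v (n v + int (Poly_Mapping.lookup e v)))
      (\<Prod>v\<in>V. binom_mod2 (n v) (Poly_Mapping.lookup e v)))"
  using assms
proof (induction V arbitrary: j rule: finite_induct)
  case empty
  then show ?case by (auto simp: sq_expos_empty)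
next
  case (insert v V)
  let ?f = "\<lambda>V e. Poly_Mapping.single (\<Sum>v\<in>V. Poly_Mapping.single v (n v + int (Poly_Mapping.lookup e v)))
      (\<Prod>v\<in>V. binom_mod2 (n v) (Poly_Mapping.lookup e v))"
  let ?g = "\<lambda>(i, e). Poly_Mapping.single v i + e"
  have inj: "inj_on ?g (SIGMA i:{0..j}. sq_expos V (j - i))"
  proof (rule inj_onI, clarify)
    fix i e i' e'
    assume *: "e \<in> sq_expos V (j - i)" "e' \<in> sq_expos V (j - i')"
      "Poly_Mapping.single v i + e = Poly_Mapping.single v i' + e'"
    have "Poly_Mapping.lookup e v = 0" "Poly_Mapping.lookup e' v = 0"
      using * insert.hyps by (auto simp: sq_expos_def in_keys_iff)
    moreover have "Poly_Mapping.lookup (Poly_Mapping.single v i + e) v = Poly_Mapping.lookup (Poly_Mapping.single v i' + e') v"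
      using * by simp
    ultimately have "i = i'" by (simp add: lookup_add)
    then show "i = i' \<and> e = e'" using * by simp
  qed
  have transfer_step: "?f (insert v V) (Poly_Mapping.single v i + e) =
      Poly_Mapping.single (Poly_Mapping.single v (n v + int i)) (binom_mod2 (n v) i) * ?f V e"
    if "e \<in> sq_expos V (j - i)" for i e
  proof -
    have "Poly_Mapping.lookup e v = 0"
      using that insert.hyps by (auto simp: sq_expos_def in_keys_iff)
    moreover have "Poly_Mapping.lookup (Poly_Mapping.single v i + e) w = Poly_Mapping.lookup e w" if "w \<in> V" for w
      using that insert.hyps by (auto simp: lookup_add lookup_single when_def)
    ultimately show ?thesis
      using insert.hyps by (simp add: mult_single lookup_add)
  qed
  have "(\<Sum>e\<in>sq_expos (insert v V) j. ?f (insert v V) e) =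
      (\<Sum>(i, e)\<in>(SIGMA i:{0..j}. sq_expos V (j - i)). ?f (insert v V) (Poly_Mapping.single v i + e))"
    unfolding sq_expos_insert[OF insert.hyps] sum.reindex[OF inj] by (simp add: case_prod_unfold)
  also have "\<dots> = (\<Sum>(i, e)\<in>(SIGMA i:{0..j}. sq_expos V (j - i)).
      Poly_Mapping.single (Poly_Mapping.single v (n v + int i)) (binom_mod2 (n v) i) * ?f V e)"
    by (rule sum.cong) (auto simp only: transfer_step mem_Sigma_iff split: prod.splits)
  also have "\<dots> = (\<Sum>i=0..j. \<Sum>e\<in>sq_expos V (j - i).
      Poly_Mapping.single (Poly_Mapping.single v (n v + int i)) (binom_mod2 (n v) i) * ?f V e)"
    using finite_sq_expos[OF insert.hyps(1)] by (simp add: sum.Sigma)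
  also have "\<dots> = fps_nth (var_sq v (n v) * (\<Prod>v\<in>V. var_sq v (n v))) j"
    by (simp only: fps_mult_nth insert.IH sum_distrib_left var_sq_nth)
  finally show ?case using insert.hyps by simp
qed

lemma lookup_map_int: "Poly_Mapping.lookup (Poly_Mapping.map int e) v = int (Poly_Mapping.lookup e v)"
  by (simp add: Poly_Mapping.map.rep_eq when_def)

text \<open>The sum defining \<open>sq_monom\<close> is a coefficient of a product of series, so
  multiplicativity questions about squares become questions about these series.\<close>

lemma sq_monom_eq_nth:
  "sq_monom j m = fps_nth (\<Prod>v\<in>Poly_Mapping.keys m. var_sq v (Poly_Mapping.lookup m v)) j"
proof -
  let ?V = "Poly_Mapping.keys m"
  have "(\<Sum>v\<in>?V. Poly_Mapping.single v (Poly_Mapping.lookup m v + int (Poly_Mapping.lookup e v))) = m + Poly_Mapping.map int e"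
    if "Poly_Mapping.keys e \<subseteq> ?V" for e
  proof -
    have "Poly_Mapping.keys (Poly_Mapping.map int e) = Poly_Mapping.keys e"
      by (auto simp: in_keys_iff lookup_map_int)
    then have "Poly_Mapping.keys (m + Poly_Mapping.map int e) \<subseteq> ?V"
      using that keys_add[of m "Poly_Mapping.map int e"] by auto
    then have "(\<Sum>v\<in>?V. Poly_Mapping.single v (Poly_Mapping.lookup (m + Poly_Mapping.map int e) v)) = m + Poly_Mapping.map int e"
      by (intro sum_single_keys) auto
    then show ?thesis by (simp add: lookup_add lookup_map_int)
  qed
  then show ?thesis
    unfolding prod_var_sq_nth[OF finite_keys] sq_monom_def sq_expos_def
    by (intro sum.cong) auto
qed

lemma total_sq_monom:
  assumes "finite V" "Poly_Mapping.keys m \<subseteq> V"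
  shows "total_sq (Poly_Mapping.single m 1) = (\<Prod>v\<in>V. var_sq v (Poly_Mapping.lookup m v))"
proof -
  have "total_sq (Poly_Mapping.single m 1) = (\<Prod>v\<in>Poly_Mapping.keys m. var_sq v (Poly_Mapping.lookup m v))"
    by (rule fps_ext) (simp add: sq_def sq_monom_eq_nth)
  also have "\<dots> = (\<Prod>v\<in>V. var_sq v (Poly_Mapping.lookup m v))"
    using assms by (intro prod.mono_neutral_left) (auto simp: in_keys_iff var_sq_0)
  finally show ?thesis .
qed

lemma sq_add [simp]: "sq j (p + q) = sq j p + sq j q"
  by (simp add: sq_def)

lemma sq_zero [simp]: "sq j 0 = 0"
  by (simp add: sq_def)

lemma total_sq_add [simp]: "total_sq (p + q) = total_sq p + total_sq q"
  by (rule fps_ext) simp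

lemma total_sq_zero [simp]: "total_sq 0 = 0"
  by (rule fps_ext) simp

text \<open>The Cartan formula. By bilinearity it suffices to treat monomials, where it is
  \<open>var_sq_add\<close> in each variable.\<close>

lemma total_sq_mult: "total_sq (p * q) = total_sq p * total_sq q"
proof (induction p rule: bit_poly_induct)
  case (single m)
  show ?case
  proof (induction q rule: bit_poly_induct)
    case (single m')
    let ?V = "Poly_Mapping.keys m \<union> Poly_Mapping.keys m'"
    have "total_sq (Poly_Mapping.single (m + m') 1) = (\<Prod>v\<in>?V. var_sq v (Poly_Mapping.lookup (m + m') v))"
      using keys_add[of m m'] by (intro total_sq_monom) auto
    also have "\<dots> = total_sq (Poly_Mapping.single m 1) * total_sq (Poly_Mapping.single m' 1)"
      by (simp add: total_sq_monom[of ?V] lookup_add var_sq_add prod.distrib)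
    finally show ?case by (simp add: mult_single)
  qed (auto simp: algebra_simps)
qed (auto simp: algebra_simps)

lemma sq_mult: "sq j (p * q) = (\<Sum>i=0..j. sq i p * sq (j - i) q)"
  using arg_cong[OF total_sq_mult[of p q], of "\<lambda>f. fps_nth f j"] by (simp add: fps_mult_nth)

definition xv :: "nat \<Rightarrow> int \<Rightarrow> laurent" where
  "xv v n = Poly_Mapping.single (Poly_Mapping.single v n) 1"

lemma sq_xv: "sq j (xv v n) = Poly_Mapping.single (Poly_Mapping.single v (n + int j)) (binom_mod2 n j)"
proof -
  have "total_sq (xv v n) = var_sq v n"
    unfolding xv_def by (subst total_sq_monom[of "{v}"]) (auto simp: in_keys_iff lookup_single)
  from arg_cong[OF this, of "\<lambda>f. fps_nth f j"] show ?thesis by (simp add: var_sq_def)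
qed

lemma xv_mult: "xv v n * xv v n' = xv v (n + n')"
  by (simp add: xv_def mult_single flip: single_add)

lemma xv_0 [simp]: "xv v 0 = 1"
  by (simp add: xv_def)

lemma sq_one: "sq j 1 = (if j = 0 then 1 else 0)"
  using sq_xv[of j 0 0] by (auto simp: binom_mod2_0)

lemma sq_0 [simp]: "sq 0 p = p"
proof (induction p rule: bit_poly_induct)
  case (single m)
  have "fps_nth (\<Prod>v\<in>V. f v) 0 = (\<Prod>v\<in>V. fps_nth (f v) 0)" for f :: "nat \<Rightarrow> laurent fps" and V
    by (induction V rule: infinite_finite_induct) auto
  then have "fps_nth (total_sq (Poly_Mapping.single m 1)) 0 =
    (\<Prod>v\<in>Poly_Mapping.keys m. Poly_Mapping.single (Poly_Mapping.single v (Poly_Mapping.lookup m v)) 1)"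
    by (simp only: total_sq_monom[OF finite_keys order_refl] var_sq_nth) simp
  moreover have "(\<Prod>v\<in>V. Poly_Mapping.single (Poly_Mapping.single v (Poly_Mapping.lookup m v)) (1::bit)) =
     Poly_Mapping.single (\<Sum>v\<in>V. Poly_Mapping.single v (Poly_Mapping.lookup m v)) 1" for V
    by (induction V rule: infinite_finite_induct) (auto simp: mult_single)
  ultimately show ?case by (simp add: sum_single_keys)
qed auto

lemma act_Nil [simp]: "act [] p = p"
  and act_Cons [simp]: "act (j # w) p = sq j (act w p)"
  by (simp_all add: act_def)

lemma act_append: "act (u @ w) p = act u (act w p)"
  by (simp add: act_def)

lemma act_add [simp]: "act w (p + q) = act w p + act w q"
  by (induction w) auto

lemma act_zero [simp]: "act w 0 = 0"
  by (induction w) auto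

lemma two_eq_zero_bit_poly [simp]: "(2 :: 'a::monoid_add \<Rightarrow>\<^sub>0 bit) = 0"
  by (simp flip: one_add_one)

lemma prod_xv: "(\<Prod>v\<in>V. xv v (f v)) = Poly_Mapping.single (\<Sum>v\<in>V. Poly_Mapping.single v (f v)) 1"
  by (induction V rule: infinite_finite_induct) (auto simp: xv_def mult_single)

lemma monom_eq_prod_xv: "Poly_Mapping.single m 1 = (\<Prod>v\<in>Poly_Mapping.keys m. xv v (Poly_Mapping.lookup m v))"
  by (simp add: prod_xv sum_single_keys)

text \<open>The variables and their inverses generate the Laurent ring. A relation between
  operations can thus be checked on generators and carried to products by the Cartan
  formula.\<close>

lemma laurent_induct [case_names zero one var inverse_var add mult]:
  assumes "P 0" "P 1" "\<And>v. P (xv v 1)" "\<And>v. P (xv v (-1))"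
    and "\<And>p q. P p \<Longrightarrow> P q \<Longrightarrow> P (p + q)" and mult: "\<And>p q. P p \<Longrightarrow> P q \<Longrightarrow> P (p * q)"
  shows "P p"
proof (induction p rule: bit_poly_induct)
  case (single m)
  have x: "P (xv v n)" for v n
  proof (induction n rule: int_induct[where k = 0])
    case base
    then show ?case using assms by simp
  next
    case (step1 i)
    then show ?case using mult[of "xv v i" "xv v 1"] assms by (simp add: xv_mult)
  next
    case (step2 i)
    then show ?case using mult[of "xv v i" "xv v (-1)"] assms by (simp add: xv_mult)
  qed
  have "P (\<Prod>v\<in>V. xv v (Poly_Mapping.lookup m v))" for V
    by (induction V rule: infinite_finite_induct) (auto simp: assms x)
  then show ?case by (simp add: monom_eq_prod_xv)
qed (auto intro: assms)

section \<open>Adem relations in low degrees on Laurent polynomials\<close>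

lemma binom_mod2_numeral: "binom_mod2 (numeral k) j = of_nat (numeral k choose j)"
  using binom_mod2_of_nat[of "numeral k" j] by simp

lemma sq_xv_if: "sq j (xv v n) = (if binom_mod2 n j = 0 then 0 else xv v (n + int j))"
  by (cases "binom_mod2 n j") (simp_all add: sq_xv, simp add: xv_def)

lemmas sq_xv_simps = sq_xv_if binom_mod2_0 binom_mod2_1 binom_mod2_minus1 binom_mod2_numeral sq_one
  eval_nat_numeral

lemma sq_mult_1: "sq 1 (p * q) = sq 1 p * q + p * sq 1 q"
  by (simp add: sq_mult add_ac)

lemma sq_mult_2: "sq 2 (p * q) = sq 2 p * q + sq 1 p * sq 1 q + p * sq 2 q"
  by (simp add: sq_mult numeral_2_eq_2 add_ac)

lemma sq_mult_3: "sq 3 (p * q) = sq 3 p * q + sq 2 p * sq 1 q + sq 1 p * sq 2 q + p * sq 3 q"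
  by (simp add: sq_mult eval_nat_numeral add_ac)

lemma sq_mult_4:
  "sq 4 (p * q) = sq 4 p * q + sq 3 p * sq 1 q + sq 2 p * sq 2 q + sq 1 p * sq 3 q + p * sq 4 q"
  by (simp add: sq_mult eval_nat_numeral add_ac)

lemmas sq_cartan = sq_mult_1 sq_mult_2 sq_mult_3 sq_mult_4

lemma sq1_sq1: "sq 1 (sq 1 p) = 0"
  by (induction p rule: laurent_induct) (simp_all add: sq_xv_simps sq_mult_1[unfolded One_nat_def] add_ac)

text \<open>Eliminates \<open>Sq^3\<close>, which the Cartan formula for \<open>Sq^4\<close>
  introduces.\<close>

lemma sq3_eq: "sq 3 p = sq 1 (sq 2 p)"
proof (induction p rule: laurent_induct)
  case (mult p q)
  then show ?case by (simp add: sq_cartan sq1_sq1 algebra_simps del: One_nat_def)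
qed (simp_all add: sq_xv_simps)

lemma sq2_sq2: "sq 2 (sq 2 p) = sq 1 (sq 2 (sq 1 p))"
proof (induction p rule: laurent_induct)
  case (mult p q)
  then show ?case by (simp add: sq_cartan sq1_sq1 algebra_simps del: One_nat_def)
qed (simp_all add: sq_xv_simps)

lemma sq4_sq1: "sq 4 (sq 1 p) = sq 1 (sq 4 p) + sq 2 (sq 1 (sq 2 p))"
proof (induction p rule: laurent_induct)
  case (mult p q)
  then show ?case by (simp add: sq_cartan sq3_eq sq1_sq1 sq2_sq2 algebra_simps del: One_nat_def)
qed (simp_all add: sq_xv_simps)

text \<open>Both sides are \<open>Sq^2 Sq^2 Sq^2 p\<close>, reduced with the two possible
  bracketings.\<close>

lemma sq1_sq2_sq1_sq2: "sq 1 (sq 2 (sq 1 (sq 2 p))) = sq 2 (sq 1 (sq 2 (sq 1 p)))"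
  using sq2_sq2[of "sq 2 p"] by (simp add: sq2_sq2)

lemma sq4_sq4: "sq 4 (sq 4 p) = sq 2 (sq 4 (sq 2 p)) + sq 1 (sq 2 (sq 4 (sq 1 p)))"
proof (induction p rule: laurent_induct)
  case (mult p q)
  then show ?case by (simp add: sq_cartan sq3_eq sq4_sq1 sq1_sq1 sq2_sq2 sq1_sq2_sq1_sq2 algebra_simps del: One_nat_def)
qed (simp_all add: sq_xv_simps)

section \<open>The free algebra on the Steenrod squares\<close>

text \<open>
  With concatenation as addition on words, \<^typ>\<open>word \<Rightarrow>\<^sub>0 bit\<close> becomes the free associative algebra.
\<close>

instantiation list :: (type) monoid_add
begin

definition zero_list_def: "0 = []"
definition plus_list_def: "u + v = u @ v"

instance
  by standard (simp_all add: zero_list_def plus_list_def)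

end

type_synonym walg = "word \<Rightarrow>\<^sub>0 bit"

abbreviation wd :: "word \<Rightarrow> walg" where
  "wd w \<equiv> Poly_Mapping.single w 1"

lemma wd_mult: "wd u * wd v = wd (u @ v)"
  by (simp add: mult_single plus_list_def)

definition walg_act :: "walg \<Rightarrow> laurent \<Rightarrow> laurent" where
  "walg_act p q = lin (\<lambda>w. act w q) p"

lemma walg_act_simps [simp]:
  "walg_act 0 q = 0" "walg_act (p + p') q = walg_act p q + walg_act p' q" "walg_act (wd w) q = act w q"
  by (simp_all add: walg_act_def)

lemma walg_act_add_right [simp]: "walg_act p (q + q') = walg_act p q + walg_act p q'"
  and walg_act_zero_right [simp]: "walg_act p 0 = 0"
  by (induction p rule: bit_poly_induct) (simp_all add: ac_simps)

lemma walg_act_mult: "walg_act (p * p') q = walg_act p (walg_act p' q)"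
proof (induction p rule: bit_poly_induct)
  case (single u)
  show ?case
    by (induction p' rule: bit_poly_induct) (simp_all add: wd_mult act_append distrib_left)
qed (simp_all add: distrib_right)

definition word_span :: "walg set" where
  "word_span = {p. \<forall>w\<in>Poly_Mapping.keys p. is_word w}"

lemma is_word_append [simp]: "is_word (u @ v) \<longleftrightarrow> is_word u \<and> is_word v"
  by (auto simp: is_word_def)

lemma adem_ideal_generator:
  assumes "is_word u" "is_word v" "0 < a" "a < 2 * b"
  shows "lin (\<lambda>x. wd (u @ x @ v)) (adem a b) \<in> adem_ideal"
  unfolding adem_ideal_def using assms by (intro group_closure.base insertI2) blast

lemma adem_ideal_zero: "0 \<in> adem_ideal"
  by (simp add: adem_ideal_def)

lemma adem_ideal_add: "p \<in> adem_ideal \<Longrightarrow> q \<in> adem_ideal \<Longrightarrow> p + q \<in> adem_ideal"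
  unfolding adem_ideal_def by (rule group_closure_add)

text \<open>The generators already carry arbitrary outer words, so a further word is absorbed into
  \<open>u\<close> or \<open>v\<close>.\<close>

lemma adem_ideal_mult:
  assumes "p \<in> adem_ideal" "is_word w"
  shows "wd w * p \<in> adem_ideal" "p * wd w \<in> adem_ideal"
proof -
  have l: "wd w * lin (\<lambda>x. wd (u @ x @ v)) r = lin (\<lambda>x. wd ((w @ u) @ x @ v)) r" for u v r
    by (induction r rule: bit_poly_induct) (simp_all add: wd_mult distrib_left)
  have r: "lin (\<lambda>x. wd (u @ x @ v)) r * wd w = lin (\<lambda>x. wd (u @ x @ (v @ w))) r" for u v r
    by (induction r rule: bit_poly_induct) (simp_all add: wd_mult distrib_right)
  from assms(1)[unfolded adem_ideal_def]
  have "wd w * p \<in> adem_ideal \<and> p * wd w \<in> adem_ideal"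
  proof (induction p rule: group_closure.induct)
    case (base s)
    then consider "s = 0" | u v a b where "s = lin (\<lambda>x. wd (u @ x @ v)) (adem a b)"
      "is_word u" "is_word v" "0 < a" "a < 2 * b" by blast
    then show ?case
    proof cases
      case 1
      then show ?thesis by (simp add: adem_ideal_zero)
    next
      case 2
      have "lin (\<lambda>x. wd ((w @ u) @ x @ v)) (adem a b) \<in> adem_ideal"
        "lin (\<lambda>x. wd (u @ x @ (v @ w))) (adem a b) \<in> adem_ideal"
        using 2 assms(2) by (intro adem_ideal_generator; simp)+
      then show ?thesis unfolding 2 l r ..
    qed
  next
    case (diff s t)
    then show ?case by (simp add: diff_eq_add distrib_left distrib_right adem_ideal_add)
  qed
  then show "wd w * p \<in> adem_ideal" "p * wd w \<in> adem_ideal" by auto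
qed

lemma adem_in_ideal: "0 < a \<Longrightarrow> a < 2 * b \<Longrightarrow> adem a b \<in> adem_ideal"
  using adem_ideal_generator[of "[]" "[]" a b] by (simp add: is_word_def lin_id)

text \<open>
  The Adem relations used below are shown to annihilate Laurent polynomials one by one, so that the
  general case is not needed: only relations in the following ideal occur as boundaries.
\<close>

definition null_ideal :: "walg set" where
  "null_ideal = {p \<in> adem_ideal. \<forall>q. walg_act p q = 0}"

lemma null_ideal_zero: "0 \<in> null_ideal"
  by (simp add: null_ideal_def adem_ideal_zero)

lemma null_ideal_add: "p \<in> null_ideal \<Longrightarrow> q \<in> null_ideal \<Longrightarrow> p + q \<in> null_ideal"
  by (simp add: null_ideal_def adem_ideal_add)

lemma null_ideal_wd: 
  assumes "p \<in> null_ideal" "is_word w"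
  shows "wd w * p \<in> null_ideal" "p * wd w \<in> null_ideal"
  using assms by (auto simp: null_ideal_def adem_ideal_mult walg_act_mult)

lemma null_ideal_mult_left:
  assumes "p \<in> null_ideal" "q \<in> word_span" shows "q * p \<in> null_ideal"
proof -
  have "(\<Sum>w\<in>A. wd w) * p \<in> null_ideal" if "A \<subseteq> Poly_Mapping.keys q" "finite A" for A
    using that(2,1) assms
    by (induction A rule: finite_induct)
       (auto simp: null_ideal_zero word_span_def distrib_right intro!: null_ideal_add null_ideal_wd)
  from this[of "Poly_Mapping.keys q"] show ?thesis by (simp add: sum_single_keys_bit)
qed

lemma null_ideal_mult_right:
  assumes "p \<in> null_ideal" "q \<in> word_span" shows "p * q \<in> null_ideal"
proof -
  have "p * (\<Sum>w\<in>A. wd w) \<in> null_ideal" if "A \<subseteq> Poly_Mapping.keys q" "finite A" for A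
    using that(2,1) assms
    by (induction A rule: finite_induct)
       (auto simp: null_ideal_zero word_span_def distrib_left intro!: null_ideal_add null_ideal_wd)
  from this[of "Poly_Mapping.keys q"] show ?thesis by (simp add: sum_single_keys_bit)
qed

lemma word_span_mult: "p \<in> word_span \<Longrightarrow> q \<in> word_span \<Longrightarrow> p * q \<in> word_span"
  using keys_mult[of p q] by (fastforce simp: word_span_def plus_list_def)

lemma word_span_wd: "is_word w \<Longrightarrow> wd w \<in> word_span"
  by (simp add: word_span_def)

abbreviation "Sq1 \<equiv> wd [1]"
abbreviation "Sq2 \<equiv> wd [2]"
abbreviation "Sq4 \<equiv> wd [4]"

lemma adem_simps:
  "adem 1 1 = wd [1, 1]"
  "adem 1 2 = wd [1, 2] + wd [3]"
  "adem 1 3 = wd [1, 3]"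
  "adem 1 4 = wd [1, 4] + wd [5]"
  "adem 1 5 = wd [1, 5]"
  "adem 1 6 = wd [1, 6] + wd [7]"
  "adem 1 7 = wd [1, 7]"
  "adem 1 8 = wd [1, 8] + wd [9]"
  "adem 2 2 = wd [2, 2] + wd [3, 1]"
  "adem 2 3 = wd [2, 3] + wd [5] + wd [4, 1]"
  "adem 2 4 = wd [2, 4] + wd [6] + wd [5, 1]"
  "adem 2 5 = wd [2, 5] + wd [6, 1]"
  "adem 2 6 = wd [2, 6] + wd [7, 1]"
  "adem 2 7 = wd [2, 7] + wd [9] + wd [8, 1]"
  "adem 3 4 = wd [3, 4] + wd [7]"
  "adem 4 4 = wd [4, 4] + wd [7, 1] + wd [6, 2]"
  "adem 5 3 = wd [5, 3]"
  by (simp_all add: adem_def del: One_nat_def, simp_all add: eval_nat_numeral add_ac)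

text \<open>
  These are the defining relations of the subalgebra of the Steenrod algebra generated by \<open>Sq\<^bsup>1\<^esup>\<close>, \<open>Sq\<^bsup>2\<^esup>\<close>
  and \<open>Sq\<^bsup>4\<^esup>\<close>.
\<close>

lemma adem_relations:
  shows "Sq1 * Sq1 \<in> null_ideal"
    and "Sq2 * Sq2 + Sq1 * Sq2 * Sq1 \<in> null_ideal"
    and "Sq1 * Sq4 + Sq4 * Sq1 + Sq2 * Sq1 * Sq2 \<in> null_ideal"
    and "Sq4 * Sq4 + Sq2 * Sq4 * Sq2 + Sq1 * Sq2 * Sq4 * Sq1 \<in> null_ideal"
proof -
  note intros = adem_ideal_add adem_ideal_mult adem_in_ideal
  have "Sq1 * Sq1 = adem 1 1" by (simp add: wd_mult adem_simps del: One_nat_def)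
  also have "\<dots> \<in> adem_ideal" by (intro intros) auto
  finally show "Sq1 * Sq1 \<in> null_ideal" 
    by (simp add: null_ideal_def walg_act_mult sq1_sq1[unfolded One_nat_def])
  have "Sq2 * Sq2 + Sq1 * Sq2 * Sq1 = adem 2 2 + adem 1 2 * wd [1]"
    by (simp add: wd_mult adem_simps algebra_simps del: One_nat_def)
  also have "\<dots> \<in> adem_ideal" by (intro intros) (auto simp: is_word_def)
  finally show "Sq2 * Sq2 + Sq1 * Sq2 * Sq1 \<in> null_ideal"
    by (simp add: null_ideal_def walg_act_mult sq2_sq2)
  have "Sq1 * Sq4 + Sq4 * Sq1 + Sq2 * Sq1 * Sq2 = adem 1 4 + (wd [2] * adem 1 2 + adem 2 3)"
    by (simp add: wd_mult adem_simps algebra_simps del: One_nat_def)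
  also have "\<dots> \<in> adem_ideal" by (intro intros) (auto simp: is_word_def)
  finally show "Sq1 * Sq4 + Sq4 * Sq1 + Sq2 * Sq1 * Sq2 \<in> null_ideal"
    by (simp add: null_ideal_def walg_act_mult sq4_sq1[unfolded One_nat_def] add_ac)
  \<comment> \<open>The auxiliary words \<open>[7, 1]\<close>, \<open>[6, 2]\<close>,
    \<open>[5, 1, 2]\<close>, \<open>[5, 3]\<close> and \<open>[3, 4, 1]\<close> each occur twice on
    the right and cancel.\<close>
  have "Sq4 * Sq4 + Sq2 * Sq4 * Sq2 + Sq1 * Sq2 * Sq4 * Sq1 =
     adem 4 4 + (adem 2 4 * wd [2] + (wd [5] * adem 1 2 + (adem 5 3 + (adem 1 2 * wd [4, 1] + adem 3 4 * wd [1]))))"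
    by (simp add: wd_mult adem_simps algebra_simps del: One_nat_def)
  also have "\<dots> \<in> adem_ideal" by (intro intros) (auto simp: is_word_def)
  finally show "Sq4 * Sq4 + Sq2 * Sq4 * Sq2 + Sq1 * Sq2 * Sq4 * Sq1 \<in> null_ideal"
    by (simp add: null_ideal_def walg_act_mult sq4_sq4)
qed

text \<open>A certificate in the free algebra: \<open>[Sq^2, Q_2]\<close> lies in the two-sided
  ideal generated by the four relations, as every summand on the right has one of them as a
  factor.\<close>

lemma commutator_identity:
  fixes a b c :: walg
  defines "Q1 \<equiv> b * a + a * b"
  defines "Q2 \<equiv> c * Q1 + Q1 * c"
  assumes r1: "r1 = a * a" and r2: "r2 = b * b + a * b * a" and r3: "r3 = a * c + c * a + b * a * b"
    and r4: "r4 = c * c + b * c * b + a * b * c * a"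
  shows "b * Q2 + Q2 * b = b * r3 * b + r2 * (a * b * b) + a * b * r1 * (b * b)
     + c * a * r2 + c * r1 * (b * a) + r2 * (a * c) + a * b * r1 * c
     + r3 * c + c * r3 + a * r4 + r1 * (b * c * a) + r4 * a + a * b * c * r1"
proof -
  note ac = distrib_left distrib_right mult.assoc add.assoc add.commute add.left_commute
        add_self add_self_left add_0_right add_0_left
  have 1: "b * c * a * b + b * a * c * b = b * r3 * b + r2 * (a * b * b) + a * b * r1 * (b * b)"
    unfolding r1 r2 r3 by (simp only: ac)
  have 2: "c * a * b * b = c * a * r2 + c * r1 * (b * a)" "b * b * a * c = r2 * (a * c) + a * b * r1 * c"
    unfolding r1 r2 by (simp_all only: ac)
  \<comment> \<open>The leftover terms \<open>a * c * c\<close> and \<open>c * c * a\<close> are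
    matched below with \<open>a * b * c * b\<close> and \<open>b * c * b * a\<close> through the
    relation \<open>r4\<close>.\<close>
  have 3: "b * a * b * c + c * b * a * b = r3 * c + c * r3 + a * c * c + c * c * a"
    unfolding r3 by (simp only: ac)
  have 4: "a * c * c + a * b * c * b = a * r4 + r1 * (b * c * a)" "c * c * a + b * c * b * a = r4 * a + a * b * c * r1"
    unfolding r4 r1 by (simp_all only: ac)
  have "b * Q2 + Q2 * b = (b * c * a * b + b * a * c * b) + c * a * b * b + b * b * a * c
      + (b * a * b * c + c * b * a * b) + b * c * b * a + a * b * c * b"
    unfolding Q1_def Q2_def by (simp only: ac)
  also have "\<dots> = (b * r3 * b + r2 * (a * b * b) + a * b * r1 * (b * b)) + (c * a * r2 + c * r1 * (b * a))
     + (r2 * (a * c) + a * b * r1 * c) + (r3 * c + c * r3) + (a * c * c + a * b * c * b) + (c * c * a + b * c * b * a)"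
    unfolding 1 2 3 by (simp only: add.assoc add.commute add.left_commute)
  also have "\<dots> = b * r3 * b + r2 * (a * b * b) + a * b * r1 * (b * b)
     + c * a * r2 + c * r1 * (b * a) + r2 * (a * c) + a * b * r1 * c
     + r3 * c + c * r3 + a * r4 + r1 * (b * c * a) + r4 * a + a * b * c * r1"
    unfolding 4 by (simp only: add.assoc)
  finally show ?thesis .
qed

text \<open>Further certificates in the free algebra. The first four write a square or commutator
  relation in terms of \<open>r1\<close>, \<open>r2\<close>, \<open>r3\<close>; the last is the
  Jacobi identity for \<open>[[c, b], Q1]\<close>, which reduces the commutator of \<open>r\<close>
  and \<open>Q1\<close> to those of \<open>b\<close> with \<open>Q1\<close> and
  \<open>Q2\<close>.\<close>

lemma Q_identities:
  fixes a b c :: walg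
  defines "Q1 \<equiv> b * a + a * b"
  defines "Q2 \<equiv> c * Q1 + Q1 * c"
  defines "r \<equiv> c * b + b * c"
  defines "r1 \<equiv> a * a"
  defines "r2 \<equiv> b * b + a * b * a"
  defines "r3 \<equiv> a * c + c * a + b * a * b"
  shows "Q1 * Q1 = b * r1 * b + a * r2 * a + r1 * b * r1 + b * r2 + r2 * b"
    and "a * Q1 + Q1 * a = r1 * b + b * r1"
    and "r * a + a * r + Q2 = b * r3 + r3 * b + r2 * (a * b) + a * b * r1 * b + b * a * r2 + b * r1 * (b * a)"
    and "b * Q1 + Q1 * b = r2 * a + a * b * r1 + a * r2 + r1 * (b * a)"
    and "r * Q1 + Q1 * r = c * (b * Q1 + Q1 * b) + (b * Q1 + Q1 * b) * c + (b * Q2 + Q2 * b)"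
  unfolding assms
  by (simp_all only: distrib_left distrib_right mult.assoc add.assoc add.commute add.left_commute
        add_self add_self_left add_0_right add_0_left)

lemma Q_relations:
  defines "Q1 \<equiv> Sq2 * Sq1 + Sq1 * Sq2"
  defines "Q2 \<equiv> Sq4 * Q1 + Q1 * Sq4"
  defines "r \<equiv> Sq4 * Sq2 + Sq2 * Sq4"
  shows "Q1 * Q1 \<in> null_ideal" "Sq1 * Q1 + Q1 * Sq1 \<in> null_ideal" "r * Sq1 + Sq1 * r + Q2 \<in> null_ideal"
    "r * Q1 + Q1 * r \<in> null_ideal"
proof -
  have in_span: "Sq1 \<in> word_span" "Sq2 \<in> word_span" "Sq4 \<in> word_span"
    by (auto intro: word_span_wd simp: is_word_def)
  note intros = null_ideal_add null_ideal_mult_left null_ideal_mult_right word_span_mult in_span adem_relations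
  show "Q1 * Q1 \<in> null_ideal"
    unfolding Q1_def Q_identities(1) by (simp only: intros)
  show "Sq1 * Q1 + Q1 * Sq1 \<in> null_ideal"
    unfolding Q1_def Q_identities(2) by (simp only: intros)
  show "r * Sq1 + Sq1 * r + Q2 \<in> null_ideal"
    unfolding Q1_def Q2_def r_def Q_identities(3) by (simp only: intros)
  have "Sq2 * Q1 + Q1 * Sq2 \<in> null_ideal"
    unfolding Q1_def Q_identities(4) by (simp only: intros)
  moreover have "Sq2 * Q2 + Q2 * Sq2 \<in> null_ideal"
    unfolding Q1_def Q2_def commutator_identity[OF refl refl refl refl] by (simp only: intros)
  moreover have "r * Q1 + Q1 * r = Sq4 * (Sq2 * Q1 + Q1 * Sq2) + (Sq2 * Q1 + Q1 * Sq2) * Sq4 + (Sq2 * Q2 + Q2 * Sq2)"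
    unfolding Q1_def Q2_def r_def by (rule Q_identities(5))
  ultimately show "r * Q1 + Q1 * r \<in> null_ideal"
    by (simp only: intros)
qed

text \<open>
  The Milnor basis formula \<open>[Sq\<^bsup>2m\<^esup>, Q\<^sub>0] = Q\<^sub>1 Sq\<^bsup>2m-2\<^esup>\<close>; for \<open>m = 1\<close> it is the definition of \<open>Q\<^sub>1\<close>.
\<close>

lemma sq_even_commutator:
  assumes "m \<in> {2, 3, 4}"
  shows "wd [2 * m] * Sq1 + Sq1 * wd [2 * m] + (Sq2 * Sq1 + Sq1 * Sq2) * wd [2 * m - 2] \<in> adem_ideal"
proof -
  \<comment> \<open>For \<open>m = 3\<close> the word \<open>[1, 6]\<close> already comes from
    \<open>Sq1 * adem 2 4\<close>. For \<open>m = 2\<close> and \<open>m = 4\<close> the word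
    \<open>[1, 2 * m]\<close> is supplied by \<open>adem 1 (2 * m)\<close>, which also cancels the
    word \<open>[2 * m + 1]\<close> of \<open>adem 2 (2 * m - 1)\<close>.\<close>
  have "wd [2 * m] * Sq1 + Sq1 * wd [2 * m] + (Sq2 * Sq1 + Sq1 * Sq2) * wd [2 * m - 2] =
     Sq1 * adem 2 (2 * m - 2) + (adem 1 (2 * m - 1) * Sq1 + (Sq2 * adem 1 (2 * m - 2) + (adem 2 (2 * m - 1) + (if m = 3 then 0 else adem 1 (2 * m)))))"
    using assms by (auto simp: algebra_simps wd_mult adem_simps simp del: One_nat_def)
  also have "\<dots> \<in> adem_ideal"
    using assms by (intro adem_ideal_add adem_ideal_mult adem_in_ideal) (auto simp: is_word_def adem_ideal_zero adem_in_ideal)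
  finally show ?thesis .
qed

section \<open>The bar complex\<close>

definition prepend :: "walg \<Rightarrow> chain \<Rightarrow> chain"  (infixr "\<rhd>" 72) where
  "p \<rhd> z = lin (\<lambda>w. lin (\<lambda>(ws, m). Poly_Mapping.single (w # ws, m) 1) z) p"

definition coef :: "laurent \<Rightarrow> chain" where
  "coef q = lin (\<lambda>m. Poly_Mapping.single ([], m) 1) q"

text \<open>The part of the bar differential that merges a new first entry into what follows it: the
  next word or, when no word is left, the coefficient.\<close>

fun smul_basis :: "word \<Rightarrow> word list \<times> expo \<Rightarrow> chain" where
  "smul_basis w ([], m) = coef (act w (Poly_Mapping.single m 1))"
| "smul_basis w (v # ws, m) = Poly_Mapping.single ((w @ v) # ws, m) 1"

definition smul :: "walg \<Rightarrow> chain \<Rightarrow> chain"  (infixr "\<star>" 72) where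
  "p \<star> z = lin (\<lambda>w. lin (smul_basis w) z) p"

lemma pre_simps [simp]:
  "0 \<rhd> z = 0" "(p + q) \<rhd> z = p \<rhd> z + q \<rhd> z" "wd w \<rhd> Poly_Mapping.single (ws, m) 1 = Poly_Mapping.single (w # ws, m) 1"
  by (simp_all add: prepend_def)

lemma pre_right [simp]: "p \<rhd> 0 = 0" "p \<rhd> (y + z) = p \<rhd> y + p \<rhd> z"
  by (simp_all add: prepend_def lin_fun_add)

lemma smul_simps [simp]:
  "0 \<star> z = 0" "(p + q) \<star> z = p \<star> z + q \<star> z" "wd w \<star> Poly_Mapping.single x 1 = smul_basis w x"
  by (simp_all add: smul_def)

lemma smul_right [simp]: "p \<star> 0 = 0" "p \<star> (y + z) = p \<star> y + p \<star> z"
  by (simp_all add: smul_def lin_fun_add)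

lemma coef_simps [simp]: "coef 0 = 0" "coef (p + q) = coef p + coef q"
  "coef (Poly_Mapping.single m 1) = Poly_Mapping.single ([], m) 1"
  by (simp_all add: coef_def)

lemma smul_coef: "p \<star> coef q = coef (walg_act p q)"
proof (induction p rule: bit_poly_induct)
  case (single w)
  show ?case by (induction q rule: bit_poly_induct) simp_all
qed simp_all

lemma smul_pre: "p \<star> (q \<rhd> z) = (p * q) \<rhd> z"
proof (induction p rule: bit_poly_induct)
  case (single u)
  show ?case
  proof (induction q rule: bit_poly_induct)
    case (single v)
    show ?case 
    proof (induction z rule: bit_poly_induct)
      case (single x)
      show ?case by (cases x) (simp add: wd_mult)
    qed simp_all
  qed (simp_all add: distrib_left)
qed (simp_all add: distrib_right)

lemma chain_induct [case_names zero nil cons add]: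
  fixes z :: chain
  assumes "P 0" "\<And>m. P (coef (Poly_Mapping.single m 1))"
    "\<And>w ws m. P (Poly_Mapping.single (ws, m) 1) \<Longrightarrow> P (wd w \<rhd> Poly_Mapping.single (ws, m) 1)"
    "\<And>x y. P x \<Longrightarrow> P y \<Longrightarrow> P (x + y)"
  shows "P z"
proof (induction z rule: bit_poly_induct)
  case (single x)
  obtain ws m where x: "x = (ws, m)" by (cases x)
  have "P (Poly_Mapping.single (ws, m) 1)"
  proof (induction ws)
    case Nil
    then show ?case using assms(2) by simp
  next
    case (Cons w ws)
    then show ?case using assms(3)[of ws m w] by simp
  qed
  then show ?case by (simp add: x)
qed (auto intro: assms)

lemma smul_smul: "p \<star> (q \<star> z) = (p * q) \<star> z"
proof (induction z rule: chain_induct)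
  case (nil m)
  then show ?case by (simp only: smul_coef walg_act_mult)
next
  case (cons w ws m)
  then show ?case by (simp only: smul_pre mult.assoc)
qed simp_all

lemma bar_d_zero [simp]: "bar_d 0 = 0"
  and bar_d_add [simp]: "bar_d (x + y) = bar_d x + bar_d y"
  by (simp_all add: bar_d_def)

lemma bar_d_coef [simp]: "bar_d (coef q) = 0"
  by (induction q rule: bit_poly_induct) (simp_all add: bar_d_def)

text \<open>The merge at position 0 is \<open>p \<star> z\<close>; the other terms are those of
  \<open>bar_d z\<close>, shifted by one place. This recursion replaces index sums in the boundary
  computations with shuffles.\<close>

lemma bar_d_pre: "bar_d (p \<rhd> z) = p \<star> z + p \<rhd> bar_d z"
proof (induction p rule: bit_poly_induct)
  case (single w)
  show ?case
  proof (induction z rule: bit_poly_induct)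
    case (single x)
    obtain ws m where x: "x = (ws, m)" by (cases x)
    have sum_pre: "wd w \<rhd> sum f A = (\<Sum>i\<in>A. wd w \<rhd> f i)" for f :: "nat \<Rightarrow> chain" and A
      by (induction A rule: infinite_finite_induct) simp_all
    have lin_pre: "wd w \<rhd> lin f q = lin (\<lambda>i. wd w \<rhd> f i) q" for f :: "expo \<Rightarrow> chain" and q
      by (induction q rule: bit_poly_induct) simp_all
    show ?case
    proof (cases ws)
      case Nil
      then show ?thesis by (simp add: x bar_d_def coef_def)
    next
      case (Cons v vs)
      then show ?thesis
        by (simp add: x bar_d_def sum_pre lin_pre sum.lessThan_Suc_shift add_ac del: sum.lessThan_Suc)
    qed
  qed (simp_all add: ac_simps)
qed (simp_all add: ac_simps)

lemma bar_d_smul: "bar_d (p \<star> z) = p \<star> bar_d z"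
proof (induction z rule: chain_induct)
  case (cons w ws m)
  then show ?case by (simp only: smul_pre bar_d_pre smul_smul smul_right)
qed (simp_all only: smul_coef bar_d_coef smul_right bar_d_add bar_d_zero)

text \<open>By the recursion and \<open>bar_d_smul\<close> the two mixed terms agree and cancel. The
  identity is exact before any Adem relation is imposed, since concatenated words act by
  composition.\<close>

lemma bar_d_bar_d: "bar_d (bar_d z) = 0"
proof (induction z rule: chain_induct)
  case (cons w ws m)
  then show ?case by (simp only: bar_d_pre bar_d_add bar_d_smul pre_right add_self) simp
qed (simp_all only: bar_d_coef bar_d_zero bar_d_add add_self)

text \<open>
  Unlike \<^const>\<open>bar_rel\<close>, whose generators may contain lists that are not bar words, this span is
  mapped into itself by \<^const>\<open>bar_d\<close> for a suitable ideal.
\<close>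

inductive_set rel_span :: "walg set \<Rightarrow> chain set" for I where
  zero: "0 \<in> rel_span I"
| add: "x \<in> rel_span I \<Longrightarrow> y \<in> rel_span I \<Longrightarrow> x + y \<in> rel_span I"
| rel: "p \<in> I \<Longrightarrow> bar_word_list ws \<Longrightarrow> p \<rhd> Poly_Mapping.single (ws, m) 1 \<in> rel_span I"
| prepend: "x \<in> rel_span I \<Longrightarrow> is_word w \<Longrightarrow> w \<noteq> [] \<Longrightarrow> wd w \<rhd> x \<in> rel_span I"

lemma rel_span_mono:
  assumes "I \<subseteq> I'" shows "rel_span I \<subseteq> rel_span I'"
proof
  fix x assume "x \<in> rel_span I"
  then show "x \<in> rel_span I'"
    by induction (use assms in \<open>auto intro: rel_span.intros\<close>)
qed

lemma bar_rel_zero [simp]: "0 \<in> bar_rel"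
  by (simp add: bar_rel_def)

lemma bar_rel_add: "x \<in> bar_rel \<Longrightarrow> y \<in> bar_rel \<Longrightarrow> x + y \<in> bar_rel"
  unfolding bar_rel_def by (rule group_closure_add)

lemma bar_rel_generator: "p \<in> adem_ideal \<Longrightarrow> lin (\<lambda>w. Poly_Mapping.single (us @ [w] @ vs, m) 1) p \<in> bar_rel"
  unfolding bar_rel_def by (intro group_closure.base insertI2) blast

lemma bar_rel_induct [consumes 1, case_names zero generator add]:
  assumes "z \<in> bar_rel" "P 0"
    "\<And>us vs m p. p \<in> adem_ideal \<Longrightarrow> P (lin (\<lambda>w. Poly_Mapping.single (us @ [w] @ vs, m) 1) p)"
    "\<And>x y. P x \<Longrightarrow> P y \<Longrightarrow> P (x + y)"
  shows "P z"
  using assms(1) unfolding bar_rel_def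
proof (induction rule: group_closure.induct)
  case (base s)
  then show ?case using assms(2,3) by blast
next
  case (diff s t)
  then show ?case using assms(4) by (simp add: diff_eq_add)
qed

lemma pre_bar_rel: "z \<in> bar_rel \<Longrightarrow> wd w \<rhd> z \<in> bar_rel"
proof (induction rule: bar_rel_induct)
  case (generator us vs m p)
  have "wd w \<rhd> lin (\<lambda>w'. Poly_Mapping.single (us @ [w'] @ vs, m) 1) p =
      lin (\<lambda>w'. Poly_Mapping.single ((w # us) @ [w'] @ vs, m) 1) p"
    by (induction p rule: bit_poly_induct) simp_all
  with generator show ?case by (simp only: bar_rel_generator)
qed (simp_all add: bar_rel_add)

lemma rel_span_adem: "rel_span adem_ideal \<subseteq> bar_rel"
proof
  fix x assume "x \<in> rel_span adem_ideal"
  then show "x \<in> bar_rel"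
  proof induction
    case (rel p ws m)
    have "p \<rhd> Poly_Mapping.single (ws, m) 1 = lin (\<lambda>w. Poly_Mapping.single ([] @ [w] @ ws, m) 1) p"
      by (induction p rule: bit_poly_induct) simp_all
    with rel show ?case by (simp only: bar_rel_generator)
  qed (auto simp: bar_rel_add pre_bar_rel)
qed

definition alg_plus :: "walg set" where
  "alg_plus = {p. \<forall>w\<in>Poly_Mapping.keys p. is_word w \<and> w \<noteq> []}"

definition bar_chains :: "chain set" where
  "bar_chains = {z. \<forall>(ws, m)\<in>Poly_Mapping.keys z. bar_word_list ws}"

lemma rel_span_pre:
  assumes "x \<in> rel_span I" "p \<in> alg_plus" shows "p \<rhd> x \<in> rel_span I"
proof -
  have "(\<Sum>w\<in>A. wd w) \<rhd> x \<in> rel_span I" if "A \<subseteq> Poly_Mapping.keys p" "finite A" for A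
    using that(2,1) assms by (induction A rule: finite_induct) (auto simp: alg_plus_def intro!: rel_span.intros)
  from this[of "Poly_Mapping.keys p"] show ?thesis by (simp add: sum_single_keys_bit)
qed

lemma rel_span_rel:
  assumes "p \<in> I" "z \<in> bar_chains" shows "p \<rhd> z \<in> rel_span I"
proof -
  have "p \<rhd> (\<Sum>k\<in>A. Poly_Mapping.single k 1) \<in> rel_span I" if "A \<subseteq> Poly_Mapping.keys z" "finite A" for A
    using that(2,1) assms by (induction A rule: finite_induct) (auto simp: bar_chains_def intro!: rel_span.intros)
  from this[of "Poly_Mapping.keys z"] show ?thesis by (simp add: sum_single_keys_bit)
qed

section \<open>The cycle and the bounding chain\<close>

definition Q1 :: walg where "Q1 = Sq2 * Sq1 + Sq1 * Sq2"
definition Q2 :: walg where "Q2 = Sq4 * Q1 + Q1 * Sq4"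
definition R2 :: walg where "R2 = Sq4 * Sq2 + Sq2 * Sq4"

definition alg_hom :: "nat \<Rightarrow> walg set" where
  "alg_hom d = {p. \<forall>w\<in>Poly_Mapping.keys p. is_word w \<and> w \<noteq> [] \<and> sum_list w = d}"

lemma alg_hom_imp_plus: "p \<in> alg_hom d \<Longrightarrow> p \<in> alg_plus"
  by (auto simp: alg_hom_def alg_plus_def)

lemma alg_hom_add: "p \<in> alg_hom d \<Longrightarrow> q \<in> alg_hom d \<Longrightarrow> p + q \<in> alg_hom d"
  by (auto simp: alg_hom_def keys_add_bit)

lemma alg_hom_mult: "p \<in> alg_hom d \<Longrightarrow> q \<in> alg_hom e \<Longrightarrow> p * q \<in> alg_hom (d + e)"
  using keys_mult[of p q] by (fastforce simp: alg_hom_def plus_list_def)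

lemma alg_hom_wd: "is_word w \<Longrightarrow> w \<noteq> [] \<Longrightarrow> wd w \<in> alg_hom (sum_list w)"
  by (simp add: alg_hom_def)

lemma hom_Sq1: "Sq1 \<in> alg_hom 1" and hom_Sq2: "Sq2 \<in> alg_hom 2" and hom_Sq4: "Sq4 \<in> alg_hom 4"
  using alg_hom_wd[of "[1]"] alg_hom_wd[of "[2]"] alg_hom_wd[of "[4]"] by (simp_all add: is_word_def)

lemma hom_Q1: "Q1 \<in> alg_hom 3"
  using alg_hom_mult[OF hom_Sq1 hom_Sq2] alg_hom_mult[OF hom_Sq2 hom_Sq1]
  by (auto simp: Q1_def eval_nat_numeral intro!: alg_hom_add)

lemma hom_R2: "R2 \<in> alg_hom 6"
  using alg_hom_mult[OF hom_Sq4 hom_Sq2] alg_hom_mult[OF hom_Sq2 hom_Sq4]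
  by (auto simp: R2_def eval_nat_numeral intro!: alg_hom_add)

lemmas plus_gens = hom_Sq1[THEN alg_hom_imp_plus] hom_Q1[THEN alg_hom_imp_plus] 
  hom_Sq4[THEN alg_hom_imp_plus] hom_R2[THEN alg_hom_imp_plus]

definition unit_chain :: chain where
  "unit_chain = Poly_Mapping.single ([], 0) 1"

lemma act_one: "is_word w \<Longrightarrow> w \<noteq> [] \<Longrightarrow> act w 1 = 0"
proof (induction w)
  case (Cons a w)
  then show ?case by (cases "w = []") (auto simp: is_word_def sq_one)
qed simp

text \<open>Positive-degree operations kill the constant 1, so over the ground field the last term
  of the differential vanishes.\<close>

lemma smul_unit_chain: "p \<in> alg_plus \<Longrightarrow> p \<star> unit_chain = 0"
proof -
  assume p: "p \<in> alg_plus"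
  have "walg_act p 1 = lin (\<lambda>_. 0) p"
    unfolding walg_act_def by (rule lin_cong) (use p in \<open>auto simp: alg_plus_def act_one\<close>)
  then have "p \<star> coef 1 = 0" by (simp add: smul_coef)
  then show ?thesis by (simp add: unit_chain_def flip: single_one)
qed

text \<open>
  \<open>divpow q n\<close> is the divided power \<open>[q|\<dots>|q]\<close>, \<open>shuffle p q n\<close> is the sum of all shuffles of \<open>p\<close> into it,
  and \<open>shuffle2 p p' q n\<close> the sum of all shuffles of \<open>p\<close> and \<open>p'\<close> into it, in both orders.
\<close>

primrec divpow :: "walg \<Rightarrow> nat \<Rightarrow> chain" where
  "divpow q 0 = unit_chain"
| "divpow q (Suc n) = q \<rhd> divpow q n"

primrec shuffle :: "walg \<Rightarrow> walg \<Rightarrow> nat \<Rightarrow> chain" where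
  "shuffle p q 0 = p \<rhd> unit_chain"
| "shuffle p q (Suc n) = p \<rhd> divpow q (Suc n) + q \<rhd> shuffle p q n"

primrec shuffle2 :: "walg \<Rightarrow> walg \<Rightarrow> walg \<Rightarrow> nat \<Rightarrow> chain" where
  "shuffle2 p p' q 0 = p \<rhd> shuffle p' q 0 + p' \<rhd> shuffle p q 0"
| "shuffle2 p p' q (Suc n) = p \<rhd> shuffle p' q (Suc n) + p' \<rhd> shuffle p q (Suc n) + q \<rhd> shuffle2 p p' q n"

lemma pre_bar_chains: "p \<in> alg_plus \<Longrightarrow> z \<in> bar_chains \<Longrightarrow> p \<rhd> z \<in> bar_chains"
  unfolding bar_chains_def
  by (fastforce simp: prepend_def alg_plus_def bar_word_list_def elim!: keys_lin)

lemma zero_bar_chains: "0 \<in> bar_chains"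
  by (simp add: bar_chains_def)

lemma bar_chains_add: "x \<in> bar_chains \<Longrightarrow> y \<in> bar_chains \<Longrightarrow> x + y \<in> bar_chains"
  by (auto simp: bar_chains_def keys_add_bit)

lemma unit_bar_chains: "unit_chain \<in> bar_chains"
  by (simp add: bar_chains_def unit_chain_def bar_word_list_def)

lemma divpow_bar_chains: "q \<in> alg_plus \<Longrightarrow> divpow q n \<in> bar_chains"
  by (induction n) (auto simp: unit_bar_chains pre_bar_chains)

lemma shuffle_bar_chains: "p \<in> alg_plus \<Longrightarrow> q \<in> alg_plus \<Longrightarrow> shuffle p q n \<in> bar_chains"
  by (induction n) (auto simp: unit_bar_chains intro!: pre_bar_chains divpow_bar_chains bar_chains_add)

lemma shuffle2_bar_chains: "p \<in> alg_plus \<Longrightarrow> p' \<in> alg_plus \<Longrightarrow> q \<in> alg_plus \<Longrightarrow> shuffle2 p p' q n \<in> bar_chains"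
  by (induction n) (auto simp del: shuffle.simps intro!: pre_bar_chains shuffle_bar_chains bar_chains_add)

lemma shuffle_zero [simp]: "shuffle 0 q n = 0"
  by (induction n) auto

lemma smul_divpow: "p \<star> divpow q (Suc n) = (p * q) \<rhd> divpow q n"
  by (simp add: smul_pre)

lemma smul_shuffle2_0: "x \<star> shuffle2 p p' q 0 = (x * p) \<rhd> shuffle p' q 0 + (x * p') \<rhd> shuffle p q 0"
  by (simp add: smul_pre)

lemma smul_shuffle2_Suc: "x \<star> shuffle2 p p' q (Suc n) = (x * p) \<rhd> shuffle p' q (Suc n) + (x * p') \<rhd> shuffle p q (Suc n) + (x * q) \<rhd> shuffle2 p p' q n"
  by (simp add: smul_pre del: shuffle.simps)

context
  fixes I :: "walg set" and q :: walg
  assumes qq: "q * q \<in> I" and q: "q \<in> alg_plus"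
begin

text \<open>Every merge joins two neighbouring entries \<open>q\<close> and produces the relation
  \<open>q * q\<close>.\<close>

lemma bar_d_divpow: "bar_d (divpow q n) \<in> rel_span I"
proof (induction n)
  case 0
  show ?case by (simp add: unit_chain_def rel_span.zero bar_d_def)
next
  case (Suc n)
  have "q \<star> divpow q n \<in> rel_span I"
    by (cases n) (auto simp: smul_divpow smul_unit_chain q qq rel_span.zero divpow_bar_chains 
        simp del: divpow.simps(2) intro!: rel_span_rel)
  with Suc show ?case by (auto simp: bar_d_pre intro!: rel_span.add rel_span_pre q)
qed

lemma bar_d_shuffle_0: "p \<in> alg_plus \<Longrightarrow> bar_d (shuffle p q 0) = 0"
  by (simp add: bar_d_pre smul_unit_chain) (simp add: unit_chain_def bar_d_def)

text \<open>Two neighbouring entries \<open>q\<close> merge to a relation. Merges of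
  \<open>p\<close> with a neighbouring \<open>q\<close> occur in both orders and add up to the
  commutator, which \<open>s\<close> represents modulo \<open>I\<close>.\<close>

lemma bar_d_shuffle:
  assumes p: "p \<in> alg_plus" and s: "p * q + q * p + s \<in> I"
  shows "bar_d (shuffle p q (Suc n)) + shuffle s q n \<in> rel_span I"
proof (induction n)
  case 0
  have "bar_d (shuffle p q (Suc 0)) + shuffle s q 0 =
      (p * q + q * p + s) \<rhd> divpow q 0 + (p \<rhd> bar_d (divpow q (Suc 0)) + q \<rhd> bar_d (shuffle p q 0))"
    by (simp add: bar_d_pre smul_pre add_ac)
  also have "\<dots> \<in> rel_span I"
    using p q s unfolding bar_d_shuffle_0[OF p]
    by (simp only: rel_span.add rel_span_rel rel_span_pre divpow_bar_chains bar_d_divpow rel_span.zero)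
  finally show ?case .
next
  case (Suc n)
  have "bar_d (shuffle p q (Suc (Suc n))) + shuffle s q (Suc n) =
      (p * q + q * p + s) \<rhd> divpow q (Suc n) + (q * q) \<rhd> shuffle p q n + p \<rhd> bar_d (divpow q (Suc (Suc n)))
      + q \<rhd> (bar_d (shuffle p q (Suc n)) + shuffle s q n)"
    by (simp add: bar_d_pre smul_pre add_ac)
  also have "\<dots> \<in> rel_span I"
    using p q s qq Suc
    by (simp only: rel_span.add rel_span_rel rel_span_pre divpow_bar_chains shuffle_bar_chains bar_d_divpow)
  finally show ?case .
qed

text \<open>Both \<open>p\<close> and \<open>p'\<close> commute with \<open>q\<close> modulo
  \<open>I\<close>, so only merges of \<open>p\<close> with \<open>p'\<close> survive, and these add
  up to the commutator represented by \<open>s\<close>.\<close>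

lemma bar_d_shuffle2:
  assumes p: "p \<in> alg_plus" and p': "p' \<in> alg_plus"
    and s: "p * p' + p' * p + s \<in> I" and c: "p * q + q * p \<in> I" "p' * q + q * p' \<in> I"
  shows "bar_d (shuffle2 p p' q n) + shuffle s q n \<in> rel_span I"
proof (induction n)
  case 0
  have "bar_d (shuffle2 p p' q 0) + shuffle s q 0 =
      (p * p' + p' * p + s) \<rhd> divpow q 0 + (p \<rhd> bar_d (shuffle p' q 0) + p' \<rhd> bar_d (shuffle p q 0))"
    by (simp add: bar_d_pre smul_pre add_ac)
  also have "\<dots> \<in> rel_span I"
    using p p' q s unfolding bar_d_shuffle_0[OF p] bar_d_shuffle_0[OF p']
    by (simp only: rel_span.add rel_span_rel rel_span_pre divpow_bar_chains bar_d_divpow rel_span.zero)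
  finally show ?case .
next
  case (Suc n)
  \<comment> \<open>These are instances of the previous lemma with commutator 0.\<close>
  have d: "bar_d (shuffle p q (Suc n)) \<in> rel_span I" "bar_d (shuffle p' q (Suc n)) \<in> rel_span I"
    using bar_d_shuffle[of p 0 n] bar_d_shuffle[of p' 0 n] p p' c by simp_all
  \<comment> \<open>The added terms remove the merges of \<open>q\<close> with a leading
    \<open>p\<close> or \<open>p'\<close>, to be paired with the opposite order below; what remains
    starts with \<open>q * q\<close>.\<close>
  have e: "q \<star> shuffle2 p p' q n + ((q * p) \<rhd> shuffle p' q n + (q * p') \<rhd> shuffle p q n) \<in> rel_span I"
  proof (cases n)
    case 0
    then show ?thesis by (simp add: smul_shuffle2_0 rel_span.zero add_ac del: shuffle.simps shuffle2.simps)
  next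
    case (Suc k)
    show ?thesis unfolding Suc smul_shuffle2_Suc
      using p p' q qq by (simp add: add_ac rel_span_rel shuffle2_bar_chains del: shuffle.simps shuffle2.simps)
  qed
  have "bar_d (shuffle2 p p' q (Suc n)) + shuffle s q (Suc n) =
      (p * p' + p' * p + s) \<rhd> divpow q (Suc n) + (p * q + q * p) \<rhd> shuffle p' q n + (p' * q + q * p') \<rhd> shuffle p q n
      + (q \<star> shuffle2 p p' q n + ((q * p) \<rhd> shuffle p' q n + (q * p') \<rhd> shuffle p q n))
      + (p \<rhd> bar_d (shuffle p' q (Suc n)) + p' \<rhd> bar_d (shuffle p q (Suc n)))
      + q \<rhd> (bar_d (shuffle2 p p' q n) + shuffle s q n)"
    by (simp add: bar_d_pre smul_pre add_ac)
  also have "\<dots> \<in> rel_span I"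
    using p p' q s c d e Suc
    by (simp only: rel_span.add rel_span_rel rel_span_pre divpow_bar_chains shuffle_bar_chains)
  finally show ?case .
qed

end

definition Ph2_cycle :: chain where
  "Ph2_cycle = shuffle Sq4 Q1 4 + shuffle2 R2 Sq1 Q1 3"

text \<open>Both summands have boundary \<open>shuffle Q2 Q1 3\<close> up to relations:
  \<open>Q2\<close> is the commutator of \<open>Sq4\<close> with \<open>Q1\<close> by definition,
  and that of \<open>R2\<close> with \<open>Sq1\<close> modulo relations.\<close>

lemma bar_d_Ph2_cycle: "bar_d Ph2_cycle \<in> rel_span null_ideal"
proof -
  note rel = Q_relations[folded Q1_def, folded Q2_def R2_def]
  have 1: "bar_d (shuffle Sq4 Q1 (Suc 3)) + shuffle Q2 Q1 3 \<in> rel_span null_ideal"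
    by (rule bar_d_shuffle) (use rel plus_gens in \<open>auto simp: Q2_def null_ideal_zero\<close>)
  have 2: "bar_d (shuffle2 R2 Sq1 Q1 3) + shuffle Q2 Q1 3 \<in> rel_span null_ideal"
    by (rule bar_d_shuffle2) (use rel plus_gens in auto)
  have "bar_d Ph2_cycle = (bar_d (shuffle Sq4 Q1 (Suc 3)) + shuffle Q2 Q1 3) + (bar_d (shuffle2 R2 Sq1 Q1 3) + shuffle Q2 Q1 3)"
    by (simp add: Ph2_cycle_def numeral_eq_Suc add_ac del: shuffle.simps shuffle2.simps)
  then show ?thesis using 1 2 by (simp only: rel_span.add)
qed

text \<open>
  The chain \<open>sq_shuffle m n\<close> moves \<open>Sq\<^bsup>2m\<^esup>\<close> through \<open>[Q\<^sub>0|\<dots>|Q\<^sub>0]\<close> by the Cartan formula, where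
  \<open>Sq\<^bsup>2\<^esup> Q\<^sub>0 = Q\<^sub>1\<close>; its boundary is the sum of all shuffles of \<open>m\<close> entries \<open>Q\<^sub>1\<close> and \<open>n - m\<close> entries \<open>Q\<^sub>0\<close>.
\<close>

primrec sq_shuffle :: "nat \<Rightarrow> nat \<Rightarrow> chain" where
  "sq_shuffle m 0 = (if m = 0 then 0 else wd [2 * m] \<rhd> unit_chain)"
| "sq_shuffle m (Suc n) = (if m = 0 then 0 else
     wd [2 * m] \<rhd> divpow Sq1 (Suc n) + Sq1 \<rhd> sq_shuffle m n + Q1 \<rhd> sq_shuffle (m - 1) n)"

primrec mixed_divpow :: "nat \<Rightarrow> nat \<Rightarrow> chain" where
  "mixed_divpow m 0 = (if m = 0 then unit_chain else 0)"
| "mixed_divpow m (Suc n) = Sq1 \<rhd> mixed_divpow m n + (if m = 0 then 0 else Q1 \<rhd> mixed_divpow (m - 1) n)"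

lemma sq_shuffle_0 [simp]: "sq_shuffle 0 n = 0"
  by (cases n) auto

lemma mixed_divpow_0: "mixed_divpow 0 n = divpow Sq1 n"
  by (induction n) auto

lemma mixed_divpow_gt: "n < m \<Longrightarrow> mixed_divpow m n = 0"
  by (induction n arbitrary: m) auto

lemma mixed_divpow_diag: "mixed_divpow n n = divpow Q1 n"
  by (induction n) (auto simp: mixed_divpow_gt)

lemma plus_even: "0 < m \<Longrightarrow> wd [2 * m] \<in> alg_plus"
  by (simp add: alg_plus_def is_word_def)

lemma sq_shuffle_bar_chains: "sq_shuffle m n \<in> bar_chains"
proof (induction n arbitrary: m)
  case 0
  then show ?case
    by (cases "m = 0") (simp_all add: pre_bar_chains plus_even unit_bar_chains zero_bar_chains)
next
  case (Suc n)
  with Suc show ?case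
    by (auto simp: zero_bar_chains intro!: pre_bar_chains divpow_bar_chains bar_chains_add plus_gens plus_even simp del: divpow.simps One_nat_def)
qed

text \<open>In the induction the merges of the first two entries collect to the relation of
  \<open>sq_even_commutator\<close> and to the relations \<open>Sq1 * Sq1\<close>,
  \<open>Q1 * Q1\<close> and \<open>Sq1 * Q1 + Q1 * Sq1\<close>. The bound on \<open>m\<close> comes
  from the range of that lemma.\<close>

lemma bar_d_sq_shuffle:
  assumes "m \<le> 4" "0 < m"
  shows "bar_d (sq_shuffle m n) + mixed_divpow m n \<in> rel_span adem_ideal"
  using assms
proof (induction n arbitrary: m)
  case 0
  then show ?case
    by (simp add: bar_d_pre smul_unit_chain plus_even rel_span.zero) (simp add: unit_chain_def bar_d_def rel_span.zero)
next
  case (Suc n)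
  let ?I = "rel_span adem_ideal"
  note rel = Q_relations[folded Q1_def, folded Q2_def R2_def]
  have sub: "p \<in> null_ideal \<Longrightarrow> p \<in> adem_ideal" for p by (simp add: null_ideal_def)
  have qq: "Sq1 * Sq1 \<in> adem_ideal" "Q1 * Q1 \<in> adem_ideal" "Sq1 * Q1 + Q1 * Sq1 \<in> adem_ideal"
    using adem_relations(1) rel by (auto intro: sub)
  obtain m' where m: "m = Suc m'" using Suc.prems by (cases m) auto
  have dgam: "wd [2 * m] \<rhd> bar_d (divpow Sq1 (Suc n)) \<in> ?I"
    using qq plus_gens Suc.prems by (intro rel_span_pre bar_d_divpow plus_even) auto
  have IH: "Sq1 \<rhd> (bar_d (sq_shuffle m n) + mixed_divpow m n) \<in> ?I"
    using Suc plus_gens by (intro rel_span_pre) auto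
  note chains = divpow_bar_chains[OF plus_gens(1)] sq_shuffle_bar_chains
  show ?case
  \<comment> \<open>For \<open>m = 1\<close> the factor \<open>Sq^(2m-2)\<close> is the identity and
    gives no bar entry; the definition of \<open>Q1\<close> then takes the place of the commutator
    relation.\<close>
  proof (cases m')
    case 0
    have a: "Sq1 \<star> sq_shuffle m n + (Sq1 * Sq2) \<rhd> divpow Sq1 n \<in> ?I"
      unfolding m 0 using qq
      by (cases n) (auto simp: smul_pre rel_span.zero add_ac numeral_2_eq_2 intro!: rel_span_rel chains)
    have "bar_d (sq_shuffle m (Suc n)) + mixed_divpow m (Suc n) =
       (Sq1 \<star> sq_shuffle m n + (Sq1 * Sq2) \<rhd> divpow Sq1 n) + wd [2 * m] \<rhd> bar_d (divpow Sq1 (Suc n))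
       + Sq1 \<rhd> (bar_d (sq_shuffle m n) + mixed_divpow m n)"
      unfolding m 0 by (simp add: bar_d_pre smul_pre mixed_divpow_0 Q1_def add_ac numeral_2_eq_2)
    then show ?thesis using a dgam IH by (simp only: rel_span.add)
  next
    case (Suc k)
    have a: "Sq1 \<star> sq_shuffle m n + Q1 \<star> sq_shuffle m' n + (Sq1 * wd [2 * m] + Q1 * wd [2 * m']) \<rhd> divpow Sq1 n \<in> ?I"
    proof (cases n)
      case 0
      then show ?thesis unfolding m Suc by (simp add: smul_pre rel_span.zero add_ac)
    next
      case n: (Suc n')
      have "Sq1 \<star> sq_shuffle m n + Q1 \<star> sq_shuffle m' n + (Sq1 * wd [2 * m] + Q1 * wd [2 * m']) \<rhd> divpow Sq1 n =
        (Sq1 * Sq1) \<rhd> sq_shuffle m n' + (Sq1 * Q1 + Q1 * Sq1) \<rhd> sq_shuffle m' n' + (Q1 * Q1) \<rhd> sq_shuffle k n'"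
        unfolding m Suc n by (simp add: smul_pre add_ac)
      then show ?thesis using qq by (simp only: rel_span.add rel_span_rel chains)
    qed
    have b: "wd [2 * m] * Sq1 + Sq1 * wd [2 * m] + Q1 * wd [2 * m'] \<in> adem_ideal"
    proof -
      have "m \<in> {2, 3, 4}" using Suc.prems unfolding m Suc insert_iff by arith
      moreover have "2 * m - 2 = 2 * m'" by (simp add: m)
      ultimately show ?thesis using sq_even_commutator[of m] by (simp only: Q1_def)
    qed
    have c: "Q1 \<rhd> (bar_d (sq_shuffle m' n) + mixed_divpow m' n) \<in> ?I"
      using Suc.IH[of m'] plus_gens Suc.prems m Suc by (intro rel_span_pre) auto
    have "bar_d (sq_shuffle m (Suc n)) + mixed_divpow m (Suc n) =
       (Sq1 \<star> sq_shuffle m n + Q1 \<star> sq_shuffle m' n + (Sq1 * wd [2 * m] + Q1 * wd [2 * m']) \<rhd> divpow Sq1 n)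
       + (wd [2 * m] * Sq1 + Sq1 * wd [2 * m] + Q1 * wd [2 * m']) \<rhd> divpow Sq1 n
       + wd [2 * m] \<rhd> bar_d (divpow Sq1 (Suc n)) + Sq1 \<rhd> (bar_d (sq_shuffle m n) + mixed_divpow m n)
       + Q1 \<rhd> (bar_d (sq_shuffle m' n) + mixed_divpow m' n)"
      unfolding m by (simp add: bar_d_pre smul_pre add_ac)
    then show ?thesis using a b c dgam IH by (simp only: rel_span.add rel_span_rel chains)
  qed
qed

text \<open>With as many entries \<open>Q1\<close> as places, no entry \<open>Sq1\<close> is left
  and the mixed shuffle is the divided power of \<open>Q1\<close>.\<close>

lemma Q1_power_boundary: "bar_d (sq_shuffle 4 4) + divpow Q1 4 \<in> bar_rel"
  using bar_d_sq_shuffle[of 4 4] rel_span_adem mixed_divpow_diag[of 4] by auto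

section \<open>The transfer on bar chains\<close>

definition lift_chain :: "nat \<Rightarrow> chain \<Rightarrow> chain" where
  "lift_chain i = lin (\<lambda>(ws, m). Poly_Mapping.single (ws, m + Poly_Mapping.single i (-1)) 1)"

text \<open>
  The snake lemma with the lift \<open>z \<mapsto> z x\<^sub>i\<^bsup>-1\<^esup>\<close>: the commutator of the lift and the boundary has no
  negative exponents and differs from the boundary of the lift of a cycle by relations.
\<close>

definition transfer_step :: "nat \<Rightarrow> chain \<Rightarrow> chain" where
  "transfer_step i z = bar_d (lift_chain i z) + lift_chain i (bar_d z)"

lemma lift_simps [simp]: "lift_chain i 0 = 0" "lift_chain i (x + y) = lift_chain i x + lift_chain i y"
  "lift_chain i (Poly_Mapping.single (ws, m) 1) = Poly_Mapping.single (ws, m + Poly_Mapping.single i (-1)) 1"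
  by (simp_all add: lift_chain_def)

lemma lift_pre: "lift_chain i (p \<rhd> z) = p \<rhd> lift_chain i z"
proof (induction p rule: bit_poly_induct)
  case (single w)
  show ?case
  proof (induction z rule: bit_poly_induct)
    case (single x)
    then show ?case by (cases x) simp
  qed simp_all
qed simp_all

lemma lift_coef: "lift_chain i (coef q) = coef (q * xv i (-1))"
  by (induction q rule: bit_poly_induct) (simp_all add: xv_def mult_single distrib_right)

lemma lift_rel_span: "x \<in> rel_span I \<Longrightarrow> lift_chain i x \<in> rel_span I"
proof (induction rule: rel_span.induct)
  case (rel p ws m)
  then show ?case by (simp add: lift_pre rel_span.rel)
qed (auto simp: lift_pre intro: rel_span.intros)

lemma smul_rel_span: "x \<in> rel_span null_ideal \<Longrightarrow> is_word w \<Longrightarrow> w \<noteq> [] \<Longrightarrow> wd w \<star> x \<in> rel_span null_ideal"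
  by (induction rule: rel_span.induct) (auto simp: smul_pre wd_mult null_ideal_wd intro: rel_span.intros)

lemma smul_bar_chains: "bar_word_list ws \<Longrightarrow> is_word w \<Longrightarrow> wd w \<star> Poly_Mapping.single (ws, m) 1 \<in> bar_chains"
proof (cases ws)
  case Nil
  have "coef q \<in> bar_chains" for q
    by (auto simp: bar_chains_def bar_word_list_def coef_def elim!: keys_lin)
  then show ?thesis using Nil by simp
next
  case (Cons v vs)
  assume "bar_word_list ws" "is_word w"
  then show ?thesis using Cons by (auto simp: bar_chains_def bar_word_list_def)
qed

lemma bar_d_bar_chains: "bar_word_list ws \<Longrightarrow> bar_d (Poly_Mapping.single (ws, m) 1) \<in> bar_chains"
proof (induction ws)
  case Nil
  have "bar_d (coef (Poly_Mapping.single m 1)) = 0" by (rule bar_d_coef)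
  then show ?case by (simp add: zero_bar_chains)
next
  case (Cons w ws)
  have w: "is_word w" "w \<noteq> []" "bar_word_list ws" using Cons.prems by (auto simp: bar_word_list_def)
  have "bar_d (wd w \<rhd> Poly_Mapping.single (ws, m) 1) \<in> bar_chains"
    unfolding bar_d_pre using w Cons.IH
    by (intro bar_chains_add smul_bar_chains pre_bar_chains) (auto simp: alg_plus_def)
  then show ?case by simp
qed

text \<open>A relation in the last entry is merged into the coefficient, where it acts as zero by
  the definition of \<open>null_ideal\<close>. In any other entry a merge multiplies it by a word,
  and the ideal is two-sided.\<close>

lemma bar_d_rel_span: "x \<in> rel_span null_ideal \<Longrightarrow> bar_d x \<in> rel_span null_ideal"
proof (induction rule: rel_span.induct)
  case (rel p ws m)
  have "p \<star> Poly_Mapping.single (ws, m) 1 \<in> rel_span null_ideal"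
  proof (cases ws)
    case Nil
    have "p \<star> coef (Poly_Mapping.single m 1) = 0"
      using rel by (simp only: smul_coef) (simp add: null_ideal_def)
    then show ?thesis using Nil by (simp add: rel_span.zero)
  next
    case (Cons v vs)
    have "(p * wd v) \<rhd> Poly_Mapping.single (vs, m) 1 \<in> rel_span null_ideal"
      using rel Cons by (intro rel_span.rel null_ideal_wd) (auto simp: bar_word_list_def)
    then show ?thesis using Cons smul_pre[of p "wd v" "Poly_Mapping.single (vs, m) 1"] by simp
  qed
  then show ?case using rel
    by (simp only: bar_d_pre rel_span.add rel_span_rel bar_d_bar_chains)
next
  case (prepend x w)
  then show ?case
    unfolding bar_d_pre by (intro rel_span.add rel_span.prepend smul_rel_span)
qed (auto intro: rel_span.intros)

text \<open>In characteristic 2 this is the commutator of the operation with multiplication by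
  \<open>x_i^{-1}\<close>.\<close>

definition laurent_defect :: "nat \<Rightarrow> word \<Rightarrow> laurent \<Rightarrow> laurent" where
  "laurent_defect i w q = act w (q * xv i (-1)) + act w q * xv i (-1)"

lemma step_zero [simp]: "transfer_step i 0 = 0" and step_add [simp]: "transfer_step i (x + y) = transfer_step i x + transfer_step i y"
  by (simp_all add: transfer_step_def ac_simps)

lemma step_pre_coef: "transfer_step i (wd w \<rhd> coef q) = coef (laurent_defect i w q)"
  by (simp add: transfer_step_def bar_d_pre lift_pre lift_coef smul_coef laurent_defect_def)

text \<open>Merging two words does not touch the coefficient and so commutes with the lift. Hence
  only the last entry contributes to a transfer step.\<close>

lemma step_pre_pre: "transfer_step i (p \<rhd> (q \<rhd> z)) = p \<rhd> transfer_step i (q \<rhd> z)"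
  by (simp add: transfer_step_def bar_d_pre lift_pre smul_pre ac_simps)

lemma step_snoc: "transfer_step i (Poly_Mapping.single (us @ [w], m) 1) =
    lin (\<lambda>m'. Poly_Mapping.single (us, m') 1) (laurent_defect i w (Poly_Mapping.single m 1))"
proof (induction us)
  case Nil
  then show ?case using step_pre_coef[of i w "Poly_Mapping.single m 1"] by (simp add: coef_def)
next
  case (Cons u us)
  obtain v vs where v: "us @ [w] = v # vs" by (cases us) auto
  have "transfer_step i (Poly_Mapping.single (u # us @ [w], m) 1) = wd u \<rhd> transfer_step i (Poly_Mapping.single (us @ [w], m) 1)"
    unfolding v using step_pre_pre[of i "wd u" "wd v" "Poly_Mapping.single (vs, m) 1"] by simp
  moreover have "wd u \<rhd> lin (\<lambda>m'. Poly_Mapping.single (us, m') 1) q = lin (\<lambda>m'. Poly_Mapping.single (u # us, m') 1) q" for q :: laurent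
    by (induction q rule: bit_poly_induct) simp_all
  ultimately show ?case using Cons by simp
qed

definition poly_span :: "nat \<Rightarrow> laurent set" where
  "poly_span k = {q. Poly_Mapping.keys q \<subseteq> P_monoms k}"

lemma poly_span_zero: "0 \<in> poly_span k"
  by (simp add: poly_span_def)

lemma poly_span_add: "p \<in> poly_span k \<Longrightarrow> q \<in> poly_span k \<Longrightarrow> p + q \<in> poly_span k"
  by (auto simp: poly_span_def keys_add_bit)

lemma poly_span_sum: "(\<And>a. a \<in> A \<Longrightarrow> f a \<in> poly_span k) \<Longrightarrow> sum f A \<in> poly_span k"
  by (induction A rule: infinite_finite_induct) (auto simp: poly_span_zero poly_span_add)

lemma P_monoms_add: "m \<in> P_monoms k \<Longrightarrow> m' \<in> P_monoms k \<Longrightarrow> m + m' \<in> P_monoms k"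
  using keys_add[of m m'] by (auto simp: P_monoms_def lookup_add)

lemma P_monoms_mono: "m \<in> P_monoms k \<Longrightarrow> k \<le> k' \<Longrightarrow> m \<in> P_monoms k'"
  by (auto simp: P_monoms_def)

lemma poly_span_mult: "p \<in> poly_span k \<Longrightarrow> q \<in> poly_span k \<Longrightarrow> p * q \<in> poly_span k"
  using keys_mult[of p q] P_monoms_add by (fastforce simp: poly_span_def)

lemma P_monoms_single: "v < k \<Longrightarrow> 0 \<le> n \<Longrightarrow> Poly_Mapping.single v n \<in> P_monoms k"
  by (auto simp: P_monoms_def lookup_single when_def split: if_splits)

lemma poly_span_xv: "v < k \<Longrightarrow> 0 \<le> n \<Longrightarrow> xv v n \<in> poly_span k"
  by (simp add: poly_span_def xv_def P_monoms_single)

lemma sq_monom_keys: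
  assumes "m' \<in> Poly_Mapping.keys (sq_monom j m)"
  obtains e where "Poly_Mapping.keys e \<subseteq> Poly_Mapping.keys m"
    "(\<Sum>v\<in>Poly_Mapping.keys m. Poly_Mapping.lookup e v) = j" "m' = m + Poly_Mapping.map int e"
    "\<And>v. binom_mod2 (Poly_Mapping.lookup m v) (Poly_Mapping.lookup e v) = 1"
proof -
  let ?E = "{e. Poly_Mapping.keys e \<subseteq> Poly_Mapping.keys m \<and> (\<Sum>v\<in>Poly_Mapping.keys m. Poly_Mapping.lookup e v) = j}"
  let ?f = "\<lambda>e. Poly_Mapping.single (m + Poly_Mapping.map int e)
    (\<Prod>v\<in>Poly_Mapping.keys m. binom_mod2 (Poly_Mapping.lookup m v) (Poly_Mapping.lookup e v))"
  have "Poly_Mapping.keys (sum ?f A) \<subseteq> (\<Union>e\<in>A. Poly_Mapping.keys (?f e))" for A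
    by (induction A rule: infinite_finite_induct) (auto simp: keys_add_bit split: if_splits)
  then obtain e where e: "e \<in> ?E" "m' \<in> Poly_Mapping.keys (?f e)"
    using assms unfolding sq_monom_def by blast
  have "binom_mod2 (Poly_Mapping.lookup m v) (Poly_Mapping.lookup e v) = 1" for v
  proof (cases "v \<in> Poly_Mapping.keys m")
    case True
    have "(\<Prod>v\<in>Poly_Mapping.keys m. binom_mod2 (Poly_Mapping.lookup m v) (Poly_Mapping.lookup e v)) \<noteq> 0"
      using e(2) by (auto split: if_splits)
    then show ?thesis using True by auto
  next
    case False
    then have "Poly_Mapping.lookup e v = 0" using e(1) by (auto simp: in_keys_iff)
    then show ?thesis by simp
  qed
  with e that show thesis by (auto split: if_splits)
qed

lemma poly_span_sq:
  assumes "p \<in> poly_span k" shows "sq j p \<in> poly_span k"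
proof -
  have "m' \<in> P_monoms k" if "m' \<in> Poly_Mapping.keys (sq_monom j m)" "m \<in> P_monoms k" for m m'
    using that(1)
  proof (rule sq_monom_keys)
    fix e :: "nat \<Rightarrow>\<^sub>0 nat"
    assume e: "Poly_Mapping.keys e \<subseteq> Poly_Mapping.keys m" "m' = m + Poly_Mapping.map int e"
    have "Poly_Mapping.keys (Poly_Mapping.map int e) = Poly_Mapping.keys e"
      by (auto simp: in_keys_iff lookup_map_int)
    then have "Poly_Mapping.map int e \<in> P_monoms k"
      using e that by (auto simp: P_monoms_def lookup_map_int)
    then show ?thesis using e that by (simp add: P_monoms_add)
  qed
  then show ?thesis using assms by (auto simp: poly_span_def sq_def elim!: keys_lin)
qed

lemma poly_span_act: "p \<in> poly_span k \<Longrightarrow> act w p \<in> poly_span k"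
  by (induction w) (auto simp: poly_span_sq)

text \<open>In the Cartan formula for \<open>sq j (q * x_i^{-1})\<close> only the term with all of
  \<open>Sq^j\<close> on \<open>q\<close> keeps the exponent \<open>-1\<close>, and the second
  summand of the defect cancels it.\<close>

lemma poly_span_defect:
  assumes "q \<in> poly_span i" shows "laurent_defect i w q \<in> poly_span (Suc i)"
proof (induction w)
  case Nil
  then show ?case by (simp add: laurent_defect_def poly_span_zero)
next
  case (Cons j w)
  have Q: "act w q \<in> poly_span (Suc i)"
    using poly_span_act[OF assms, of w] P_monoms_mono[of _ i "Suc i"] by (auto simp: poly_span_def)
  have "sq j (act w q * xv i (-1)) = (\<Sum>k=0..j. sq k (act w q) * xv i (int (j - k) - 1))"
    unfolding sq_mult by (rule sum.cong) (simp_all add: sq_xv_if binom_mod2_minus1)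
  also have "\<dots> = sq j (act w q) * xv i (-1) + (\<Sum>k<j. sq k (act w q) * xv i (int (j - k) - 1))"
    by (simp add: atLeast0AtMost flip: lessThan_Suc_atMost)
  finally have eq: "sq j (act w q * xv i (-1)) + sq j (act w q) * xv i (-1) = (\<Sum>k<j. sq k (act w q) * xv i (int (j - k) - 1))"
    by (simp add: ac_simps)
  have "laurent_defect i (j # w) q = sq j (laurent_defect i w q) + (sq j (act w q * xv i (-1)) + sq j (act w q) * xv i (-1))"
    by (simp add: laurent_defect_def ac_simps)
  also have "\<dots> \<in> poly_span (Suc i)" unfolding eq
    using Cons Q by (intro poly_span_add poly_span_sq poly_span_sum poly_span_mult poly_span_xv) auto
  finally show ?case .
qed

section \<open>Odd exponents under operations and transfer steps\<close>

definition odd_vars :: "expo \<Rightarrow> nat set" where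
  "odd_vars m = {v. odd (Poly_Mapping.lookup m v)}"

lemma odd_vars_subset_keys: "odd_vars m \<subseteq> Poly_Mapping.keys m"
  by (auto simp: odd_vars_def in_keys_iff)

lemma finite_odd_vars [simp]: "finite (odd_vars m)"
  using odd_vars_subset_keys by (rule finite_subset) simp

lemma expo_deg_superset:
  assumes "finite V" "Poly_Mapping.keys m \<subseteq> V"
  shows "expo_deg m = (\<Sum>v\<in>V. Poly_Mapping.lookup m v)"
  unfolding expo_deg_def using assms by (intro sum.mono_neutral_left) (auto simp: in_keys_iff)

lemma expo_deg_add: "expo_deg (m + m') = expo_deg m + expo_deg m'"
proof -
  let ?V = "Poly_Mapping.keys m \<union> Poly_Mapping.keys m'"
  have "expo_deg (m + m') = (\<Sum>v\<in>?V. Poly_Mapping.lookup (m + m') v)"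
    using keys_add[of m m'] by (intro expo_deg_superset) auto
  then show ?thesis by (simp add: lookup_add sum.distrib expo_deg_superset[of ?V])
qed

lemma expo_deg_single [simp]: "expo_deg (Poly_Mapping.single v n) = n"
  by (simp add: expo_deg_def)

lemma even_expo_deg: "even (expo_deg m) \<longleftrightarrow> even (card (odd_vars m))"
proof -
  have "{v \<in> Poly_Mapping.keys m. odd (Poly_Mapping.lookup m v)} = odd_vars m"
    using odd_vars_subset_keys by (auto simp: odd_vars_def)
  then show ?thesis by (simp add: expo_deg_def even_sum_iff)
qed

lemma of_nat_bit_odd: "odd n \<Longrightarrow> of_nat n = (1 :: bit)"
  by (auto elim!: oddE)

lemma of_int_bit_even: "even n \<Longrightarrow> of_int n = (0 :: bit)"
  by (auto elim!: evenE)

text \<open>Absorption gives \<open>j * binom(i, j) = i * binom(i - 1, j - 1)\<close>; the right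
  side is even and \<open>j\<close> is odd.\<close>

lemma binom_mod2_even_odd:
  assumes "even i" "odd j" shows "binom_mod2 i j = 0"
proof -
  obtain k where j: "j = Suc k" using assms by (cases j) auto
  have "of_nat (Suc k) * (of_int i gchoose Suc k :: rat) = of_int i * (of_int (i - 1) gchoose k)"
    using gbinomial_absorption[of k "of_int i :: rat"] by simp
  then have "of_int (int (Suc k)) * (of_int \<lfloor>of_int i gchoose Suc k :: rat\<rfloor>) = (of_int i * of_int \<lfloor>of_int (i - 1) gchoose k :: rat\<rfloor> :: rat)"
    unfolding of_int_floor_gbinomial by simp
  then have "int (Suc k) * \<lfloor>of_int i gchoose Suc k :: rat\<rfloor> = i * \<lfloor>of_int (i - 1) gchoose k :: rat\<rfloor>"
    unfolding of_int_mult[symmetric] of_int_eq_iff .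
  then have "of_int (int (Suc k) * \<lfloor>of_int i gchoose Suc k :: rat\<rfloor>) = (of_int (i * \<lfloor>of_int (i - 1) gchoose k :: rat\<rfloor>) :: bit)"
    by (rule arg_cong)
  then have "of_nat j * binom_mod2 i j = (0 :: bit)"
    unfolding of_int_mult of_int_of_nat_eq of_int_bit_even[OF assms(1)] binom_mod2_def j by simp
  then show ?thesis using of_nat_bit_odd[OF assms(2)] by simp
qed

text \<open>By the previous lemma an even exponent can only be raised by an even amount, so no new
  odd exponent appears.\<close>

lemma sq_monom_keys_odd:
  assumes "m' \<in> Poly_Mapping.keys (sq_monom j m)"
  shows "odd_vars m' \<subseteq> odd_vars m" "expo_deg m' = expo_deg m + int j"
proof -
  obtain e where e: "Poly_Mapping.keys e \<subseteq> Poly_Mapping.keys m"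
    "(\<Sum>v\<in>Poly_Mapping.keys m. Poly_Mapping.lookup e v) = j" "m' = m + Poly_Mapping.map int e"
    "\<And>v. binom_mod2 (Poly_Mapping.lookup m v) (Poly_Mapping.lookup e v) = 1"
    using sq_monom_keys[OF assms] by metis
  show "odd_vars m' \<subseteq> odd_vars m"
  proof
    fix v assume "v \<in> odd_vars m'"
    then show "v \<in> odd_vars m"
      using e(4)[of v] binom_mod2_even_odd[of "Poly_Mapping.lookup m v" "Poly_Mapping.lookup e v"]
      by (auto simp: odd_vars_def e(3) lookup_add lookup_map_int)
  qed
  have "Poly_Mapping.keys (Poly_Mapping.map int e) = Poly_Mapping.keys e"
    by (auto simp: in_keys_iff lookup_map_int)
  then have "expo_deg (Poly_Mapping.map int e) = (\<Sum>v\<in>Poly_Mapping.keys m. int (Poly_Mapping.lookup e v))"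
    using e(1) by (subst expo_deg_superset[of "Poly_Mapping.keys m"]) (auto simp: lookup_map_int)
  then show "expo_deg m' = expo_deg m + int j"
    by (simp add: e(3) expo_deg_add flip: e(2))
qed

lemma act_keys_odd:
  assumes "m' \<in> Poly_Mapping.keys (act w q)"
  obtains m where "m \<in> Poly_Mapping.keys q" "odd_vars m' \<subseteq> odd_vars m" "expo_deg m' = expo_deg m + int (sum_list w)"
  using assms
proof (induction w arbitrary: m' thesis)
  case Nil
  then show ?case by auto
next
  case (Cons j w)
  from Cons.prems(2) have "m' \<in> Poly_Mapping.keys (lin (sq_monom j) (act w q))" by (simp add: sq_def)
  then obtain b where b: "b \<in> Poly_Mapping.keys (act w q)" "m' \<in> Poly_Mapping.keys (sq_monom j b)"
    by (rule keys_lin)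
  obtain m where "m \<in> Poly_Mapping.keys q" "odd_vars b \<subseteq> odd_vars m" "expo_deg b = expo_deg m + int (sum_list w)"
    using Cons.IH[OF _ b(1)] by blast
  then show ?case using sq_monom_keys_odd[OF b(2)] by (intro Cons.prems(1)[of m]) auto
qed

lemma odd_vars_add_single: "odd_vars (m + Poly_Mapping.single i n) \<subseteq> insert i (odd_vars m)"
  by (auto simp: odd_vars_def lookup_add lookup_single when_def split: if_splits)

lemma mult_xv_keys:
  assumes "m' \<in> Poly_Mapping.keys (q * xv i n)"
  obtains m where "m \<in> Poly_Mapping.keys q" "m' = m + Poly_Mapping.single i n"
  using assms keys_mult[of q "xv i n"] by (auto simp: xv_def)

lemma defect_keys_odd:
  assumes "m' \<in> Poly_Mapping.keys (laurent_defect i w (Poly_Mapping.single m 1))"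
  shows "odd_vars m' \<subseteq> insert i (odd_vars m)" "expo_deg m' = expo_deg m - 1 + int (sum_list w)"
proof -
  from assms consider "m' \<in> Poly_Mapping.keys (act w (Poly_Mapping.single m 1 * xv i (-1)))"
    | "m' \<in> Poly_Mapping.keys (act w (Poly_Mapping.single m 1) * xv i (-1))"
    by (auto simp: laurent_defect_def keys_add_bit)
  then have "odd_vars m' \<subseteq> insert i (odd_vars m) \<and> expo_deg m' = expo_deg m - 1 + int (sum_list w)"
  proof cases
    case 1
    then show ?thesis
      by (rule act_keys_odd, elim mult_xv_keys)
        (use odd_vars_add_single[of m i "-1"] in \<open>auto simp: expo_deg_add\<close>)
  next
    case 2
    then obtain b where b: "b \<in> Poly_Mapping.keys (act w (Poly_Mapping.single m 1))" "m' = b + Poly_Mapping.single i (-1)"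
      by (rule mult_xv_keys)
    from b(1) show ?thesis
      by (rule act_keys_odd) (use odd_vars_add_single[of b i "-1"] b(2) in \<open>auto simp: expo_deg_add\<close>)
  qed
  then show "odd_vars m' \<subseteq> insert i (odd_vars m)" "expo_deg m' = expo_deg m - 1 + int (sum_list w)" by auto
qed

definition even_words :: "word list \<Rightarrow> nat" where
  "even_words ws = length (filter (\<lambda>w. even (sum_list w)) ws)"

text \<open>
  Each step of the transfer adds the odd exponent \<open>-1\<close> and applies the last word. If that word has
  odd degree, it removes an odd exponent; otherwise the number of even words drops.
\<close>

definition tame :: "nat \<Rightarrow> int \<Rightarrow> nat \<Rightarrow> chain set" where
  "tame n t i = {z \<in> bar n t (P_monoms i). \<forall>(ws, m)\<in>Poly_Mapping.keys z. card (odd_vars m) + even_words ws \<le> 1}"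

lemma step_tame:
  assumes "z \<in> tame (Suc n) (t + 1) i"
  shows "transfer_step i z \<in> tame n t (Suc i)"
proof -
  have step_eq: "transfer_step i z = lin (\<lambda>x. transfer_step i (Poly_Mapping.single x 1)) z"
    by (induction z rule: bit_poly_induct) simp_all
  have "length ws' = n \<and> bar_word_list ws' \<and> m' \<in> P_monoms (Suc i) \<and> words_deg ws' + expo_deg m' = t
      \<and> card (odd_vars m') + even_words ws' \<le> 1"
    if "(ws', m') \<in> Poly_Mapping.keys (transfer_step i z)" for ws' m'
  proof -
    from that obtain x where x: "x \<in> Poly_Mapping.keys z" "(ws', m') \<in> Poly_Mapping.keys (transfer_step i (Poly_Mapping.single x 1))"
      unfolding step_eq by (rule keys_lin)
    obtain ws m where [simp]: "x = (ws, m)" by (cases x)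
    have z: "length ws = Suc n" "bar_word_list ws" "m \<in> P_monoms i" "words_deg ws + expo_deg m = t + 1"
      "card (odd_vars m) + even_words ws \<le> 1"
      using assms x(1) by (auto simp: tame_def bar_def)
    obtain us w where ws: "ws = us @ [w]" using z(1) by (cases ws rule: rev_cases) auto
    have m': "m' \<in> Poly_Mapping.keys (laurent_defect i w (Poly_Mapping.single m 1))" and [simp]: "ws' = us"
      using x(2) by (auto simp: ws step_snoc elim!: keys_lin)
    have "Poly_Mapping.single m 1 \<in> poly_span i" using z(3) by (simp add: poly_span_def)
    then have "m' \<in> P_monoms (Suc i)"
      using m' poly_span_defect[of "Poly_Mapping.single m 1" i w] by (auto simp: poly_span_def)
    moreover have "words_deg us + expo_deg m' = t"
      using z(4) defect_keys_odd(2)[OF m'] by (simp add: words_deg_def ws)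
    moreover have "card (odd_vars m') + even_words us \<le> 1"
    proof -
      have "card (odd_vars m') \<le> card (insert i (odd_vars m))"
        using defect_keys_odd(1)[OF m'] by (intro card_mono) auto
      also have "\<dots> \<le> Suc (card (odd_vars m))"
        by (simp add: card_insert_le_m1 card_insert_if)
      finally have le: "card (odd_vars m') \<le> Suc (card (odd_vars m))" .
      show ?thesis
      proof (cases "even (sum_list w)")
        case True
        then show ?thesis using le z(5) by (simp add: ws even_words_def)
      next
        case False
        \<comment> \<open>An odd word together with the factor \<open>x_i^{-1}\<close> changes the
          degree by an even number, so an increase of the count by exactly 1 is impossible.\<close>
        then have "even (card (odd_vars m')) \<longleftrightarrow> even (card (odd_vars m))"
          using defect_keys_odd(2)[OF m'] by (simp flip: even_expo_deg)
        then have "card (odd_vars m') \<le> card (odd_vars m)" using le by (auto simp: le_Suc_eq)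
        then show ?thesis using z(5) False by (simp add: ws even_words_def)
      qed
    qed
    ultimately show ?thesis using z by (auto simp: ws bar_word_list_def)
  qed
  then show ?thesis by (auto simp: tame_def bar_def)
qed

lemma bar_proj_lift:
  assumes "z \<in> bar n t (P_monoms i)" shows "bar_proj i (lift_chain i z) = z"
proof -
  have "bar_proj i (lift_chain i z) = lin (\<lambda>x. Poly_Mapping.single x 1) z"
    unfolding bar_proj_def lift_chain_def lin_compose
  proof (rule lin_cong)
    fix x assume "x \<in> Poly_Mapping.keys z"
    then obtain ws m where x: "x = (ws, m)" "m \<in> P_monoms i" using assms by (auto simp: bar_def)
    then have "Poly_Mapping.lookup m i = 0" by (auto simp: P_monoms_def in_keys_iff)
    then show "lin (\<lambda>(ws, m). if Poly_Mapping.lookup m i = - 1 then Poly_Mapping.single (ws, m + Poly_Mapping.single i 1) 1 else 0)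
          (case x of (ws, m) \<Rightarrow> Poly_Mapping.single (ws, m + Poly_Mapping.single i (- 1)) 1) = Poly_Mapping.single x 1"
      by (simp add: x lookup_add add.assoc flip: single_add)
  qed
  then show ?thesis by (simp add: lin_id)
qed

lemma lift_bar:
  assumes "z \<in> bar n (t + 1) (P_monoms i)" shows "lift_chain i z \<in> bar n t (Phat_monoms i)"
proof -
  have "m + Poly_Mapping.single i (-1) \<in> Phat_monoms i" if "m \<in> P_monoms i" for m
  proof -
    have "Poly_Mapping.lookup m i = 0" using that by (auto simp: P_monoms_def in_keys_iff)
    then show ?thesis
      using that keys_add[of m "Poly_Mapping.single i (-1)"]
      by (auto simp: P_monoms_def Phat_monoms_def lookup_add lookup_single when_def subset_iff less_imp_le)
  qed
  then show ?thesis using assms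
    by (fastforce simp: bar_def lift_chain_def expo_deg_add elim!: keys_lin)
qed

lemma rel_span_null_bar_rel: "x \<in> rel_span null_ideal \<Longrightarrow> x \<in> bar_rel"
  using rel_span_mono[of null_ideal adem_ideal] rel_span_adem by (auto simp: null_ideal_def)

text \<open>The lift is the preimage \<open>w\<close> required by \<open>connecting\<close>: it
  projects to \<open>z\<close> exactly, and the discrepancy \<open>lift_chain i (bar_d z)\<close>
  consists of relations.\<close>

lemma step_connecting:
  assumes z: "z \<in> tame (Suc n) (t + 1) i" "bar_d z \<in> rel_span null_ideal" "z \<in> X"
  shows "transfer_step i z \<in> connecting i n t X" "bar_d (transfer_step i z) \<in> rel_span null_ideal"
proof -
  have zb: "z \<in> bar (Suc n) (t + 1) (P_monoms i)" using z by (simp add: tame_def)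
  show d: "bar_d (transfer_step i z) \<in> rel_span null_ideal"
    using z(2) by (simp add: transfer_step_def bar_d_bar_d lift_rel_span bar_d_rel_span)
  have "transfer_step i z \<in> tor_cycles n t (Suc i)"
    using step_tame[OF z(1)] rel_span_null_bar_rel[OF d] by (simp add: tame_def tor_cycles_def)
  moreover have "bar_proj i (lift_chain i z) - z \<in> bar_rel"
    by (simp add: bar_proj_lift[OF zb])
  moreover have "bar_d (lift_chain i z) - transfer_step i z \<in> bar_rel"
    using lift_rel_span[OF z(2), of i] by (simp add: transfer_step_def diff_eq_add rel_span_null_bar_rel)
  ultimately show "transfer_step i z \<in> connecting i n t X"
    unfolding connecting_def using z(3) lift_bar[OF zb] by blast
qed

text \<open>One tame representative suffices, since \<open>transfer_PH\<close> prescribes the value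
  on every element of \<open>tor_transfer\<close>. After \<open>i\<close> steps \<open>k - i\<close>
  bar entries remain.\<close>

lemma connecting_iter_ex:
  assumes "z \<in> tame k (int k + d) 0" "bar_d z \<in> rel_span null_ideal" "z \<in> X"
  shows "i \<le> k \<Longrightarrow> \<exists>y\<in>connecting_iter k d i X. y \<in> tame (k - i) (int (k - i) + d) i \<and> bar_d y \<in> rel_span null_ideal"
proof (induction i)
  case 0
  then show ?case using assms by auto
next
  case (Suc i)
  then obtain y where y: "y \<in> connecting_iter k d i X" "y \<in> tame (k - i) (int (k - i) + d) i" "bar_d y \<in> rel_span null_ideal"
    by auto
  have "k - i = Suc (k - Suc i)" using Suc.prems by simp
  then have t: "y \<in> tame (Suc (k - Suc i)) (d + int (k - Suc i) + 1) i"
    using y(2) by (simp add: ac_simps)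
  have "transfer_step i y \<in> tame (k - Suc i) (int (k - Suc i) + d) (Suc i)"
    using step_tame[OF t] by (simp add: ac_simps)
  moreover note step_connecting[OF t y(3) y(1)]
  ultimately show ?case by auto
qed

section \<open>Hit monomials in degree 11\<close>

lemma sq_mult_xv1: "sq (Suc j) (xv v 1 * p) = xv v 1 * sq (Suc j) p + xv v 2 * sq j p"
proof -
  have "sq (Suc j) (xv v 1 * p) = (\<Sum>i=0..Suc j. sq i (xv v 1) * sq (Suc j - i) p)"
    by (rule sq_mult)
  also have "\<dots> = (\<Sum>i\<in>{0, 1}. sq i (xv v 1) * sq (Suc j - i) p)"
    by (rule sum.mono_neutral_right) (auto simp: sq_xv_if binom_mod2_1)
  also have "\<dots> = xv v 1 * sq (Suc j) p + xv v 2 * sq j p"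
    by (simp add: sq_xv_if binom_mod2_1)
  finally show ?thesis .
qed

lemma sq_mult_xv2: "sq (Suc (Suc j)) (xv v 2 * p) = xv v 2 * sq (Suc (Suc j)) p + xv v 4 * sq j p"
proof -
  have "xv v 2 * p = xv v 1 * (xv v 1 * p)" by (simp add: xv_mult flip: mult.assoc)
  then have "sq (Suc (Suc j)) (xv v 2 * p) = xv v 1 * sq (Suc (Suc j)) (xv v 1 * p) + xv v 2 * sq (Suc j) (xv v 1 * p)"
    by (simp only: sq_mult_xv1)
  also have "\<dots> = xv v 2 * sq (Suc (Suc j)) p + xv v 4 * sq j p"
    unfolding sq_mult_xv1 by (simp add: distrib_left xv_mult add_ac flip: mult.assoc)
  finally show ?thesis .
qed

lemma sq2_mult_xv4: "sq 2 (xv v 4 * p) = xv v 4 * sq 2 p"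
proof -
  have "xv v 4 * p = xv v 2 * (xv v 2 * p)" by (simp add: xv_mult flip: mult.assoc)
  then have "sq (Suc (Suc 0)) (xv v 4 * p) = xv v 2 * sq (Suc (Suc 0)) (xv v 2 * p) + xv v 4 * (xv v 2 * p)"
    by (simp only: sq_mult_xv2 sq_0)
  also have "\<dots> = xv v 4 * sq (Suc (Suc 0)) p"
    unfolding sq_mult_xv2 by (simp add: distrib_left xv_mult add_ac flip: mult.assoc)
  finally show ?thesis by (simp add: numeral_2_eq_2)
qed

text \<open>The instability condition, by splitting off one factor \<open>x_v\<close>: its only
  nonzero squares are \<open>Sq^0\<close> and \<open>Sq^1\<close>, so the top square is
  \<open>x_v^2\<close> times that of the remaining monomial.\<close>

lemma sq_monomial_instable:
  assumes "\<And>v. 0 \<le> Poly_Mapping.lookup m v" "expo_deg m = int d"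
  shows "sq d (Poly_Mapping.single m 1) = Poly_Mapping.single m 1 * Poly_Mapping.single m 1
    \<and> (\<forall>j>d. sq j (Poly_Mapping.single m 1) = 0)"
  using assms
proof (induction d arbitrary: m)
  case 0
  have "Poly_Mapping.lookup m v = 0" for v
  proof (rule ccontr)
    assume "Poly_Mapping.lookup m v \<noteq> 0"
    then have "Poly_Mapping.lookup m v > 0" "v \<in> Poly_Mapping.keys m"
      using 0(1)[of v] by (auto simp: in_keys_iff)
    then have "expo_deg m > 0" unfolding expo_deg_def
      by (intro sum_pos2[of _ v]) (auto simp: 0)
    then show False using 0 by simp
  qed
  then have "m = 0" by (intro poly_mapping_eqI) simp
  then show ?case by (simp add: sq_one)
next
  case (Suc d)
  have "m \<noteq> 0" using Suc.prems(2) by (auto simp: expo_deg_def)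
  then obtain v where v: "v \<in> Poly_Mapping.keys m" by fastforce
  define m' where "m' = m - Poly_Mapping.single v 1"
  have m: "m = Poly_Mapping.single v 1 + m'" by (simp add: m'_def)
  have "Poly_Mapping.lookup m v > 0" using v Suc.prems(1)[of v] by (auto simp: in_keys_iff)
  then have "0 \<le> Poly_Mapping.lookup m' w" for w
    using Suc.prems(1)[of w] by (auto simp: m'_def lookup_minus lookup_single when_def)
  moreover have "expo_deg m' = int d" using Suc.prems(2) by (simp add: m expo_deg_add)
  ultimately have IH: "sq d (Poly_Mapping.single m' 1) = Poly_Mapping.single m' 1 * Poly_Mapping.single m' 1"
    "\<And>j. j > d \<Longrightarrow> sq j (Poly_Mapping.single m' 1) = 0"
    using Suc.IH by blast+
  have M: "Poly_Mapping.single m 1 = xv v 1 * Poly_Mapping.single m' 1"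
    by (simp add: m xv_def mult_single)
  have "sq (Suc j) (Poly_Mapping.single m 1) = 0" if "j > d" for j
    unfolding M sq_mult_xv1 using IH that by simp
  then have "sq j (Poly_Mapping.single m 1) = 0" if "j > Suc d" for j
    using that by (cases j) auto
  moreover have "sq (Suc d) (Poly_Mapping.single m 1) = Poly_Mapping.single m 1 * Poly_Mapping.single m 1"
  proof -
    have "sq (Suc d) (Poly_Mapping.single m 1) = xv v 2 * (Poly_Mapping.single m' 1 * Poly_Mapping.single m' 1)"
      unfolding M sq_mult_xv1 using IH by simp
    also have "xv v 2 = xv v 1 * xv v 1" by (simp add: xv_mult)
    finally show ?thesis by (simp add: M ac_simps)
  qed
  ultimately show ?case by blast
qed

text \<open>
  The monomial is \<open>x n\<^sup>2 = x Sq\<^bsup>5\<^esup> n\<close>, which equals \<open>Sq\<^bsup>5\<^esup>(x n) + Sq\<^bsup>4\<^esup>(x\<^sup>2 n) + Sq\<^bsup>2\<^esup>(x\<^sup>4 n)\<close>: only the conjugates of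
  \<open>Sq\<^bsup>0\<^esup>, Sq\<^bsup>1\<^esup>, Sq\<^bsup>3\<^esup>\<close> act non-trivially on \<open>x\<close>.
\<close>

lemma PH_vanishes:
  assumes f: "f \<in> PH k d" and m: "m \<in> P_monoms k" "expo_deg m = 11" "card (odd_vars m) \<le> 1"
  shows "f m = 0"
proof -
  have "odd (card (odd_vars m))" using m(2) even_expo_deg[of m] by simp
  then have "card (odd_vars m) = 1" using m(3) by (cases "card (odd_vars m)") auto
  then obtain v where v: "odd_vars m = {v}" by (auto simp: card_1_singleton_iff)
  define n where "n = Poly_Mapping.map (\<lambda>x. x div 2) m"
  have n: "Poly_Mapping.lookup n w = Poly_Mapping.lookup m w div 2" for w
    by (simp add: n_def Poly_Mapping.map.rep_eq when_def)
  have m_eq: "m = Poly_Mapping.single v 1 + (n + n)"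
  proof (rule poly_mapping_eqI)
    fix w
    show "Poly_Mapping.lookup m w = Poly_Mapping.lookup (Poly_Mapping.single v 1 + (n + n)) w"
    proof (cases "w = v")
      case True
      then have "odd (Poly_Mapping.lookup m w)" using v by (auto simp: odd_vars_def)
      then show ?thesis unfolding lookup_add n using True by (auto elim!: oddE)
    next
      case False
      then have "even (Poly_Mapping.lookup m w)" using v by (auto simp: odd_vars_def)
      then show ?thesis unfolding lookup_add n lookup_single using False by (auto elim!: evenE)
    qed
  qed
  have n_nonneg: "0 \<le> Poly_Mapping.lookup n w" for w
    using m(1) by (simp add: n P_monoms_def)
  have "Poly_Mapping.keys n \<subseteq> Poly_Mapping.keys m" by (auto simp: in_keys_iff n)
  then have n_P: "n \<in> P_monoms k"
    using m(1) n_nonneg by (auto simp: P_monoms_def)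
  have "v \<in> Poly_Mapping.keys m" using v odd_vars_subset_keys[of m] by auto
  then have "v < k" using m(1) by (auto simp: P_monoms_def)
  then have P: "Poly_Mapping.single v j + n \<in> P_monoms k" if "0 \<le> j" for j
    using that n_P by (intro P_monoms_add P_monoms_single)
  have "expo_deg n = int 5" using m(2) unfolding m_eq expo_deg_add by simp
  note inst = sq_monomial_instable[OF n_nonneg this]
  let ?N = "Poly_Mapping.single n 1 :: laurent"
  have xN: "xv v j * ?N = Poly_Mapping.single (Poly_Mapping.single v j + n) 1" for j
    by (simp add: xv_def mult_single)
  have hit: "lin f (sq i (xv v j * ?N)) = 0" if "0 < i" "0 \<le> j" for i j
  proof -
    have "lin f (act [i] (Poly_Mapping.single (Poly_Mapping.single v j + n) 1)) = 0"
      using f P[OF that(2)] that(1) unfolding PH_def by (auto simp: is_word_def simp del: act_Cons)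
    then show ?thesis by (simp add: xN)
  qed
  have "Poly_Mapping.single m 1 = xv v 1 * sq 5 ?N"
    using inst by (simp add: m_eq xv_def mult_single)
  also have "\<dots> = sq 5 (xv v 1 * ?N) + sq 4 (xv v 2 * ?N) + sq 2 (xv v 4 * ?N)"
    using sq_mult_xv1[of 4 v ?N] sq_mult_xv2[of 2 v ?N] sq2_mult_xv4[of v ?N]
    by (simp add: eval_nat_numeral add_ac)
  finally have "f m = lin f (sq 5 (xv v 1 * ?N) + sq 4 (xv v 2 * ?N) + sq 2 (xv v 4 * ?N))"
    by (metis lin_single)
  then show ?thesis by (simp add: hit)
qed

section \<open>Cochains and the Massey product\<close>

lemma cochain_eval_add [simp]: "cochain_eval c (x + y) = cochain_eval c x + cochain_eval c y"
  and cochain_eval_zero [simp]: "cochain_eval c 0 = 0"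
  and cochain_eval_single [simp]: "cochain_eval c (Poly_Mapping.single (ws, m) 1) = c ws"
  by (simp_all add: cochain_eval_def)

lemma cochain_eval_plus: "cochain_eval (c + c') z = cochain_eval c z + cochain_eval c' z"
  unfolding cochain_eval_def case_prod_unfold plus_fun_apply by (rule lin_fun_add)

lemma cochain_eval_vanish:
  "(\<And>ws m. (ws, m) \<in> Poly_Mapping.keys z \<Longrightarrow> c ws = 0) \<Longrightarrow> cochain_eval c z = 0"
  by (auto simp: cochain_eval_def lin_def intro!: sum.neutral)

lemma cochain_eval_lin: "cochain_eval c (lin g z) = lin (\<lambda>x. cochain_eval c (g x)) z"
  unfolding cochain_eval_def by (rule lin_compose)

lemma keys_adem:
  assumes "x \<in> Poly_Mapping.keys (adem a b)" "0 < a" "0 < b"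
  shows "is_word x \<and> x \<noteq> [] \<and> sum_list x = a + b"
proof -
  let ?g = "\<lambda>c. Poly_Mapping.single (if c = 0 then [a + b] else [a + b - c, c])
                      (of_nat ((b - c - 1) choose (a - 2 * c)) :: bit)"
  have "Poly_Mapping.keys (sum ?g A) \<subseteq> (\<Union>c\<in>A. Poly_Mapping.keys (?g c))" for A
    by (induction A rule: infinite_finite_induct) (auto simp: keys_add_bit split: if_splits)
  then have "Poly_Mapping.keys (adem a b) \<subseteq> {[a, b]} \<union> (\<Union>c\<in>{..a div 2}. Poly_Mapping.keys (?g c))"
    unfolding adem_def keys_add_bit by fastforce
  then show ?thesis using assms by (fastforce simp: is_word_def split: if_splits)
qed

lemma bar_word_list_append [simp]: "bar_word_list (us @ vs) \<longleftrightarrow> bar_word_list us \<and> bar_word_list vs"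
  by (auto simp: bar_word_list_def)

lemma bar_word_list_Cons [simp]: "bar_word_list (w # ws) \<longleftrightarrow> is_word w \<and> w \<noteq> [] \<and> bar_word_list ws"
  by (auto simp: bar_word_list_def)

lemma words_deg_append [simp]: "words_deg (us @ vs) = words_deg us + words_deg vs"
  by (simp add: words_deg_def)

lemma words_deg_Cons [simp]: "words_deg (w # ws) = int (sum_list w) + words_deg ws"
  by (simp add: words_deg_def)

text \<open>\<open>cochains\<close> demands vanishing only on relations inside one bidegree of the
  bar complex. Each generator of the ideal is homogeneous, so its terms lie either all in that
  bidegree or all outside the support of \<open>c\<close>.\<close>

lemma cochains_vanish_generator:
  assumes c: "c \<in> cochains s t" and p: "p \<in> adem_ideal"
  shows "lin (\<lambda>w. c (us @ [w] @ vs)) p = 0"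
  using p[unfolded adem_ideal_def]
proof (induction p rule: group_closure.induct)
  case (base r)
  then consider "r = 0" | u v a b where "r = lin (\<lambda>x. wd (u @ x @ v)) (adem a b)"
      "is_word u" "is_word v" "0 < a" "a < 2 * b" by blast
  then show ?case
  proof cases
    case 2
    have ab: "0 < a" "0 < b" using 2 by auto
    let ?z = "lin (\<lambda>w. Poly_Mapping.single (us @ [w] @ vs, 0) 1) r :: chain"
    have z: "lin (\<lambda>w. c (us @ [w] @ vs)) r = cochain_eval c ?z"
      by (simp add: cochain_eval_lin)
    have r: "is_word w \<and> w \<noteq> [] \<and> sum_list w = sum_list u + (a + b) + sum_list v" if "w \<in> Poly_Mapping.keys r" for w
      using that unfolding 2(1) by (rule keys_lin) (use keys_adem[OF _ ab] 2 in auto)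
    show ?thesis
    proof (cases "length us + length vs + 1 = s \<and> bar_word_list us \<and> bar_word_list vs \<and>
        words_deg us + int (sum_list u + (a + b) + sum_list v) + words_deg vs = t")
      case True
      have "length (us @ [w] @ vs) = s \<and> bar_word_list (us @ [w] @ vs) \<and> words_deg (us @ [w] @ vs) = t"
        if "w \<in> Poly_Mapping.keys r" for w
        using True r[OF that] by simp
      then have "?z \<in> bar s t (P_monoms 0)"
        by (auto simp: bar_def expo_deg_def P_monoms_def elim!: keys_lin)
      moreover have "?z \<in> bar_rel"
        using 2 by (intro bar_rel_generator) (simp add: adem_ideal_generator)
      ultimately show ?thesis using c unfolding z cochains_def by auto
    next
      case False
      have "c (us @ [w] @ vs) = 0" if "w \<in> Poly_Mapping.keys r" for w
      proof (rule ccontr)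
        assume "c (us @ [w] @ vs) \<noteq> 0"
        then have "length (us @ [w] @ vs) = s \<and> bar_word_list (us @ [w] @ vs) \<and> words_deg (us @ [w] @ vs) = t"
          using c unfolding cochains_def by blast
        then show False using False r[OF that] by simp
      qed
      then show ?thesis by (simp add: lin_def)
    qed
  qed simp
next
  case (diff x y)
  then show ?case by (simp add: diff_eq_add)
qed

lemma cochains_vanish:
  assumes "c \<in> cochains s t" "z \<in> bar_rel" shows "cochain_eval c z = 0"
  using assms(2)
proof (induction rule: bar_rel_induct)
  case (generator us vs m p)
  then show ?case using cochains_vanish_generator[OF assms(1)] by (simp add: cochain_eval_lin)
qed simp_all

lemma lin_mult_right: "lin (\<lambda>x. f x * (c :: bit)) z = lin f z * c"
  unfolding lin_def by (rule sum_distrib_right[symmetric])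

lemma lin_mult_left: "lin (\<lambda>x. (c :: bit) * f x) z = c * lin f z"
  unfolding lin_def by (rule sum_distrib_left[symmetric])

lemma cochains_support:
  "c \<in> cochains s t \<Longrightarrow> c ws \<noteq> 0 \<Longrightarrow> length ws = s \<and> bar_word_list ws \<and> words_deg ws = t"
  by (auto simp: cochains_def)

text \<open>The entry carrying a relation lies on one side of the cut at \<open>p\<close>, and the
  factor on that side vanishes.\<close>

lemma cup_cochains:
  assumes a: "a \<in> cochains p t" and b: "b \<in> cochains q u"
  shows "cup p a b \<in> cochains (p + q) (t + u)"
proof -
  have supp: "length ws = p + q \<and> bar_word_list ws \<and> words_deg ws = t + u" if "cup p a b ws \<noteq> 0" for ws
  proof -
    have "a (take p ws) \<noteq> 0" "b (drop p ws) \<noteq> 0" using that by (auto simp: cup_def)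
    then have *: "length (take p ws) = p" "bar_word_list (take p ws)" "words_deg (take p ws) = t"
      "length (drop p ws) = q" "bar_word_list (drop p ws)" "words_deg (drop p ws) = u"
      using cochains_support[OF a] cochains_support[OF b] by blast+
    have "bar_word_list (take p ws @ drop p ws)" "words_deg (take p ws @ drop p ws) = t + u"
      "length (take p ws @ drop p ws) = p + q"
      using * by (simp_all only: bar_word_list_append words_deg_append length_append)
    then show ?thesis by simp
  qed
  have "cochain_eval (cup p a b) z = 0" if "z \<in> bar_rel" for z
    using that
  proof (induction rule: bar_rel_induct)
    case (generator us vs m r)
    have "lin (\<lambda>w. cup p a b (us @ [w] @ vs)) r = 0"
    proof (cases "length us < p")
      case True
      then obtain k where "p = Suc (length us + k)" using less_imp_Suc_add by blast
      then have "cup p a b (us @ [w] @ vs) = a (us @ [w] @ take k vs) * b (drop k vs)" for w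
        by (simp add: cup_def)
      then show ?thesis
        by (simp only: lin_mult_right cochains_vanish_generator[OF a generator(1)] mult_zero_left)
    next
      case False
      then have "cup p a b (us @ [w] @ vs) = a (take p us) * b (drop p us @ [w] @ vs)" for w
        by (simp add: cup_def)
      then show ?thesis
        by (simp only: lin_mult_left cochains_vanish_generator[OF b generator(1)] mult_zero_right)
    qed
    then show ?case by (simp add: cochain_eval_lin)
  qed simp_all
  with supp show ?thesis by (auto simp: cochains_def)
qed

lemma cochains_add: "a \<in> cochains p t \<Longrightarrow> b \<in> cochains p t \<Longrightarrow> a + b \<in> cochains p t"
  unfolding cochains_def by (auto simp: cochain_eval_plus)

section \<open>Coboundaries and the Leibniz rule\<close>

definition merge_words :: "nat \<Rightarrow> word list \<Rightarrow> word list" where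
  "merge_words i ws = take i ws @ [ws ! i @ ws ! Suc i] @ drop (i + 2) ws"

lemma cochain_eval_bar_d:
  assumes "bar_word_list ws"
  shows "cochain_eval c (bar_d (Poly_Mapping.single (ws, 0) 1)) = (\<Sum>i<length ws - 1. c (merge_words i ws))"
proof -
  have "(if ws = [] then 0 else lin (\<lambda>m'. Poly_Mapping.single (butlast ws, m') 1) (act (last ws) (Poly_Mapping.single 0 1))) = (0 :: chain)"
    using assms by (auto simp: bar_word_list_def act_one)
  moreover have "cochain_eval c (sum g A) = (\<Sum>a\<in>A. cochain_eval c (g a))" for g :: "nat \<Rightarrow> chain" and A
    by (induction A rule: infinite_finite_induct) simp_all
  ultimately show ?thesis by (simp add: bar_d_def merge_words_def)
qed

lemma coboundary_eq:
  "coboundary c ws = (if bar_word_list ws then \<Sum>i<length ws - 1. c (merge_words i ws) else 0)"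
  by (simp add: coboundary_def cochain_eval_bar_d)

lemma length_merge: "i < length ws - 1 \<Longrightarrow> length (merge_words i ws) = length ws - 1"
  by (simp add: merge_words_def)

lemma coboundary_add: "coboundary (a + b) = coboundary a + coboundary b"
proof (rule ext)
  show "coboundary (a + b) ws = (coboundary a + coboundary b) ws" for ws
    by (cases "bar_word_list ws")
       (simp_all only: coboundary_eq plus_fun_apply if_True if_False sum.distrib add_0_left)
qed

lemma coboundary_zero: "coboundary 0 = 0"
  by (rule ext) (simp add: coboundary_eq)

lemma coboundary_nonzero:
  assumes "coboundary c ws \<noteq> 0"
  shows "\<exists>i<length ws - 1. c (merge_words i ws) \<noteq> 0"
proof (rule ccontr)
  assume "\<not> ?thesis"
  then have "coboundary c ws = 0" by (simp add: coboundary_eq)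
  with assms show False by simp
qed

lemma merge_append_left: "merge_words (length us) (us @ v # w # ws) = us @ (v @ w) # ws"
  by (simp add: merge_words_def nth_append)

lemma merge_append_right: "merge_words (length us + i) (us @ ws) = us @ merge_words i ws"
  by (simp add: merge_words_def nth_append)

lemma sum_lessThan_add:
  fixes F :: "nat \<Rightarrow> 'a::comm_monoid_add" and p q :: nat
  shows "(\<Sum>i<p + q. F i) = (\<Sum>i<p. F i) + (\<Sum>i<q. F (p + i))"
  by (induction q) (simp_all add: ac_simps)

lemma cup_merge_left:
  assumes "i < p" "length ws = Suc (p + q)"
  shows "cup p a b (merge_words i ws) = a (merge_words i (take (Suc p) ws)) * b (drop (Suc p) ws)"
proof -
  obtain k where k: "p = Suc (i + k)" using assms(1) less_imp_Suc_add by blast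
  define us where "us = take i ws"
  obtain v w vs where vs: "drop i ws = v # w # vs"
    using assms k by (cases "drop i ws"; cases "tl (drop i ws)") (auto dest!: arg_cong[of _ _ length])
  have ws: "ws = us @ v # w # vs" and i: "length us = i"
    using append_take_drop_id[of i ws] assms by (simp_all add: us_def vs)
  show ?thesis
    unfolding ws i[symmetric] merge_append_left by (simp add: cup_def k i[symmetric] merge_append_left)
qed

lemma cup_merge_right:
  assumes "p \<le> length ws"
  shows "cup p a b (merge_words (p + i) ws) = a (take p ws) * b (merge_words i (drop p ws))"
proof -
  have "merge_words (length (take p ws) + i) (take p ws @ drop p ws) = take p ws @ merge_words i (drop p ws)"
    by (rule merge_append_right)
  then have "merge_words (p + i) ws = take p ws @ merge_words i (drop p ws)" using assms by (simp add: min_absorb2)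
  then show ?thesis using assms by (simp add: cup_def min_absorb2)
qed

text \<open>On lists of length \<open>p + q + 1\<close> the first \<open>p\<close> merges take place
  among the first \<open>p + 1\<close> entries and the other \<open>q\<close> among the last
  \<open>q + 1\<close>. Elsewhere the supports of \<open>a\<close> and \<open>b\<close> make all
  terms zero.\<close>

lemma coboundary_cup:
  assumes a: "a \<in> cochains p t" and b: "b \<in> cochains q u"
  shows "coboundary (cup p a b) = cup (Suc p) (coboundary a) b + cup p a (coboundary b)"
proof (rule ext)
  fix ws
  have bw: "bar_word_list ws \<Longrightarrow> bar_word_list (take k ws) \<and> bar_word_list (drop k ws)" for k
    by (auto simp: bar_word_list_def dest: in_set_takeD in_set_dropD)
  show "coboundary (cup p a b) ws = (cup (Suc p) (coboundary a) b + cup p a (coboundary b)) ws"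
  proof (cases "length ws = Suc (p + q)")
    case len: True
    show ?thesis
    proof (cases "bar_word_list ws")
      case True
      have "coboundary (cup p a b) ws = (\<Sum>i<p + q. cup p a b (merge_words i ws))"
        using True len by (simp only: coboundary_eq) simp
      also have "\<dots> = (\<Sum>i<p. a (merge_words i (take (Suc p) ws)) * b (drop (Suc p) ws)) +
          (\<Sum>i<q. a (take p ws) * b (merge_words i (drop p ws)))"
        unfolding sum_lessThan_add
      proof (rule arg_cong2[of _ _ _ _ "(+)"])
        show "(\<Sum>i<p. cup p a b (merge_words i ws)) = (\<Sum>i<p. a (merge_words i (take (Suc p) ws)) * b (drop (Suc p) ws))"
          using cup_merge_left[OF _ len] by (intro sum.cong) auto
        show "(\<Sum>i<q. cup p a b (merge_words (p + i) ws)) = (\<Sum>i<q. a (take p ws) * b (merge_words i (drop p ws)))"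
          using len by (intro sum.cong refl cup_merge_right) simp
      qed
      also have "\<dots> = coboundary a (take (Suc p) ws) * b (drop (Suc p) ws) + a (take p ws) * coboundary b (drop p ws)"
      proof -
        have "length (take (Suc p) ws) - 1 = p" "length (drop p ws) - 1 = q" using len by simp_all
        then show ?thesis by (simp only: coboundary_eq bw[OF True] if_True sum_distrib_left sum_distrib_right)
      qed
      finally show ?thesis by (simp only: cup_def plus_fun_apply)
    next
      case False
      have "cup (Suc p) (coboundary a) b ws = 0"
      proof (cases "bar_word_list (take (Suc p) ws)")
        case True
        then have "\<not> bar_word_list (drop (Suc p) ws)"
          using False append_take_drop_id[of "Suc p" ws] unfolding bar_word_list_def by (metis Un_iff set_append)
        then have "b (drop (Suc p) ws) = 0" using cochains_support[OF b] by blast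
        then show ?thesis by (simp add: cup_def)
      qed (simp add: cup_def coboundary_def)
      moreover have "cup p a (coboundary b) ws = 0"
      proof (cases "bar_word_list (drop p ws)")
        case True
        then have "\<not> bar_word_list (take p ws)"
          using False append_take_drop_id[of p ws] unfolding bar_word_list_def by (metis Un_iff set_append)
        then have "a (take p ws) = 0" using cochains_support[OF a] by blast
        then show ?thesis by (simp add: cup_def)
      qed (simp add: cup_def coboundary_def)
      ultimately show ?thesis using False by (simp add: coboundary_def)
    qed
  next
    case False
    have "coboundary (cup p a b) ws = 0"
    proof -
      have "cup p a b (merge_words i ws) = 0" if "i < length ws - 1" for i
        using cochains_support[OF cup_cochains[OF a b], of "merge_words i ws"] length_merge[OF that] False that by force
      then show ?thesis by (simp add: coboundary_eq)
    qed
    moreover have "cup (Suc p) (coboundary a) b ws = 0"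
    proof (rule ccontr)
      assume "cup (Suc p) (coboundary a) b ws \<noteq> 0"
      then have *: "coboundary a (take (Suc p) ws) \<noteq> 0" "b (drop (Suc p) ws) \<noteq> 0" by (auto simp: cup_def)
      then obtain i where i: "i < length (take (Suc p) ws) - 1" "a (merge_words i (take (Suc p) ws)) \<noteq> 0"
        using coboundary_nonzero by blast
      then have "length (take (Suc p) ws) = Suc p"
        using cochains_support[OF a i(2)] length_merge[OF i(1)] by linarith
      moreover have "length (drop (Suc p) ws) = q" using cochains_support[OF b *(2)] by simp
      ultimately show False using False by simp
    qed
    moreover have "cup p a (coboundary b) ws = 0"
    proof (rule ccontr)
      assume "cup p a (coboundary b) ws \<noteq> 0"
      then have *: "coboundary b (drop p ws) \<noteq> 0" "a (take p ws) \<noteq> 0" by (auto simp: cup_def)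
      then obtain i where i: "i < length (drop p ws) - 1" "b (merge_words i (drop p ws)) \<noteq> 0"
        using coboundary_nonzero by blast
      then have "length (drop p ws) = Suc q"
        using cochains_support[OF b i(2)] length_merge[OF i(1)] by linarith
      moreover have "length (take p ws) = p" using cochains_support[OF a *(2)] by simp
      ultimately show False using False by simp
    qed
    ultimately show ?thesis by simp
  qed
qed

lemma ext_class_iff:
  "c \<in> ext_class s t c' \<longleftrightarrow> c' \<in> ext_cocycles s t \<and> c \<in> ext_cocycles s t \<and> c' - c \<in> ext_coboundaries s t"
  by (auto simp: ext_class_def ext_rel_def cong_mod_def)

lemma cochains_0: "t \<noteq> 0 \<Longrightarrow> c \<in> cochains 0 t \<Longrightarrow> c = 0"
proof (rule ext, rule ccontr)
  fix ws assume "t \<noteq> 0" "c \<in> cochains 0 t" "c ws \<noteq> 0 ws"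
  then have "length ws = 0" "words_deg ws = t" using cochains_support[of c 0 t ws] by auto
  with \<open>t \<noteq> 0\<close> show False by (simp add: words_deg_def)
qed

text \<open>Cochains of filtration 0 live in degree 0 only, so in nonzero degree a class of
  filtration 1 has a single representative.\<close>

lemma ext_class_1:
  assumes "c \<in> ext_class 1 t c'" "t \<noteq> 0" shows "c = c'"
proof -
  obtain g where "g \<in> cochains 0 t" "c' - c = coboundary g"
    using assms(1) by (auto simp: ext_class_iff)
  then have "c' - c = 0" using cochains_0[OF assms(2), of g] coboundary_zero by simp
  then show ?thesis by simp
qed

text \<open>The cocycle property comes from membership itself: \<open>ext_class\<close> is empty
  unless its argument is a cocycle.\<close>

lemma h_memD:
  assumes "a \<in> h i"
  shows "a \<in> ext_cocycles 1 (2 ^ i)" "a = (\<lambda>ws. if ws = [[2 ^ i]] then 1 else 0)"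
  using assms ext_class_1[of a "2 ^ i"] by (auto simp: h_def ext_class_iff)

lemma cochains_sq1_sq1:
  assumes "g \<in> cochains s t" shows "g (us @ [[1, 1]] @ vs) = 0"
proof -
  have "adem 1 1 \<in> adem_ideal" by (rule adem_in_ideal) auto
  from cochains_vanish_generator[OF assms this, of us vs] show ?thesis by (simp add: adem_simps(1) del: One_nat_def)
qed

lemma merge_replicate:
  "merge_words i (replicate (Suc (Suc (i + k))) x) = replicate i x @ [x @ x] @ replicate k x"
proof -
  have "replicate (Suc (Suc (i + k))) x = replicate i x @ x # x # replicate k x"
    using replicate_add[of i "Suc (Suc k)" x] by simp
  then show ?thesis using merge_append_left[of "replicate i x" x x "replicate k x"] by (simp del: replicate_Suc)
qed

text \<open>The value on \<open>[Sq1|...|Sq1]\<close> does not depend on the representative: each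
  merge in that chain creates the Adem relation \<open>Sq1 * Sq1\<close>, on which cochains
  vanish.\<close>

lemma ext_power_h0:
  assumes "b \<in> ext_power (1, 1) (h 0) n"
  shows "b \<in> ext_cocycles n (int n) \<and> b (replicate n [1]) = 1"
  using assms
proof (induction n arbitrary: b)
  case 0
  then have "b \<in> ext_cocycles 0 0" "b = (\<lambda>ws. if ws = [] then 1 else 0)"
    unfolding ext_power.simps ext_class_iff ext_coboundaries.simps singleton_iff right_minus_eq
    by (blast, metis)
  then show ?case by simp
next
  case (Suc n)
  then have "\<exists>a\<in>h 0. \<exists>b'\<in>ext_power (1, 1) (h 0) n. b \<in> ext_class (1 + n * 1) (1 + int n * 1) (cup 1 a b')"
    by (simp only: ext_power.simps ext_mult.simps UN_iff)
  then obtain a b' where a: "a \<in> h 0" and b': "b' \<in> ext_power (1, 1) (h 0) n"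
    and b: "b \<in> ext_class (Suc n) (1 + int n) (cup 1 a b')"
    unfolding mult_1_right plus_1_eq_Suc by blast
  from b obtain g where g: "g \<in> cochains n (1 + int n)" "cup 1 a b' - b = coboundary g"
    by (auto simp: ext_class_iff)
  have "bar_word_list (replicate (Suc n) [1])" by (auto simp: bar_word_list_def is_word_def)
  then have "coboundary g (replicate (Suc n) [1]) = (\<Sum>i<n. g (merge_words i (replicate (Suc n) [1])))"
    by (simp add: coboundary_eq del: replicate_Suc)
  also have "\<dots> = 0"
  proof (rule sum.neutral, rule ballI)
    fix i assume "i \<in> {..<n}"
    then obtain k where "n = Suc (i + k)" using less_imp_Suc_add by blast
    then show "g (merge_words i (replicate (Suc n) [1])) = 0"
      using cochains_sq1_sq1[OF g(1), of "replicate i [1]" "replicate k [1]"]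
      by (simp only: merge_replicate append_Cons append_Nil)
  qed
  finally have "cup 1 a b' (replicate (Suc n) [1]) - b (replicate (Suc n) [1]) = 0"
    using fun_cong[OF g(2), of "replicate (Suc n) [1]"] by (simp only: fun_diff_def)
  moreover have "cup 1 a b' (replicate (Suc n) [1]) = 1"
    using Suc.IH[OF b'] h_memD(2)[OF a] by (simp add: cup_def)
  ultimately have "b (replicate (Suc n) [1]) = 1" by (simp only: right_minus_eq)
  moreover have "b \<in> ext_cocycles (Suc n) (int (Suc n))"
    using b by (simp add: ext_class_iff)
  ultimately show ?case by blast
qed

section \<open>Degrees, weights and last entries of the explicit chains\<close>

lemma keys_pre:
  assumes "x \<in> Poly_Mapping.keys (p \<rhd> z)"
  obtains w ws m where "x = (w # ws, m)" "w \<in> Poly_Mapping.keys p" "(ws, m) \<in> Poly_Mapping.keys z"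
  using assms unfolding prepend_def by (elim keys_lin) (auto split: prod.splits)

lemma pre_bar:
  assumes "p \<in> alg_hom d" "z \<in> bar n t E" shows "p \<rhd> z \<in> bar (Suc n) (t + int d) E"
  using assms unfolding bar_def alg_hom_def by (auto elim!: keys_pre)

lemma bar_add: "x \<in> bar n t E \<Longrightarrow> y \<in> bar n t E \<Longrightarrow> x + y \<in> bar n t E"
  by (auto simp: bar_def keys_add_bit)

text \<open>The parity bound of \<open>tame\<close> without its degree conditions, so that it can be
  tracked entry by entry.\<close>

definition weight_le :: "nat \<Rightarrow> chain set" where
  "weight_le k = {z. \<forall>(ws, m)\<in>Poly_Mapping.keys z. card (odd_vars m) + even_words ws \<le> k}"

lemma weight_le_add: "x \<in> weight_le k \<Longrightarrow> y \<in> weight_le k \<Longrightarrow> x + y \<in> weight_le k"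
  by (auto simp: weight_le_def keys_add_bit)

lemma pre_weight_le:
  assumes "p \<in> alg_hom d" "z \<in> weight_le k"
  shows "p \<rhd> z \<in> weight_le (if even d then Suc k else k)"
proof -
  have "card (odd_vars m) + even_words ws \<le> (if even d then Suc k else k)"
    if "(ws, m) \<in> Poly_Mapping.keys (p \<rhd> z)" for ws m
    using that
  proof (rule keys_pre)
    fix w ws' m' assume *: "(ws, m) = (w # ws', m')" "w \<in> Poly_Mapping.keys p" "(ws', m') \<in> Poly_Mapping.keys z"
    then have "card (odd_vars m') + even_words ws' \<le> k" "sum_list w = d"
      using assms by (auto simp: weight_le_def alg_hom_def)
    then show ?thesis using * by (simp add: even_words_def)
  qed
  then show ?thesis unfolding weight_le_def by blast
qed

text \<open>Chains that pair to zero with every cup product whose last factor is supported on the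
  single word \<open>v\<close>; used with \<open>h_3\<close> and the word
  \<open>[8]\<close>.\<close>

definition last_not :: "word \<Rightarrow> chain set" where
  "last_not v = {z. \<forall>(ws, m)\<in>Poly_Mapping.keys z. ws \<noteq> [] \<and> last ws \<noteq> v}"

lemma last_not_add: "x \<in> last_not v \<Longrightarrow> y \<in> last_not v \<Longrightarrow> x + y \<in> last_not v"
  by (auto simp: last_not_def keys_add_bit)

lemma last_not_zero: "0 \<in> last_not v"
  by (auto simp: last_not_def)

lemma pre_last_not: "z \<in> last_not v \<Longrightarrow> p \<rhd> z \<in> last_not v"
  unfolding last_not_def by (auto elim!: keys_pre)

lemma pre_unit_last_not: "p \<in> alg_hom d \<Longrightarrow> d \<noteq> sum_list v \<Longrightarrow> p \<rhd> unit_chain \<in> last_not v"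
  unfolding last_not_def unit_chain_def alg_hom_def by (auto elim!: keys_pre)

lemma unit_bar: "unit_chain \<in> bar 0 0 (P_monoms 0)"
  by (simp add: unit_chain_def bar_def P_monoms_def bar_word_list_def words_deg_def expo_deg_def)

lemma unit_weight: "unit_chain \<in> weight_le 0"
  by (simp add: unit_chain_def weight_le_def odd_vars_def even_words_def)

lemma divpow_bar: "q \<in> alg_hom d \<Longrightarrow> divpow q n \<in> bar n (int (n * d)) (P_monoms 0)"
proof (induction n)
  case (Suc n)
  then show ?case using pre_bar[of q d "divpow q n" n "int (n * d)"] by (simp add: algebra_simps)
qed (simp add: unit_bar)

lemma divpow_weight: "q \<in> alg_hom d \<Longrightarrow> odd d \<Longrightarrow> divpow q n \<in> weight_le 0"
proof (induction n)
  case (Suc n)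
  then show ?case using pre_weight_le[of q d "divpow q n" 0] by simp
qed (simp add: unit_weight)

lemma divpow_last_not: "q \<in> alg_hom d \<Longrightarrow> d \<noteq> sum_list v \<Longrightarrow> divpow q (Suc n) \<in> last_not v"
  by (induction n) (auto simp: pre_unit_last_not pre_last_not)

lemma shuffle_bar:
  assumes "p \<in> alg_hom d" "q \<in> alg_hom e" shows "shuffle p q n \<in> bar (Suc n) (int (n * e + d)) (P_monoms 0)"
proof (induction n)
  case 0
  then show ?case using pre_bar[OF assms(1) unit_bar] by simp
next
  case (Suc n)
  have "p \<rhd> divpow q (Suc n) \<in> bar (Suc (Suc n)) (int (Suc n * e + d)) (P_monoms 0)"
    using pre_bar[OF assms(1) divpow_bar[OF assms(2), of "Suc n"]] by simp
  moreover have "q \<rhd> shuffle p q n \<in> bar (Suc (Suc n)) (int (Suc n * e + d)) (P_monoms 0)"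
    using pre_bar[OF assms(2) Suc] by (simp add: algebra_simps)
  ultimately show ?case by (simp add: bar_add)
qed

lemma shuffle_weight:
  assumes "p \<in> alg_hom d" "q \<in> alg_hom e" "odd e" 
  shows "shuffle p q n \<in> weight_le (if even d then 1 else 0)"
proof (induction n)
  case 0
  then show ?case using pre_weight_le[OF assms(1) unit_weight] by (cases "even d") simp_all
next
  case (Suc n)
  have "p \<rhd> divpow q (Suc n) \<in> weight_le (if even d then 1 else 0)"
    using pre_weight_le[OF assms(1) divpow_weight[OF assms(2,3), of "Suc n"]]
    by (cases "even d") (simp_all del: divpow.simps)
  moreover have "q \<rhd> shuffle p q n \<in> weight_le (if even d then 1 else 0)"
    using pre_weight_le[OF assms(2) Suc] assms(3) by simp
  ultimately show ?case by (simp add: weight_le_add)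
qed

lemma shuffle_last_not:
  assumes "p \<in> alg_hom d" "d \<noteq> sum_list v" "q \<in> alg_hom e" "e \<noteq> sum_list v" shows "shuffle p q n \<in> last_not v"
proof (induction n)
  case (Suc n)
  then show ?case using divpow_last_not[OF assms(3,4), of n]
    by (simp only: shuffle.simps last_not_add pre_last_not)
qed (use assms in \<open>simp add: pre_unit_last_not\<close>)

lemma shuffle2_bar:
  assumes "p \<in> alg_hom d" "p' \<in> alg_hom d'" "q \<in> alg_hom e"
  shows "shuffle2 p p' q n \<in> bar (Suc (Suc n)) (int (n * e + d + d')) (P_monoms 0)"
proof (induction n)
  case 0
  then show ?case
    using pre_bar[OF assms(1) shuffle_bar[OF assms(2,3), of 0]] pre_bar[OF assms(2) shuffle_bar[OF assms(1,3), of 0]]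
    by (simp add: bar_add add.commute)
next
  case (Suc n)
  have "p \<rhd> shuffle p' q (Suc n) \<in> bar (Suc (Suc (Suc n))) (int (Suc n * e + d + d')) (P_monoms 0)"
    using pre_bar[OF assms(1) shuffle_bar[OF assms(2,3), of "Suc n"]] by (simp add: algebra_simps del: shuffle.simps)
  moreover have "p' \<rhd> shuffle p q (Suc n) \<in> bar (Suc (Suc (Suc n))) (int (Suc n * e + d + d')) (P_monoms 0)"
    using pre_bar[OF assms(2) shuffle_bar[OF assms(1,3), of "Suc n"]] by (simp add: algebra_simps del: shuffle.simps)
  moreover have "q \<rhd> shuffle2 p p' q n \<in> bar (Suc (Suc (Suc n))) (int (Suc n * e + d + d')) (P_monoms 0)"
    using pre_bar[OF assms(3) Suc] by (simp add: algebra_simps)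
  ultimately show ?case by (simp only: shuffle2.simps bar_add)
qed

lemma shuffle2_weight:
  assumes "p \<in> alg_hom d" "even d" "p' \<in> alg_hom d'" "odd d'" "q \<in> alg_hom e" "odd e"
  shows "shuffle2 p p' q n \<in> weight_le 1"
proof -
  have *: "p \<rhd> shuffle p' q n \<in> weight_le 1" "p' \<rhd> shuffle p q n \<in> weight_le 1" for n
    using pre_weight_le[OF assms(1) shuffle_weight[OF assms(3,5,6)]] pre_weight_le[OF assms(3) shuffle_weight[OF assms(1,5,6)]] assms
    by simp_all
  show ?thesis
  proof (induction n)
    case 0
    then show ?case by (simp only: shuffle2.simps weight_le_add *)
  next
    case (Suc n)
    then show ?case using pre_weight_le[OF assms(5) Suc] assms(6) by (simp only: shuffle2.simps weight_le_add * if_False)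
  qed
qed

lemma shuffle2_last_not:
  assumes "p \<in> alg_hom d" "d \<noteq> sum_list v" "p' \<in> alg_hom d'" "d' \<noteq> sum_list v" "q \<in> alg_hom e" "e \<noteq> sum_list v"
  shows "shuffle2 p p' q n \<in> last_not v"
  by (induction n) (simp_all only: shuffle2.simps last_not_add pre_last_not shuffle_last_not[OF assms(1,2,5,6)] shuffle_last_not[OF assms(3,4,5,6)])

text \<open>Each term has exactly one entry of even degree, \<open>Sq4\<close> or \<open>R2\<close>;
  the degrees add up as 4 + 4 * 3 and 6 + 1 + 3 * 3.\<close>

lemma Ph2_cycle_tame: "Ph2_cycle \<in> tame 5 16 0"
proof -
  have "Ph2_cycle \<in> bar 5 16 (P_monoms 0)"
    using shuffle_bar[OF hom_Sq4 hom_Q1, of 4] shuffle2_bar[OF hom_R2 hom_Sq1 hom_Q1, of 3]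
    unfolding Ph2_cycle_def by (intro bar_add) (simp_all del: shuffle.simps shuffle2.simps)
  moreover have "Ph2_cycle \<in> weight_le 1"
    using shuffle_weight[OF hom_Sq4 hom_Q1, of 4] shuffle2_weight[OF hom_R2 _ hom_Sq1 _ hom_Q1, of 3]
    unfolding Ph2_cycle_def by (intro weight_le_add) (simp_all del: shuffle.simps shuffle2.simps)
  ultimately show ?thesis by (simp add: tame_def weight_le_def)
qed

lemma Ph2_cycle_last_not: "Ph2_cycle \<in> last_not [8]"
  unfolding Ph2_cycle_def
  by (intro last_not_add shuffle_last_not[OF hom_Sq4 _ hom_Q1] shuffle2_last_not[OF hom_R2 _ hom_Sq1 _ hom_Q1]) auto

lemma hom_even: "0 < m \<Longrightarrow> wd [2 * m] \<in> alg_hom (2 * m)"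
  using alg_hom_wd[of "[2 * m]"] by (simp add: is_word_def)

lemma zero_bar: "0 \<in> bar n t E"
  by (simp add: bar_def)

lemma sq_shuffle_bar: "sq_shuffle m n \<in> bar (Suc n) (int (n + 2 * m)) (P_monoms 0)"
proof (induction n arbitrary: m)
  case 0
  then show ?case
    using pre_bar[OF hom_even unit_bar, of m] by (simp add: zero_bar)
next
  case (Suc n)
  show ?case
  proof (cases "m = 0")
    case False
    have "wd [2 * m] \<rhd> divpow Sq1 (Suc n) \<in> bar (Suc (Suc n)) (int (Suc n + 2 * m)) (P_monoms 0)"
      using pre_bar[OF hom_even divpow_bar[OF hom_Sq1, of "Suc n"], of m] False by (simp add: ac_simps)
    moreover have "Sq1 \<rhd> sq_shuffle m n \<in> bar (Suc (Suc n)) (int (Suc n + 2 * m)) (P_monoms 0)"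
      using pre_bar[OF hom_Sq1 Suc, of m] by (simp add: ac_simps)
    moreover have "Q1 \<rhd> sq_shuffle (m - 1) n \<in> bar (Suc (Suc n)) (int (Suc n + 2 * m)) (P_monoms 0)"
      using pre_bar[OF hom_Q1 Suc, of "m - 1"] False by (simp add: algebra_simps of_nat_diff)
    ultimately show ?thesis using False by (simp only: sq_shuffle.simps if_False bar_add)
  qed (simp add: zero_bar)
qed

lemma sq_shuffle_last_not: "m < 4 \<Longrightarrow> sq_shuffle m n \<in> last_not [8]"
proof (induction n arbitrary: m)
  case 0
  then show ?case by (auto simp: last_not_zero intro!: pre_unit_last_not hom_even)
next
  case (Suc n)
  then show ?case
    using divpow_last_not[OF hom_Sq1, of "[8]" n]
    by (auto simp: last_not_zero simp del: divpow.simps intro!: last_not_add pre_last_not)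
qed

text \<open>\<open>Sq^8\<close> reaches the last place only by passing every \<open>Sq1\<close>
  undiminished; the added term is that single occurrence and cancels it.\<close>

lemma sq_shuffle_4: "sq_shuffle 4 n + Poly_Mapping.single (replicate n [1] @ [[8]], 0) 1 \<in> last_not [8]"
proof (induction n)
  case 0
  then show ?case by (simp add: unit_chain_def last_not_zero)
next
  case (Suc n)
  have "sq_shuffle 4 (Suc n) + Poly_Mapping.single (replicate (Suc n) [1] @ [[8]], 0) 1 =
     wd [8] \<rhd> divpow Sq1 (Suc n) + Sq1 \<rhd> (sq_shuffle 4 n + Poly_Mapping.single (replicate n [1] @ [[8]], 0) 1) + Q1 \<rhd> sq_shuffle 3 n"
    by (simp add: add_ac)
  also have "\<dots> \<in> last_not [8]"
  proof -
    have "divpow Sq1 (Suc n) \<in> last_not [8]" by (rule divpow_last_not[OF hom_Sq1]) simp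
    moreover have "sq_shuffle 3 n \<in> last_not [8]" by (rule sq_shuffle_last_not) simp
    ultimately show ?thesis using Suc by (simp only: last_not_add pre_last_not)
  qed
  finally show ?case .
qed

section \<open>Evaluation of the Massey product on the cycle\<close>

lemma cochain_eval_cup_pre:
  "cochain_eval (cup 1 a f) (p \<rhd> z) = lin (\<lambda>w. a [w]) p * cochain_eval f z"
proof (induction p rule: bit_poly_induct)
  case (single w)
  show ?case
  proof (induction z rule: bit_poly_induct)
    case (single x)
    then show ?case by (cases x) (simp add: cup_def)
  qed (simp_all add: distrib_left)
qed (simp_all add: distrib_right)

lemma cochain_eval_bar_d_coboundary:
  assumes "W \<in> bar n t (P_monoms 0)"
  shows "cochain_eval f (bar_d W) = cochain_eval (coboundary f) W"
proof -
  have "cochain_eval f (bar_d W) = lin (\<lambda>x. cochain_eval f (bar_d_basis x)) W"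
    by (simp add: bar_d_def cochain_eval_lin)
  also have "\<dots> = lin (\<lambda>(ws, m). coboundary f ws) W"
  proof (rule lin_cong)
    fix x assume "x \<in> Poly_Mapping.keys W"
    then obtain ws where "x = (ws, 0)" "bar_word_list ws"
      using assms by (auto simp: bar_def P_monoms_def)
    then show "cochain_eval f (bar_d_basis x) = (case x of (ws, m) \<Rightarrow> coboundary f ws)"
      by (simp add: coboundary_def bar_d_def)
  qed
  finally show ?thesis by (simp add: cochain_eval_def)
qed

lemma cochain_eval_cup_last:
  assumes "z \<in> last_not v" "z \<in> bar (Suc n) t E" "\<And>w. w \<noteq> v \<Longrightarrow> c [w] = 0"
  shows "cochain_eval (cup n b c) z = 0"
proof (rule cochain_eval_vanish)
  fix ws m assume "(ws, m) \<in> Poly_Mapping.keys z"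
  then have ws: "ws \<noteq> []" "last ws \<noteq> v" "length ws = Suc n" using assms(1,2) by (auto simp: last_not_def bar_def)
  then have "ws = butlast ws @ [last ws]" "length (butlast ws) = n" by simp_all
  then have "drop n ws = [last ws]" by (metis append_eq_conv_conj)
  then show "cup n b c ws = 0" using assms(3) ws by (simp add: cup_def)
qed

lemma massey_eval:
  assumes a: "a \<in> h 2" and b: "b \<in> ext_power (1, 1) (h 0) 4" and c: "c \<in> h 3"
    and f: "f \<in> cochains 4 12" "coboundary f = cup 4 b c"
  shows "cochain_eval (cup 4 e c + cup 1 a f) Ph2_cycle = 1"
proof -
  have c0: "c [w] = 0" if "w \<noteq> [8]" for w using h_memD(2)[OF c] that by simp
  have "Ph2_cycle \<in> bar (Suc 4) 16 (P_monoms 0)" using Ph2_cycle_tame by (simp add: tame_def numeral_eq_Suc)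
  then have "cochain_eval (cup 4 e c) Ph2_cycle = 0"
    using cochain_eval_cup_last[OF Ph2_cycle_last_not, of 4 16 "P_monoms 0" c e] c0 by blast
  moreover have "cochain_eval (cup 1 a f) Ph2_cycle = cochain_eval f (divpow Q1 4)"
  proof -
    have a': "a = (\<lambda>ws. if ws = [[4]] then 1 else 0)" using h_memD(2)[OF a] by simp
    \<comment> \<open>Sorted by first entry. The representative of \<open>h_2\<close> is nonzero on
      the word \<open>[4]\<close> alone, so \<open>Q1\<close>, \<open>R2\<close> and
      \<open>Sq1\<close> contribute nothing.\<close>
    have eq: "Ph2_cycle = Sq4 \<rhd> divpow Q1 4 + Q1 \<rhd> shuffle Sq4 Q1 3 + (R2 \<rhd> shuffle Sq1 Q1 3 + Sq1 \<rhd> shuffle R2 Q1 3 + Q1 \<rhd> shuffle2 R2 Sq1 Q1 2)"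
      using shuffle.simps(2)[of Sq4 Q1 3] shuffle2.simps(2)[of R2 Sq1 Q1 2] by (simp add: Ph2_cycle_def del: shuffle.simps shuffle2.simps divpow.simps)
    have "lin (\<lambda>w. a [w]) Sq4 = 1" "lin (\<lambda>w. a [w]) Q1 = 0" "lin (\<lambda>w. a [w]) R2 = 0" "lin (\<lambda>w. a [w]) Sq1 = 0"
      by (simp_all add: a' Q1_def R2_def wd_mult)
    then show ?thesis
      unfolding eq cochain_eval_add cochain_eval_cup_pre by (simp only: mult_zero_left mult_1_left add_0_right)
  qed
  moreover have "cochain_eval f (divpow Q1 4) = 1"
  proof -
    have "cochain_eval f (divpow Q1 4) = cochain_eval f (bar_d (sq_shuffle 4 4))"
      using cochains_vanish[OF f(1) Q1_power_boundary]
      by (simp only: cochain_eval_add add_eq_0_iff_eq)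
    also have "\<dots> = cochain_eval (cup 4 b c) (sq_shuffle 4 4)"
      using cochain_eval_bar_d_coboundary[OF sq_shuffle_bar] f(2) by simp
    \<comment> \<open>The unique term ending in \<open>Sq^8\<close> is separated off;
      \<open>c\<close> kills the rest.\<close>
    also have "\<dots> = cochain_eval (cup 4 b c) (sq_shuffle 4 4 + Poly_Mapping.single (replicate 4 [1] @ [[8]], 0) 1)
       + cochain_eval (cup 4 b c) (Poly_Mapping.single (replicate 4 [1] @ [[8]], 0) 1)"
      by (simp only: cochain_eval_add cochain_eval_single add.assoc add_self add_0_right)
    also have "cochain_eval (cup 4 b c) (sq_shuffle 4 4 + Poly_Mapping.single (replicate 4 [1] @ [[8]], 0) 1) = 0"
    proof (rule cochain_eval_cup_last[OF sq_shuffle_4])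
      show "c [w] = 0" if "w \<noteq> [8]" for w using that by (rule c0)
      show "sq_shuffle 4 4 + Poly_Mapping.single (replicate 4 [1] @ [[8]], 0) 1 \<in> bar (Suc 4) 12 (P_monoms 0)"
        using sq_shuffle_bar[of 4 4]
        by (intro bar_add) (simp_all add: bar_def P_monoms_def bar_word_list_def is_word_def words_deg_def expo_deg_def eval_nat_numeral)
    qed
    also have "cochain_eval (cup 4 b c) (Poly_Mapping.single (replicate 4 [1] @ [[8]], 0) 1) = 1"
      using ext_power_h0[OF b] h_memD(2)[OF c] by (simp add: cup_def)
    finally show ?thesis by simp
  qed
  ultimately show ?thesis by (simp add: cochain_eval_plus)
qed

lemma ext_coboundaries_0: "0 \<in> ext_coboundaries s t"
proof (cases s)
  case (Suc r)
  have "0 \<in> cochains r t" by (simp add: cochains_def cochain_eval_vanish)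
  then have "coboundary 0 \<in> coboundary ` cochains r t" by (rule imageI)
  then show ?thesis using Suc by (simp add: coboundary_zero)
qed simp

lemma cup_zero_left: "cup p 0 b = 0" and cup_zero_right: "cup p b 0 = 0"
  by (simp_all add: cup_def fun_eq_iff)

text \<open>By the Leibniz rule both summands have coboundary equal to the triple product of
  \<open>a\<close>, \<open>b\<close>, \<open>c\<close>, which is strictly associative on
  cochains.\<close>

lemma massey_cocycle:
  assumes a: "a \<in> ext_cocycles 1 4" and b: "b \<in> ext_cocycles 4 4" and c: "c \<in> ext_cocycles 1 8"
    and e: "e \<in> cochains 4 8" "coboundary e = cup 1 a b"
    and f: "f \<in> cochains 4 12" "coboundary f = cup 4 b c"
  shows "cup 4 e c + cup 1 a f \<in> ext_cocycles 5 16"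
proof -
  have c': "a \<in> cochains 1 4" "coboundary a = 0" "c \<in> cochains 1 8" "coboundary c = 0"
    using a c by (auto simp: ext_cocycles_def)
  have "cup 4 e c \<in> cochains 5 16" "cup 1 a f \<in> cochains 5 16"
    using cup_cochains[OF e(1) c'(3)] cup_cochains[OF c'(1) f(1)] by simp_all
  moreover have "coboundary (cup 4 e c) = cup 5 (cup 1 a b) c"
    using coboundary_cup[OF e(1) c'(3)] by (simp add: c' e(2) cup_zero_right)
  moreover have "coboundary (cup 1 a f) = cup 1 a (cup 4 b c)"
    using coboundary_cup[OF c'(1) f(1)] by (simp add: c' f(2) cup_zero_left)
  moreover have "cup 5 (cup 1 a b) c = cup 1 a (cup 4 b c)"
    by (rule ext) (simp add: cup_def drop_take mult.assoc)
  moreover have "x + x = 0" for x :: cochain by (rule ext) (simp only: plus_fun_apply add_self zero_fun_apply)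
  ultimately show ?thesis by (simp only: ext_cocycles_def mem_Collect_eq cochains_add coboundary_add)
qed

section \<open>Comparison with the transfer\<close>

theorem theorem1p2:
  fixes Ph2 :: "cochain set"
  assumes "Ph2 \<in> adams_P (1, 4) (h 2)"
  shows "Ph2 \<notin> Tr 5 11 ` PH_coinvariants 5 11"
proof
  assume "Ph2 \<in> Tr 5 11 ` PH_coinvariants 5 11"
  then obtain C where C: "C \<in> PH_coinvariants 5 11" and Ph2: "Ph2 = Tr 5 11 C" by auto
  from assms obtain a b c e f where Ph2_eq: "Ph2 = ext_class 5 16 (cup 4 e c + cup 1 a f)"
    and abc: "a \<in> h 2" "b \<in> ext_power (1, 1) (h 0) 4" "c \<in> h 3"
    and e: "e \<in> cochains 4 8" "coboundary e = cup 1 a b"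
    and f: "f \<in> cochains 4 12" "coboundary f = cup 4 b c"
    unfolding adams_P_def massey.simps by (auto simp del: One_nat_def)
  let ?c = "cup 4 e c + cup 1 a f"
  have "?c \<in> ext_cocycles 5 16"
    using h_memD(1)[OF abc(1)] ext_power_h0[OF abc(2)] h_memD(1)[OF abc(3)] e f
    by (intro massey_cocycle) auto
  then have "?c \<in> Ph2" using ext_coboundaries_0 by (simp add: Ph2_eq ext_class_iff)
  \<comment> \<open>The assumed equality places the Massey cocycle in the union defining
    \<open>Tr\<close>, so its values on homology are given by some primitive
    \<open>g\<close>.\<close>
  then obtain g where "g \<in> C" and g: "?c \<in> transfer_PH 5 11 g" by (auto simp: Ph2 Tr_def)
  have gPH: "g \<in> PH 5 11"
    using C \<open>g \<in> C\<close> by (auto simp: PH_coinvariants_def quotient_def cong_mod_def)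
  have cycle: "Ph2_cycle \<in> tor_cycles 5 16 0"
    using Ph2_cycle_tame rel_span_null_bar_rel[OF bar_d_Ph2_cycle] by (simp add: tor_cycles_def tame_def)
  define X where "X = cong_mod (tor_cycles 5 16 0) (tor_boundaries 5 16 0) `` {Ph2_cycle}"
  have X: "X \<in> Tor 5 16 0" unfolding X_def Tor_def by (rule quotientI[OF cycle])
  have "0 \<in> tor_boundaries 5 16 0"
    by (auto simp: tor_boundaries_def zero_bar intro!: bexI[of _ 0])
  then have zX: "Ph2_cycle \<in> X" using cycle by (simp add: X_def cong_mod_def)
  \<comment> \<open>After five steps no bar entry is left: \<open>y\<close> is a polynomial of
    degree 11 whose monomials have at most one odd exponent.\<close>
  obtain y where y: "y \<in> connecting_iter 5 11 5 X" "y \<in> tame (5 - 5) (int (5 - 5) + 11) 5"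
    using connecting_iter_ex[of Ph2_cycle 5 11 X 5] Ph2_cycle_tame bar_d_Ph2_cycle zX by auto
  have "cochain_eval ?c Ph2_cycle = lin (\<lambda>(ws, m). g m) y"
    using g X zX y(1) by (auto simp: transfer_PH_def tor_transfer_def)
  also have "\<dots> = 0"
  proof -
    have "g m = 0" if "(ws, m) \<in> Poly_Mapping.keys y" for ws m
    proof (rule PH_vanishes[OF gPH])
      show "m \<in> P_monoms 5" "expo_deg m = 11" "card (odd_vars m) \<le> 1"
        using y(2) that by (auto simp: tame_def bar_def words_deg_def)
    qed
    then show ?thesis by (auto simp: lin_def intro!: sum.neutral)
  qed
  finally show False using massey_eval[OF abc f] by simp
qed

end
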